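(* The following decision problem is $\mathbf{NP}$-complete: given a $3$-regular graph $G$, decide whether $\eta(G)=2$.
   Context: All graphs are finite and simple. A lucky labeling of a graph $G$ is a function $\ell: V(G)\to\mathbb{N}$ such that for every two adjacent vertices $u,v$ of $G$ we have $\sum_{w\sim u}\ell(w)\neq\sum_{w\sim v}\ell(w)$, where $w\sim x$ means $w$ is adjacent to $x$. The lucky number $\eta(G)$ is the minimum positive integer $k$ such that $G$ has a lucky labeling $\ell: V(G)\to\{1,\dots,k\}$. A graph is $3$-regular if every vertex has degree $3$. *)

theory Defs
  imports
    "HOL-Computational_Algebra.Polynomial"
    "HOL-Library.Nat_Bijection"
    "Graph_Theory.Graph_Theory"
begin

section \<open>Deterministic multi-tape Turing machines\<close>

datatype move = MoveLeft | MoveStay | MoveRight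

text \<open>
  States are the numbers below \<open>tm_states\<close>, tape symbols the numbers below \<open>tm_symbols\<close>.
  Symbol 0 is the blank; symbols 1 and 2 represent the bits 0 and 1.
  The transition function maps a state and the scanned symbols (one per tape) to the new
  state and, for each tape, the symbol written and the head movement.
\<close>

record tm =
  tm_tapes :: nat
  tm_states :: nat
  tm_symbols :: nat
  tm_start :: nat
  tm_accept :: nat
  tm_reject :: nat
  tm_delta :: "nat \<Rightarrow> nat list \<Rightarrow> nat \<times> (nat \<times> move) list"

definition tm_wf :: "tm \<Rightarrow> bool" where
  "tm_wf M \<longleftrightarrow>
     0 < tm_tapes M \<and> 3 \<le> tm_symbols M \<and>
     tm_start M < tm_states M \<and> tm_accept M < tm_states M \<and> tm_reject M < tm_states M \<and>
     tm_accept M \<noteq> tm_reject M \<and>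
     (\<forall>q < tm_states M. \<forall>as. length as = tm_tapes M \<and> set as \<subseteq> {..<tm_symbols M} \<longrightarrow>
        (case tm_delta M q as of (q', acts) \<Rightarrow>
           q' < tm_states M \<and> length acts = tm_tapes M \<and>
           (\<forall>(b, m) \<in> set acts. b < tm_symbols M)))"

text \<open>A two-way infinite tape together with the head position.\<close>

type_synonym tape = "(int \<Rightarrow> nat) \<times> int"

type_synonym config = "nat \<times> tape list"

fun scan :: "tape \<Rightarrow> nat" where
  "scan (t, h) = t h"

fun move_head :: "move \<Rightarrow> int \<Rightarrow> int" where
  "move_head MoveLeft h = h - 1"
| "move_head MoveStay h = h"
| "move_head MoveRight h = h + 1"

fun act :: "nat \<times> move \<Rightarrow> tape \<Rightarrow> tape" where
  "act (b, m) (t, h) = (t(h := b), move_head m h)"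

definition halting :: "tm \<Rightarrow> nat \<Rightarrow> bool" where
  "halting M q \<longleftrightarrow> q = tm_accept M \<or> q = tm_reject M"

text \<open>
  Halted configurations are fixed points of \<open>step\<close>, so being in a halting state after
  \<open>n\<close> iterations means having halted within \<open>n\<close> steps.
\<close>

fun step :: "tm \<Rightarrow> config \<Rightarrow> config" where
  "step M (q, ts) =
     (if halting M q then (q, ts)
      else case tm_delta M q (map scan ts) of (q', acts) \<Rightarrow> (q', map2 act acts ts))"

definition bit_symbol :: "bool \<Rightarrow> nat" where
  "bit_symbol b = (if b then 2 else 1)"

definition string_cells :: "bool list \<Rightarrow> int \<Rightarrow> nat" where
  "string_cells x i = (if 0 \<le> i \<and> i < int (length x) then bit_symbol (x ! nat i) else 0)"

text \<open>Each input string is placed on a tape of its own; the remaining tapes are blank.\<close>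

definition init_config :: "tm \<Rightarrow> bool list list \<Rightarrow> config" where
  "init_config M xs =
     (tm_start M,
      map (\<lambda>x. (string_cells x, 0)) xs
        @ replicate (tm_tapes M - length xs) (string_cells [], 0))"

definition run :: "tm \<Rightarrow> bool list list \<Rightarrow> nat \<Rightarrow> config" where
  "run M xs n = (step M ^^ n) (init_config M xs)"

definition halts_within :: "tm \<Rightarrow> bool list list \<Rightarrow> nat \<Rightarrow> bool" where
  "halts_within M xs n \<longleftrightarrow> halting M (fst (run M xs n))"

definition accepts :: "tm \<Rightarrow> bool list list \<Rightarrow> bool" where
  "accepts M xs \<longleftrightarrow> (\<exists>n. fst (run M xs n) = tm_accept M)"

section \<open>NP-completeness\<close>

text \<open>The output is the complete contents of the last tape on halting.\<close>

definition polytime_computable :: "(bool list \<Rightarrow> bool list) \<Rightarrow> bool" where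
  "polytime_computable f \<longleftrightarrow>
     (\<exists>M (p :: nat poly). tm_wf M \<and>
        (\<forall>x. halts_within M [x] (poly p (length x)) \<and>
             fst (last (snd (run M [x] (poly p (length x))))) = string_cells (f x)))"

text \<open>
  Languages with polynomial-time verifiable certificates of polynomial length; the verifier
  gets the input on its first and the certificate on its second tape.
\<close>

definition NP :: "bool list set set" where
  "NP = {L. \<exists>M (p :: nat poly) (r :: nat poly). tm_wf M \<and> 2 \<le> tm_tapes M \<and>
          (\<forall>x u. halts_within M [x, u] (poly r (length x + length u))) \<and>
          (\<forall>x. x \<in> L \<longleftrightarrow> (\<exists>u. length u \<le> poly p (length x) \<and> accepts M [x, u]))}"

definition polytime_reducible :: "bool list set \<Rightarrow> bool list set \<Rightarrow> bool" where
  "polytime_reducible A B \<longleftrightarrow>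
     (\<exists>f. polytime_computable f \<and> (\<forall>x. x \<in> A \<longleftrightarrow> f x \<in> B))"

definition NP_complete :: "bool list set \<Rightarrow> bool" where
  "NP_complete L \<longleftrightarrow> L \<in> NP \<and> (\<forall>A \<in> NP. polytime_reducible A L)"

section \<open>Graphs and lucky labelings\<close>

text \<open>
  A finite simple graph is a \<open>pair_graph\<close>: finite, loop-free, with a symmetric arc relation.
  Hence the degree of a vertex is its \<open>out_degree\<close>.
\<close>

definition regular :: "nat \<Rightarrow> 'a pair_pre_digraph \<Rightarrow> bool" where
  "regular d G \<longleftrightarrow> (\<forall>v \<in> pverts G. out_degree (with_proj G) v = d)"

definition lucky_labeling :: "'a pair_pre_digraph \<Rightarrow> ('a \<Rightarrow> nat) \<Rightarrow> bool" where
  "lucky_labeling G l \<longleftrightarrow>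
     (\<forall>u v. (u, v) \<in> parcs G \<longrightarrow>
        (\<Sum>w | (w, u) \<in> parcs G. l w) \<noteq> (\<Sum>w | (w, v) \<in> parcs G. l w))"

definition lucky_number :: "'a pair_pre_digraph \<Rightarrow> nat" where
  "lucky_number G =
     (LEAST k. 0 < k \<and> (\<exists>l. lucky_labeling G l \<and> (\<forall>v \<in> pverts G. l v \<in> {1..k})))"

text \<open>The minimum defining the lucky number is always taken over a nonempty set.\<close>

lemma lucky_labeling_exists:
  assumes "pair_graph G"
  shows "\<exists>k>0. \<exists>l. lucky_labeling G l \<and> (\<forall>v \<in> pverts G. l v \<in> {1..k})"
proof -
  interpret pair_graph G by fact
  obtain f :: "_ \<Rightarrow> nat" where f: "inj_on f (pverts G)"
    using pair_finite_verts finite_imp_inj_to_nat_seg by blast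
  define l where "l = (\<lambda>v. (2::nat) ^ f v)"
  have sub: "{w. (w, u) \<in> parcs G} \<subseteq> pverts G" for u
    using in_arcsD1 by auto
  have enc: "(\<Sum>w | (w, u) \<in> parcs G. l w) = set_encode (f ` {w. (w, u) \<in> parcs G})" for u
    unfolding set_encode_def l_def
    by (subst sum.reindex) (use f sub in \<open>auto intro: inj_on_subset simp: comp_def\<close>)
  have "lucky_labeling G l"
    unfolding lucky_labeling_def
  proof (intro allI impI notI)
    fix u v
    assume uv: "(u, v) \<in> parcs G"
      and eq: "(\<Sum>w | (w, u) \<in> parcs G. l w) = (\<Sum>w | (w, v) \<in> parcs G. l w)"
    have fin: "finite (f ` {w. (w, x) \<in> parcs G})" for x
      using sub pair_finite_verts finite_subset by blast
    have "f ` {w. (w, u) \<in> parcs G} = f ` {w. (w, v) \<in> parcs G}"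
      using eq fin by (simp add: enc set_encode_eq)
    then have "{w. (w, u) \<in> parcs G} = {w. (w, v) \<in> parcs G}"
      using inj_on_image_eq_iff[OF f sub sub] by blast
    then have "(u, u) \<in> parcs G" using uv by blast
    then show False using pair_no_loops by fastforce
  qed
  moreover have "l v \<in> {1..Suc (\<Sum>w\<in>pverts G. l w)}" if "v \<in> pverts G" for v
    using that pair_finite_verts member_le_sum[of v "pverts G" l]
    by (auto simp: l_def intro: le_SucI)
  ultimately show ?thesis by blast
qed

section \<open>Graph problems as languages\<close>

text \<open>The number of vertices in unary, a separating 0, and the adjacency matrix row by row.\<close>

definition encode_graph :: "nat pair_pre_digraph \<Rightarrow> bool list" where
  "encode_graph G = (let n = card (pverts G) in
     replicate n True @ [False] @
     concat (map (\<lambda>i. map (\<lambda>j. (i, j) \<in> parcs G) [0..<n]) [0..<n]))"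

text \<open>
  Every finite simple graph is isomorphic to one with vertices \<open>0, \<dots>, n - 1\<close>, so it is
  enough to encode these.
\<close>

definition graph_problem :: "(nat pair_pre_digraph \<Rightarrow> bool) \<Rightarrow> bool list set" where
  "graph_problem P =
     {encode_graph G | G. pair_graph G \<and> pverts G = {..<card (pverts G)} \<and> P G}"

end

theory Submission
  imports Defs "HOL-Library.Countable_Set"
begin

text \<open>
  Membership in NP: a vertex set, the vertices labelled 2, is a certificate, and on a nonempty
  cubic graph the constant labeling is never lucky.

  Hardness: an accepting computation of a verifier, with tapes described relative to their heads,
  is a choice of one tile for every pair of a time and a tape position that avoids certain
  conflicts between two tiles. Hence it is a satisfying assignment of clauses that are either
  positive (some tile is chosen) or negative (two conflicting tiles are not both chosen).
  Subtracting 1 from the labels, a labeling of a cubic graph by 1 and 2 becomes a 0/1-labeling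
  with the same property. Two triangles sharing an edge (a diamond) then transport a bit, and four
  gadgets on eight vertices act as constraints on four such bits. Placing them on a torus whose rows
  are variables and whose columns are clauses gives a cubic graph that has a lucky 0/1-labeling
  iff the clauses are satisfiable. All the functions involved are built from arithmetic on numbers
  of polynomial size and bounded sums, and such functions are computed by Turing machines whose
  tapes serve as unary counters.
\<close>

section \<open>Counter programs on Turing machines\<close>

datatype cmd = Skip | Inc nat | Dec nat | Out bool | Seq cmd cmd
  | Ite nat nat cmd cmd | Until nat nat cmd

fun next_cmds :: "cmd list \<Rightarrow> (nat \<Rightarrow> nat) \<Rightarrow> cmd list" where
  "next_cmds (Seq a b # K) s = a # b # K"
| "next_cmds (Ite i v a b # K) s = (if s i = v then a else b) # K"
| "next_cmds (Until i v c # K) s = (if s i = v then K else c # Until i v c # K)"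
| "next_cmds K s = tl K"

fun cmd_move :: "cmd list \<Rightarrow> nat \<Rightarrow> move" where
  "cmd_move (Inc i # K) j = (if i = j then MoveRight else MoveStay)"
| "cmd_move (Dec i # K) j = (if i = j then MoveLeft else MoveStay)"
| "cmd_move K j = MoveStay"

fun emit :: "cmd list \<Rightarrow> bool list" where
  "emit (Out b # K) = [b]"
| "emit K = []"

type_synonym inputs = "bool list \<times> bool list"

text \<open>Tapes 0 and 1 hold the inputs; every other tape is a counter: its value is the position
  of the head, and the origin is marked so that zero can be recognised.\<close>

definition tape_cells :: "inputs \<Rightarrow> nat \<Rightarrow> int \<Rightarrow> nat" where
  "tape_cells z i = (if i = 0 then string_cells (fst z) else if i = 1 then string_cells (snd z)
     else (\<lambda>p. if p = 0 then 1 else 0))"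

type_synonym cmd_state = "cmd list \<times> (nat \<Rightarrow> int) \<times> bool list"

fun cmd_step :: "inputs \<Rightarrow> cmd_state \<Rightarrow> cmd_state" where
  "cmd_step z (K, h, w) = (next_cmds K (\<lambda>i. tape_cells z i (h i)),
     (\<lambda>j. move_head (cmd_move K j) (h j)), w @ emit K)"

fun continuations :: "cmd \<Rightarrow> cmd list \<Rightarrow> cmd list set" where
  "continuations (Seq a b) K =
     insert (Seq a b # K) (continuations a (b # K) \<union> continuations b K)"
| "continuations (Ite i v a b) K =
     insert (Ite i v a b # K) (continuations a K \<union> continuations b K)"
| "continuations (Until i v c) K = insert (Until i v c # K) (continuations c (Until i v c # K))"
| "continuations c K = {c # K}"

fun tapes_tested :: "cmd \<Rightarrow> nat set" where
  "tapes_tested (Seq a b) = tapes_tested a \<union> tapes_tested b"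
| "tapes_tested (Ite i v a b) = insert i (tapes_tested a \<union> tapes_tested b)"
| "tapes_tested (Until i v c) = insert i (tapes_tested c)"
| "tapes_tested c = {}"

lemma finite_continuations: "finite (continuations c K)"
  by (induction c K rule: continuations.induct) auto

lemma finite_tapes_tested: "finite (tapes_tested c)"
  by (induction c) auto

lemma Cons_in_continuations: "c # K \<in> continuations c K"
  by (cases c) auto

lemma next_cmds_in_continuations:
  "L \<in> continuations c K \<Longrightarrow> next_cmds L s \<in> insert K (continuations c K)"
proof (induction c arbitrary: K L)
  case (Seq a b)
  then show ?case
    using Cons_in_continuations[of a "b # K"] Cons_in_continuations[of b K] by fastforce
next
  case (Ite i v a b)
  from Ite.prems consider "L = Ite i v a b # K" | "L \<in> continuations a K" | "L \<in> continuations b K"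
    by auto
  then show ?case
    by cases (use Ite.IH Cons_in_continuations[of a K] Cons_in_continuations[of b K] in auto)
next
  case (Until i v c)
  from Until.prems consider "L = Until i v c # K" | "L \<in> continuations c (Until i v c # K)" by auto
  then show ?case
    by cases (use Until.IH Cons_in_continuations[of c "Until i v c # K"] in auto)
qed auto

lemma tapes_tested_continuations:
  "L \<in> continuations c K \<Longrightarrow> \<Union> (tapes_tested ` set L) \<subseteq> tapes_tested c \<union> \<Union> (tapes_tested ` set K)"
proof (induction c arbitrary: K L)
  case (Seq a b)
  from Seq.prems consider "L = Seq a b # K" | "L \<in> continuations a (b # K)"
    | "L \<in> continuations b K"
    by auto
  then show ?case
    by cases (use Seq.IH(1)[of L "b # K"] Seq.IH(2)[of L K] in auto)
next
  case (Ite i v a b)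
  from Ite.prems consider "L = Ite i v a b # K" | "L \<in> continuations a K" | "L \<in> continuations b K"
    by auto
  then show ?case
    by cases (use Ite.IH(1)[of L K] Ite.IH(2)[of L K] in auto)
next
  case (Until i v c)
  from Until.prems consider "L = Until i v c # K" | "L \<in> continuations c (Until i v c # K)" by auto
  then show ?case
    by cases (use Until.IH[of L "Until i v c # K"] in auto)
qed auto

lemma next_cmds_cong:
  assumes "\<And>i. i \<in> \<Union> (tapes_tested ` set K) \<Longrightarrow> s i = s' i"
  shows "next_cmds K s = next_cmds K s'"
  using assms by (cases "(K, s)" rule: next_cmds.cases) auto

lemma string_cells_snoc:
  "string_cells (w @ [b]) = (string_cells w)(int (length w) := bit_symbol b)"
  by (auto simp: string_cells_def fun_eq_iff nth_append nat_less_iff)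

lemma string_cells_end: "string_cells w (int (length w)) = 0"
  by (simp add: string_cells_def)

lemma funpow_step_halted: "halting M (fst c) \<Longrightarrow> (step M ^^ n) c = c"
  by (induction n) (cases c; auto)+

lemma run_halted:
  assumes "halting M (fst (run M xs m))" "m \<le> n"
  shows "run M xs n = run M xs m"
proof -
  have "run M xs n = (step M ^^ (n - m)) (run M xs m)"
    using assms(2) by (simp add: run_def flip: funpow_add[THEN fun_cong, unfolded comp_def])
  then show ?thesis using funpow_step_halted[OF assms(1)] by simp
qed

subsection \<open>The machine of a counter program\<close>

context
  fixes prog :: cmd
begin

definition control :: "cmd list set" where
  "control = insert [] (continuations prog [])"

definition tape_count :: nat where
  "tape_count = Max (insert 3 (Suc ` tapes_tested prog))"

abbreviation state_of :: "cmd list \<Rightarrow> nat" where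
  "state_of K \<equiv> 3 + to_nat_on control K"

definition map_tapes :: "(nat \<Rightarrow> 'a) \<Rightarrow> 'a list" where
  "map_tapes f = map f [0..<Suc tape_count]"

text \<open>State 0 marks the origins of the counters, state 1 accepts, state 2 rejects, and the other
  states are the finitely many continuations of the program. The last tape receives the output.
  Counter 2 holds the verdict: it is positive iff the head has left the marked origin.\<close>

definition machine_delta :: "nat \<Rightarrow> nat list \<Rightarrow> nat \<times> (nat \<times> move) list" where
  "machine_delta q as = (let K = from_nat_into control (q - 3) in
     if q = 0 then (state_of [prog],
       map_tapes (\<lambda>i. (if 2 \<le> i \<and> i < tape_count then 1 else as ! i, MoveStay)))
     else if K = [] then (if as ! 2 = 0 then 1 else 2, map_tapes (\<lambda>i. (as ! i, MoveStay)))
     else (state_of (next_cmds K ((!) as)), map_tapes (\<lambda>i.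
       if i < tape_count then (as ! i, cmd_move K i)
       else case emit K of [] \<Rightarrow> (as ! i, MoveStay) | b # _ \<Rightarrow> (bit_symbol b, MoveRight))))"

definition machine :: tm where
  "machine = \<lparr>tm_tapes = Suc tape_count, tm_states = 3 + card control, tm_symbols = 3,
     tm_start = 0, tm_accept = 1, tm_reject = 2, tm_delta = machine_delta\<rparr>"

lemma machine_simps [simp]:
  "tm_tapes machine = Suc tape_count" "tm_states machine = 3 + card control"
  "tm_symbols machine = 3"
  "tm_start machine = 0" "tm_accept machine = 1" "tm_reject machine = 2"
  "tm_delta machine = machine_delta"
  by (simp_all add: machine_def)

lemma finite_control: "finite control"
  by (simp add: control_def finite_continuations)

lemma tape_count_ge: "3 \<le> tape_count"
  by (simp add: tape_count_def finite_tapes_tested)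

lemma length_map_tapes [simp]: "length (map_tapes f) = Suc tape_count"
  by (simp add: map_tapes_def)

lemma nth_map_tapes [simp]: "i \<le> tape_count \<Longrightarrow> map_tapes f ! i = f i"
  by (simp add: map_tapes_def del: upt_Suc)

lemma map_map_tapes [simp]: "map f (map_tapes g) = map_tapes (\<lambda>i. f (g i))"
  by (simp add: map_tapes_def comp_def)

lemma map2_map_tapes [simp]: "map2 f (map_tapes g) (map_tapes h) = map_tapes (\<lambda>i. f (g i) (h i))"
  by (simp add: map_tapes_def map2_map_map del: upt_Suc)

lemma map_tapes_cong: "(\<And>i. i \<le> tape_count \<Longrightarrow> f i = g i) \<Longrightarrow> map_tapes f = map_tapes g"
  by (simp add: map_tapes_def)

lemma prog_in_control: "[prog] \<in> control"
  by (simp add: control_def Cons_in_continuations)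

lemma next_cmds_in_control: "K \<in> control \<Longrightarrow> next_cmds K s \<in> control"
  using next_cmds_in_continuations[of K prog "[]" s] by (auto simp: control_def)

lemma tapes_tested_less_tape_count:
  assumes "K \<in> control" "i \<in> \<Union> (tapes_tested ` set K)"
  shows "i < tape_count"
proof -
  have "i \<in> tapes_tested prog"
    using assms tapes_tested_continuations[of K prog "[]"] by (auto simp: control_def)
  then have "Suc i \<le> tape_count"
    unfolding tape_count_def by (intro Max_ge) (simp_all add: finite_tapes_tested)
  then show ?thesis by simp
qed

lemma state_of_less: "K \<in> control \<Longrightarrow> to_nat_on control K < card control"
  using bij_betw_apply[OF to_nat_on_finite[OF finite_control]] by simp

lemma countable_control [simp]: "countable control"
  by (simp add: countable_finite finite_control)

lemma tm_wf_machine: "tm_wf machine"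
  unfolding tm_wf_def machine_simps
proof (intro conjI allI impI)
  fix q and as :: "nat list"
  assume "length as = Suc tape_count \<and> set as \<subseteq> {..<3}"
  then have symbol: "as ! i < 3" if "i \<le> tape_count" for i
    using that nth_mem[of i as] by (metis le_imp_less_Suc lessThan_iff subsetD)
  have "from_nat_into control (q - 3) \<in> control" by (rule from_nat_into) (simp add: control_def)
  then show "case machine_delta q as of (q', acts) \<Rightarrow> q' < 3 + card control \<and>
      length acts = Suc tape_count \<and> (\<forall>(b, m) \<in> set acts. b < 3)"
    using symbol state_of_less[OF prog_in_control] state_of_less[OF next_cmds_in_control]
    by (auto simp: machine_delta_def Let_def map_tapes_def bit_symbol_def split: list.splits)
qed auto

definition machine_tapes :: "inputs \<Rightarrow> (nat \<Rightarrow> int) \<Rightarrow> bool list \<Rightarrow> tape list" where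
  "machine_tapes z h w = map_tapes (\<lambda>i.
     if i < tape_count then (tape_cells z i, h i) else (string_cells w, int (length w)))"

fun machine_config :: "inputs \<Rightarrow> cmd_state \<Rightarrow> config" where
  "machine_config z (K, h, w) = (state_of K, machine_tapes z h w)"

lemma step_machine_config:
  assumes "K \<in> control" "K \<noteq> []"
  shows "step machine (machine_config z (K, h, w)) = machine_config z (cmd_step z (K, h, w))"
proof -
  let ?symbols = "map scan (machine_tapes z h w)"
  let ?write = "case emit K of [] \<Rightarrow> (0, MoveStay) | b # _ \<Rightarrow> (bit_symbol b, MoveRight)"
  have symbols: "?symbols ! i = tape_cells z i (h i)" if "i < tape_count" for i
    using that by (simp add: machine_tapes_def)
  have "next_cmds K ((!) ?symbols) = next_cmds K (\<lambda>i. tape_cells z i (h i))"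
    using symbols tapes_tested_less_tape_count[OF assms(1)] by (intro next_cmds_cong) blast
  moreover have "?symbols ! tape_count = 0"
    by (simp add: machine_tapes_def string_cells_end)
  ultimately have delta: "machine_delta (state_of K) ?symbols =
      (state_of (next_cmds K (\<lambda>i. tape_cells z i (h i))),
       map_tapes (\<lambda>i. if i < tape_count then (tape_cells z i (h i), cmd_move K i) else ?write))"
    using assms symbols
    by (auto simp: machine_delta_def Let_def simp del: map_map_tapes intro!: map_tapes_cong
        split: list.splits)
  have "act ?write (string_cells w, int (length w)) =
      (string_cells (w @ emit K), int (length (w @ emit K)))"
    by (cases K rule: emit.cases) (auto simp: string_cells_snoc string_cells_end fun_upd_idem)
  then show ?thesis
    unfolding machine_config.simps cmd_step.simps step.simps machine_simps delta
    by (auto simp: halting_def machine_tapes_def fun_upd_idem intro!: map_tapes_cong)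
qed

lemma step_machine_final:
  "step machine (machine_config z ([], h, w)) =
    (if h 2 = 0 then tm_reject machine else tm_accept machine, machine_tapes z h w)"
proof -
  let ?symbols = "map scan (machine_tapes z h w)"
  have "?symbols ! 2 = 0 \<longleftrightarrow> h 2 \<noteq> 0"
    using tape_count_ge by (simp add: machine_tapes_def tape_cells_def)
  moreover have "[] \<in> control" by (simp add: control_def)
  ultimately have delta: "machine_delta (state_of []) ?symbols =
      (if h 2 = 0 then 2 else 1, map_tapes (\<lambda>i. (?symbols ! i, MoveStay)))"
    by (simp add: machine_delta_def del: map_map_tapes)
  have "map2 act (map_tapes (\<lambda>i. (?symbols ! i, MoveStay))) (machine_tapes z h w) =
      machine_tapes z h w"
    unfolding machine_tapes_def map_map_tapes map2_map_tapes
    by (intro map_tapes_cong) (simp add: fun_upd_idem)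
  then show ?thesis
    unfolding machine_config.simps step.simps machine_simps delta by (simp add: halting_def)
qed

lemma step_machine_init:
  "step machine (init_config machine [x, u]) = machine_config (x, u) ([prog], \<lambda>_. 0, [])"
proof -
  let ?init = "\<lambda>i. (string_cells (if i = 0 then x else if i = 1 then u else []), 0 :: int)"
  have "snd (init_config machine [x, u]) = map_tapes ?init"
  proof (rule nth_equalityI)
    fix i assume "i < length (snd (init_config machine [x, u]))"
    then show "snd (init_config machine [x, u]) ! i = map_tapes ?init ! i"
      using tape_count_ge by (auto simp: init_config_def nth_Cons split: nat.splits)
  qed (use tape_count_ge in \<open>simp add: init_config_def\<close>)
  then have init: "init_config machine [x, u] = (0, map_tapes ?init)"
    by (simp add: init_config_def)
  have "map2 act (map_tapes (\<lambda>i. (if 2 \<le> i \<and> i < tape_count then 1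
      else map scan (map_tapes ?init) ! i,
      MoveStay))) (map_tapes ?init) = machine_tapes (x, u) (\<lambda>_. 0) []"
    unfolding machine_tapes_def map_map_tapes map2_map_tapes
    using tape_count_ge
    by (intro map_tapes_cong) (auto simp: tape_cells_def string_cells_def fun_eq_iff)
  then show ?thesis
    unfolding init by (simp add: halting_def machine_delta_def del: map_map_tapes map2_map_tapes)
qed

lemma funpow_step_machine_config:
  assumes "(cmd_step z ^^ t) s = ([], h, w)" "fst s \<in> control" "t < n"
  shows "(step machine ^^ n) (machine_config z s) =
    (if h 2 = 0 then tm_reject machine else tm_accept machine, machine_tapes z h w)"
  using assms
proof (induction t arbitrary: s n)
  case 0
  then obtain m where "n = Suc m" by (cases n) auto
  with 0 show ?case
    by (simp add: funpow_Suc_right funpow_step_halted halting_def step_machine_final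
        del: funpow.simps machine_config.simps)
next
  case (Suc t)
  obtain K h' w' where s: "s = (K, h', w')" by (cases s)
  show ?case
  proof (cases "K = []")
    case True
    then have "(cmd_step z ^^ t) s = ([], h, w)" using Suc.prems(1) s by (simp add: funpow_swap1)
    then show ?thesis using Suc by simp
  next
    case False
    obtain m where "n = Suc m" "t < m" using Suc.prems(3) by (cases n) auto
    with Suc False show ?thesis
      unfolding s by (simp add: funpow_Suc_right step_machine_config next_cmds_in_control
        del: funpow.simps machine_config.simps step.simps)
  qed
qed

lemma run_machine:
  assumes "(cmd_step (x, u) ^^ t) ([prog], \<lambda>_. 0, []) = ([], h, w)" "t + 2 \<le> n"
  shows "run machine [x, u] n =
    (if h 2 = 0 then tm_reject machine else tm_accept machine, machine_tapes (x, u) h w)"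
proof -
  obtain m where "n = Suc m" "t < m" using assms(2) by (cases n) auto
  then have "run machine [x, u] n = (step machine ^^ m) (machine_config (x, u) ([prog], \<lambda>_. 0, []))"
    by (simp add: run_def funpow_Suc_right step_machine_init del: funpow.simps machine_config.simps)
  then show ?thesis
    using funpow_step_machine_config[OF assms(1)] prog_in_control \<open>t < m\<close> by simp
qed

lemma last_machine_tapes: "fst (last (machine_tapes z h w)) = string_cells w"
  by (simp add: machine_tapes_def map_tapes_def)

lemma run_machine_single: "run machine [x] n = run machine [x, []] n"
proof -
  have "tape_count = Suc (tape_count - 1)" using tape_count_ge by simp
  then have "init_config machine [x] = init_config machine [x, []]"
    by (simp add: init_config_def) (metis replicate_Suc)
  then show ?thesis by (simp add: run_def)
qed

end

subsection \<open>Executing commands\<close>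

definition exec :: "inputs \<Rightarrow> cmd \<Rightarrow> (nat \<Rightarrow> nat) \<Rightarrow> bool list \<Rightarrow> nat \<Rightarrow>
    (nat \<Rightarrow> nat) \<Rightarrow> bool list \<Rightarrow> bool" where
  "exec z c e w T e' w' \<longleftrightarrow>
     (\<exists>t\<le>T. \<forall>K. (cmd_step z ^^ t) (c # K, int \<circ> e, w) = (K, int \<circ> e', w'))"

lemma execI:
  assumes "\<And>K. (cmd_step z ^^ t) (c # K, int \<circ> e, w) = (K, int \<circ> e', w')" "t \<le> T"
  shows "exec z c e w T e' w'"
  using assms by (auto simp: exec_def)

lemma exec_weaken:
  assumes "exec z c e w T e' w'" "T \<le> T'" "e' = e''"
  shows "exec z c e w T' e'' w'"
  using assms unfolding exec_def by (meson order_trans)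

lemma exec_Skip: "exec z Skip e w 1 e w"
  by (rule execI[where t = 1]) (auto simp: fun_eq_iff)

lemma exec_Inc: "exec z (Inc i) e w 1 (e(i := Suc (e i))) w"
  by (rule execI[where t = 1]) (auto simp: fun_eq_iff)

lemma exec_Dec: "0 < e i \<Longrightarrow> exec z (Dec i) e w 1 (e(i := e i - 1)) w"
  by (rule execI[where t = 1]) (auto simp: fun_eq_iff)

lemma exec_Out: "exec z (Out b) e w 1 e (w @ [b])"
  by (rule execI[where t = 1]) (auto simp: fun_eq_iff)

lemma exec_Seq:
  assumes "exec z a e w T e' w'" "exec z b e' w' T' e'' w''"
  shows "exec z (Seq a b) e w (Suc (T + T')) e'' w''"
proof -
  obtain t where t: "t \<le> T" "\<And>K. (cmd_step z ^^ t) (a # K, int \<circ> e, w) = (K, int \<circ> e', w')"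
    using assms(1) unfolding exec_def by blast
  obtain t' where t': "t' \<le> T'" "\<And>K. (cmd_step z ^^ t') (b # K, int \<circ> e', w') = (K, int \<circ> e'', w'')"
    using assms(2) unfolding exec_def by blast
  have "cmd_step z (Seq a b # K, int \<circ> e, w) = (a # b # K, int \<circ> e, w)" for K
    by (simp add: fun_eq_iff)
  then have "(cmd_step z ^^ Suc (t' + t)) (Seq a b # K, int \<circ> e, w) = (K, int \<circ> e'', w'')" for K
    by (simp only: funpow_Suc_right comp_apply funpow_add t(2) t'(2))
  then show ?thesis by (rule execI) (use t(1) t'(1) in simp)
qed

lemma exec_Ite:
  assumes "exec z (if tape_cells z i (int (e i)) = v then a else b) e w T e' w'"
  shows "exec z (Ite i v a b) e w (Suc T) e' w'"
proof -
  let ?c = "if tape_cells z i (int (e i)) = v then a else b"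
  obtain t where t: "t \<le> T" "\<And>K. (cmd_step z ^^ t) (?c # K, int \<circ> e, w) = (K, int \<circ> e', w')"
    using assms unfolding exec_def by blast
  have "cmd_step z (Ite i v a b # K, int \<circ> e, w) = (?c # K, int \<circ> e, w)" for K
    by (simp add: fun_eq_iff)
  then have "(cmd_step z ^^ Suc t) (Ite i v a b # K, int \<circ> e, w) = (K, int \<circ> e', w')" for K
    by (simp only: funpow_Suc_right comp_apply t(2))
  then show ?thesis by (rule execI) (use t(1) in simp)
qed

lemma exec_Until_stop:
  assumes "tape_cells z i (int (e i)) = v"
  shows "exec z (Until i v c) e w 1 e w"
  using assms by (intro execI[where t = 1]) (simp_all add: fun_eq_iff)

lemma exec_Until_go:
  assumes "tape_cells z i (int (e i)) \<noteq> v" "exec z c e w T e' w'"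
    "exec z (Until i v c) e' w' T' e'' w''"
  shows "exec z (Until i v c) e w (Suc (T + T')) e'' w''"
proof -
  obtain t where t: "t \<le> T" "\<And>K. (cmd_step z ^^ t) (c # K, int \<circ> e, w) = (K, int \<circ> e', w')"
    using assms(2) unfolding exec_def by blast
  obtain t' where t': "t' \<le> T'"
    "\<And>K. (cmd_step z ^^ t') (Until i v c # K, int \<circ> e', w') = (K, int \<circ> e'', w'')"
    using assms(3) unfolding exec_def by blast
  have "cmd_step z (Until i v c # K, int \<circ> e, w) = (c # Until i v c # K, int \<circ> e, w)" for K
    using assms(1) by (simp add: fun_eq_iff)
  then have "(cmd_step z ^^ Suc (t' + t)) (Until i v c # K, int \<circ> e, w) = (K, int \<circ> e'', w'')" for K
    by (simp only: funpow_Suc_right comp_apply funpow_add t(2) t'(2))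
  then show ?thesis by (rule execI) (use t(1) t'(1) in simp)
qed

lemma exec_Until:
  assumes "\<And>m. m < n \<Longrightarrow> tape_cells z i (int (E m i)) \<noteq> v"
    and "\<And>m. m < n \<Longrightarrow> exec z c (E m) (W m) T (E (Suc m)) (W (Suc m))"
    and "tape_cells z i (int (E n i)) = v"
  shows "exec z (Until i v c) (E 0) (W 0) (Suc (n * Suc T)) (E n) (W n)"
  using assms
proof (induction n arbitrary: E W)
  case 0
  then show ?case using exec_Until_stop by simp
next
  case (Suc n)
  have "exec z (Until i v c) (E (Suc 0)) (W (Suc 0)) (Suc (n * Suc T)) (E (Suc n)) (W (Suc n))"
    using Suc.IH[of "\<lambda>m. E (Suc m)" "\<lambda>m. W (Suc m)"] Suc.prems by auto
  then have "exec z (Until i v c) (E 0) (W 0) (Suc (T + Suc (n * Suc T))) (E (Suc n)) (W (Suc n))"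
    using Suc.prems by (intro exec_Until_go) auto
  then show ?case by (rule exec_weaken) simp_all
qed

lemma counter_zero: "2 \<le> i \<Longrightarrow> tape_cells z i p = Suc 0 \<longleftrightarrow> p = 0"
  by (auto simp: tape_cells_def)

definition count_down :: "nat \<Rightarrow> cmd \<Rightarrow> cmd" where
  "count_down i c = Until i 1 (Seq (Dec i) c)"

lemma exec_count_down:
  assumes i: "2 \<le> i" and n: "e i = n" and E0: "E 0 = e" and W0: "W 0 = w"
    and body: "\<And>m. m < n \<Longrightarrow>
      exec z c ((E m)(i := n - Suc m)) (W m) T ((E (Suc m))(i := n - Suc m)) (W (Suc m))"
  shows "exec z (count_down i c) e w (Suc (n * (T + 3))) ((E n)(i := 0)) (W n)"
proof -
  let ?E = "\<lambda>m. (E m)(i := n - m)"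
  have "exec z (Until i 1 (Seq (Dec i) c)) (?E 0) (W 0) (Suc (n * Suc (Suc (1 + T)))) (?E n) (W n)"
  proof (rule exec_Until)
    fix m assume m: "m < n"
    show "tape_cells z i (int (?E m i)) \<noteq> 1" using m counter_zero[OF i] by simp
    have "exec z (Dec i) (?E m) (W m) 1 ((E m)(i := n - Suc m)) (W m)"
      by (rule exec_weaken[OF exec_Dec]) (use m in auto)
    then show "exec z (Seq (Dec i) c) (?E m) (W m) (Suc (1 + T)) (?E (Suc m)) (W (Suc m))"
      by (rule exec_Seq) (rule body[OF m])
  qed (simp add: counter_zero[OF i])
  moreover have "?E 0 = e" using E0 n by auto
  ultimately show ?thesis
    unfolding count_down_def W0 by (simp add: algebra_simps numeral_3_eq_3)
qed

definition incs :: "nat list \<Rightarrow> cmd" where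
  "incs js = foldr (\<lambda>j. Seq (Inc j)) js Skip"

lemma exec_incs: "exec z (incs js) e w (Suc (2 * length js)) (\<lambda>j. e j + count_list js j) w"
proof (induction js arbitrary: e)
  case Nil
  then show ?case using exec_Skip by (simp add: incs_def)
next
  case (Cons j js)
  show ?case
    using exec_Seq[OF exec_Inc[of z j e w] Cons[of "e(j := Suc (e j))"]]
    by (auto simp: incs_def fun_eq_iff elim!: exec_weaken)
qed

definition drain :: "nat \<Rightarrow> nat list \<Rightarrow> cmd" where
  "drain i js = count_down i (incs js)"

lemma exec_drain:
  assumes "2 \<le> i" "i \<notin> set js"
  shows "exec z (drain i js) e w (Suc (e i * (2 * length js + 4)))
    ((\<lambda>j. e j + e i * count_list js j)(i := 0)) w"
proof -
  let ?E = "\<lambda>m j. e j + m * count_list js j"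
  have "exec z (count_down i (incs js)) e w (Suc (e i * (Suc (2 * length js) + 3)))
      ((?E (e i))(i := 0)) w"
  proof (rule exec_count_down[where E = ?E and W = "\<lambda>_. w"])
    fix m
    show "exec z (incs js) ((?E m)(i := e i - Suc m)) w (Suc (2 * length js))
        ((?E (Suc m))(i := e i - Suc m)) w"
      by (rule exec_weaken[OF exec_incs]) (use assms in \<open>auto simp: fun_eq_iff count_list_0_iff\<close>)
  qed (use assms in auto)
  then show ?thesis by (simp add: drain_def add.commute)
qed

lemma exec_count_down_Dec:
  assumes "2 \<le> i" "i \<noteq> j" "e i \<le> e j"
  shows "exec z (count_down i (Dec j)) e w (Suc (e i * 4)) (e(i := 0, j := e j - e i)) w"
proof -
  let ?E = "\<lambda>m. e(j := e j - m)"
  have "exec z (count_down i (Dec j)) e w (Suc (e i * (1 + 3))) ((?E (e i))(i := 0)) w"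
  proof (rule exec_count_down[where E = ?E and W = "\<lambda>_. w"])
    fix m assume "m < e i"
    then show "exec z (Dec j) ((?E m)(i := e i - Suc m)) w 1 ((?E (Suc m))(i := e i - Suc m)) w"
      by (intro exec_weaken[OF exec_Dec]) (use assms in \<open>auto simp: fun_eq_iff\<close>)
  qed (use assms in auto)
  then show ?thesis by (rule exec_weaken) (use assms in \<open>auto simp: fun_eq_iff\<close>)
qed

definition decrement :: "nat \<Rightarrow> cmd" where
  "decrement i = Ite i 1 Skip (Dec i)"

lemma exec_decrement:
  assumes "2 \<le> i"
  shows "exec z (decrement i) e w 2 (e(i := e i - 1)) w"
proof -
  have "exec z (if tape_cells z i (int (e i)) = 1 then Skip else Dec i) e w 1 (e(i := e i - 1)) w"
  proof (cases "e i = 0")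
    case True
    then have "e(i := e i - 1) = e" by (auto simp: fun_eq_iff)
    with True show ?thesis using exec_Skip[of z e w] assms by (simp add: counter_zero)
  next
    case False
    then show ?thesis using exec_Dec[of e i z w] assms by (simp add: counter_zero)
  qed
  then show ?thesis
    unfolding decrement_def by (intro exec_weaken[OF exec_Ite]) auto
qed

section \<open>Functions computable with polynomially bounded values and time\<close>

definition poly_bounded :: "(nat \<Rightarrow> nat) \<Rightarrow> bool" where
  "poly_bounded T \<longleftrightarrow> (\<exists>p :: nat poly. \<forall>B. T B \<le> poly p B)"

lemma poly_nat_mono: "m \<le> n \<Longrightarrow> poly p m \<le> poly p n" for m n :: nat
  by (induction p) (auto intro: add_mono mult_le_mono)

lemma poly_bounded_const: "poly_bounded (\<lambda>B. c)"
  unfolding poly_bounded_def by (rule exI[of _ "[:c:]"]) simp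

lemma poly_bounded_id: "poly_bounded (\<lambda>B. B)"
  unfolding poly_bounded_def by (rule exI[of _ "[:0, 1:]"]) simp

lemma poly_bounded_add:
  assumes "poly_bounded S" "poly_bounded T" shows "poly_bounded (\<lambda>B. S B + T B)"
proof -
  from assms obtain p q :: "nat poly" where "\<forall>B. S B \<le> poly p B" "\<forall>B. T B \<le> poly q B"
    by (auto simp: poly_bounded_def)
  then have "\<forall>B. S B + T B \<le> poly (p + q) B" by (simp add: add_mono)
  then show ?thesis unfolding poly_bounded_def by blast
qed

lemma poly_bounded_mult:
  assumes "poly_bounded S" "poly_bounded T" shows "poly_bounded (\<lambda>B. S B * T B)"
proof -
  from assms obtain p q :: "nat poly" where "\<forall>B. S B \<le> poly p B" "\<forall>B. T B \<le> poly q B"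
    by (auto simp: poly_bounded_def)
  then have "\<forall>B. S B * T B \<le> poly (p * q) B" by (simp add: mult_le_mono)
  then show ?thesis unfolding poly_bounded_def by blast
qed

lemma poly_bounded_Suc: "poly_bounded S \<Longrightarrow> poly_bounded (\<lambda>B. Suc (S B))"
  using poly_bounded_add[OF poly_bounded_const[of 1]] by simp

lemma poly_bounded_comp:
  assumes "poly_bounded S" "poly_bounded T" shows "poly_bounded (\<lambda>B. S (T B))"
proof -
  from assms obtain p q :: "nat poly" where pq: "\<forall>B. S B \<le> poly p B" "\<forall>B. T B \<le> poly q B"
    by (auto simp: poly_bounded_def)
  then have "S (T B) \<le> poly (pcompose p q) B" for B
    unfolding poly_pcompose by (meson order_trans poly_nat_mono)
  then show ?thesis unfolding poly_bounded_def by blast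
qed

lemmas poly_bounded_intros = poly_bounded_const poly_bounded_id poly_bounded_mult poly_bounded_add
  poly_bounded_Suc poly_bounded_comp[where T = "\<lambda>B. B + F B" for F]

definition input_bound :: "inputs \<Rightarrow> nat list \<Rightarrow> nat \<Rightarrow> bool" where
  "input_bound z vs B \<longleftrightarrow> length (fst z) + length (snd z) \<le> B \<and> (\<forall>v \<in> set vs. v \<le> B)"

definition clean_from :: "nat \<Rightarrow> (nat \<Rightarrow> nat) \<Rightarrow> bool" where
  "clean_from r e \<longleftrightarrow> (\<forall>j. r \<le> j \<or> j < 2 \<longrightarrow> e j = 0)"

definition registers :: "nat \<Rightarrow> nat list \<Rightarrow> nat \<Rightarrow> bool" where
  "registers d rs r \<longleftrightarrow> length rs = d \<and> set rs \<subseteq> {2..<r} \<and> 2 \<le> r"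

text \<open>The first argument of \<open>f\<close> is the pair of input strings, the second is the list of the values
  of the \<open>d\<close> free variables. A program computing \<open>f\<close> finds these values in the registers \<open>rs\<close> and
  leaves the result in register \<open>r\<close>; all registers from \<open>r\<close> on are scratch and zero before and,
  except for the result, after its run.\<close>

definition computes_at :: "(inputs \<Rightarrow> nat list \<Rightarrow> nat) \<Rightarrow> nat list \<Rightarrow> nat \<Rightarrow> cmd \<Rightarrow>
    (nat \<Rightarrow> nat) \<Rightarrow> bool" where
  "computes_at f rs r c T \<longleftrightarrow> (\<forall>z e w B. clean_from r e \<longrightarrow> input_bound z (map e rs) B
      \<longrightarrow> exec z c e w (T B) (e(r := f z (map e rs))) w)"

definition bounded_by :: "nat \<Rightarrow> (inputs \<Rightarrow> nat list \<Rightarrow> nat) \<Rightarrow> (nat \<Rightarrow> nat) \<Rightarrow> bool" where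
  "bounded_by d f G \<longleftrightarrow>
     poly_bounded G \<and> (\<forall>z vs B. length vs = d \<longrightarrow> input_bound z vs B \<longrightarrow> f z vs \<le> G B)"

definition polytime_fun :: "nat \<Rightarrow> (inputs \<Rightarrow> nat list \<Rightarrow> nat) \<Rightarrow> bool" where
  "polytime_fun d f \<longleftrightarrow> (\<exists>G. bounded_by d f G) \<and>
     (\<forall>rs r. registers d rs r \<longrightarrow> (\<exists>c T. poly_bounded T \<and> computes_at f rs r c T))"

lemma polytime_funI:
  assumes "bounded_by d f G"
    and "\<And>rs r. registers d rs r \<Longrightarrow> \<exists>c T. poly_bounded T \<and> computes_at f rs r c T"
  shows "polytime_fun d f"
  using assms unfolding polytime_fun_def by blast

lemma polytime_fun_bound:
  assumes "polytime_fun d f"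
  obtains G where "bounded_by d f G"
  using assms unfolding polytime_fun_def by blast

lemma polytime_fun_program:
  assumes "polytime_fun d f" "registers d rs r"
  obtains c T where "poly_bounded T" "computes_at f rs r c T"
  using assms unfolding polytime_fun_def by blast

lemma bounded_byI:
  assumes "poly_bounded G" "\<And>z vs B. length vs = d \<Longrightarrow> input_bound z vs B \<Longrightarrow> f z vs \<le> G B"
  shows "bounded_by d f G"
  using assms by (simp add: bounded_by_def)

lemma bounded_byD:
  assumes "bounded_by d f G"
  shows "poly_bounded G" "length vs = d \<Longrightarrow> input_bound z vs B \<Longrightarrow> f z vs \<le> G B"
  using assms unfolding bounded_by_def by blast+

lemma computesI:
  assumes "poly_bounded T"
    and "\<And>z e w B. clean_from r e \<Longrightarrow> input_bound z (map e rs) B \<Longrightarrow>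
      exec z c e w (T B) (e(r := f z (map e rs))) w"
  shows "\<exists>c T. poly_bounded T \<and> computes_at f rs r c T"
  using assms unfolding computes_at_def by blast

lemma computes_atD:
  assumes "computes_at f rs r c T" "clean_from r e" "map e rs = vs" "input_bound z vs B"
  shows "exec z c e w (T B) (e(r := f z vs)) w"
  using assms unfolding computes_at_def by blast

lemma clean_fromD: "clean_from r e \<Longrightarrow> r \<le> j \<or> j < 2 \<Longrightarrow> e j = 0"
  by (auto simp: clean_from_def)

lemma registers_Suc: "registers d rs r \<Longrightarrow> registers d rs (Suc r)"
  by (auto simp: registers_def)

lemma registers_fresh: "registers d rs r \<Longrightarrow> r \<le> j \<Longrightarrow> j \<notin> set rs"
  by (auto simp: registers_def)

lemma map_upd_fresh: "registers d rs r \<Longrightarrow> r \<le> j \<Longrightarrow> map (e(j := v)) rs = map e rs"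
  by (simp add: registers_fresh)

lemma polytime_fun_const: "polytime_fun d (\<lambda>z vs. c)"
proof (rule polytime_funI)
  show "bounded_by d (\<lambda>z vs. c) (\<lambda>B. c)" by (simp add: bounded_by_def poly_bounded_const)
  fix rs r assume "registers d rs r"
  show "\<exists>p T. poly_bounded T \<and> computes_at (\<lambda>z vs. c) rs r p T"
  proof (rule computesI)
    show "poly_bounded (\<lambda>B. Suc (2 * c))" by (rule poly_bounded_const)
    fix z e w B assume "clean_from r e"
    then have "e r = 0" by (simp add: clean_fromD)
    then show "exec z (incs (replicate c r)) e w (Suc (2 * c)) (e(r := c)) w"
      by (intro exec_weaken[OF exec_incs]) (auto simp: fun_eq_iff count_list_eq_length_filter)
  qed
qed

lemma polytime_fun_var:
  assumes "i < d" shows "polytime_fun d (\<lambda>z vs. vs ! i)"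
proof (rule polytime_funI)
  show "bounded_by d (\<lambda>z vs. vs ! i) (\<lambda>B. B)"
    using assms by (auto simp: bounded_by_def input_bound_def poly_bounded_id)
  fix rs r assume rs: "registers d rs r"
  define q where "q = rs ! i"
  have "q \<in> set rs" using assms rs by (simp add: q_def registers_def)
  then have q: "q \<in> set rs" "2 \<le> q" "q < r" using rs by (auto simp: registers_def)
  show "\<exists>c T. poly_bounded T \<and> computes_at (\<lambda>z vs. vs ! i) rs r c T"
  proof (rule computesI)
    show "poly_bounded (\<lambda>B. Suc (Suc (B * 8) + Suc (B * 6)))" by (intro poly_bounded_intros)
    fix z e w B assume e: "clean_from r e" and B: "input_bound z (map e rs) B"
    let ?e = "e(q := 0, r := e q, Suc r := e q)"
    have "exec z (drain q [r, Suc r]) e w (Suc (B * 8)) ?e w"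
      using q B by (intro exec_weaken[OF exec_drain])
        (auto simp: fun_eq_iff input_bound_def clean_fromD[OF e])
    moreover have "exec z (drain (Suc r) [q]) ?e w (Suc (B * 6)) (e(r := e q)) w"
      using q B by (intro exec_weaken[OF exec_drain])
        (auto simp: fun_eq_iff input_bound_def clean_fromD[OF e])
    moreover have "map e rs ! i = e q" using assms rs by (simp add: q_def registers_def)
    ultimately show "exec z (Seq (drain q [r, Suc r]) (drain (Suc r) [q])) e w
        (Suc (Suc (B * 8) + Suc (B * 6))) (e(r := map e rs ! i)) w"
      by (metis exec_Seq)
  qed
qed

lemma bounded_by_binop:
  assumes F: "bounded_by d f F" and G: "bounded_by d g G" and bound: "\<And>a b. op a b \<le> a + b"
  shows "bounded_by d (\<lambda>z vs. op (f z vs) (g z vs)) (\<lambda>B. F B + G B)"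
proof (rule bounded_byI)
  fix z vs B assume vs: "length vs = d" "input_bound z vs B"
  have "op (f z vs) (g z vs) \<le> f z vs + g z vs" by (rule bound)
  also have "\<dots> \<le> F B + G B"
    by (intro add_mono bounded_byD(2)[OF F vs] bounded_byD(2)[OF G vs])
  finally show "op (f z vs) (g z vs) \<le> F B + G B" .
qed (intro poly_bounded_add bounded_byD(1)[OF F] bounded_byD(1)[OF G])

lemma polytime_fun_binop:
  assumes f: "polytime_fun d f" and g: "polytime_fun d g"
    and bound: "\<And>a b. op a b \<le> a + b"
    and program: "\<And>r. 2 \<le> r \<Longrightarrow> \<exists>c. \<forall>z e w.
      exec z c e w (Suc (K * e (Suc r))) (e(r := op (e r) (e (Suc r)), Suc r := 0)) w"
  shows "polytime_fun d (\<lambda>z vs. op (f z vs) (g z vs))"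
proof -
  obtain F G where F: "bounded_by d f F" and G: "bounded_by d g G"
    using f g polytime_fun_bound by metis
  show ?thesis
  proof (rule polytime_funI)
    show "bounded_by d (\<lambda>z vs. op (f z vs) (g z vs)) (\<lambda>B. F B + G B)"
      using F G bound by (rule bounded_by_binop)
    fix rs r assume rs: "registers d rs r"
    obtain cf Tf where cf: "poly_bounded Tf" "computes_at f rs r cf Tf"
      using polytime_fun_program[OF f rs] .
    obtain cg Tg where cg: "poly_bounded Tg" "computes_at g rs (Suc r) cg Tg"
      using polytime_fun_program[OF g registers_Suc[OF rs]] .
    obtain p where p:
      "\<And>z e w. exec z p e w (Suc (K * e (Suc r))) (e(r := op (e r) (e (Suc r)), Suc r := 0)) w"
      using program[of r] rs by (auto simp: registers_def)
    show "\<exists>c T. poly_bounded T \<and> computes_at (\<lambda>z vs. op (f z vs) (g z vs)) rs r c T"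
    proof (rule computesI)
      show "poly_bounded (\<lambda>B. Suc (Tf B + Suc (Tg B + Suc (K * G B))))"
        by (intro poly_bounded_intros cf cg bounded_byD[OF G])
      fix z e w B assume e: "clean_from r e" and B: "input_bound z (map e rs) B"
      let ?a = "f z (map e rs)" and ?b = "g z (map e rs)"
      have "exec z cf e w (Tf B) (e(r := ?a)) w"
        by (rule computes_atD[OF cf(2) e refl B])
      moreover have "exec z cg (e(r := ?a)) w (Tg B) (e(r := ?a, Suc r := ?b)) w"
        by (rule computes_atD[OF cg(2) _ _ B])
          (use e rs in \<open>auto simp: clean_from_def registers_def map_upd_fresh[OF rs]\<close>)
      moreover have "exec z p (e(r := ?a, Suc r := ?b)) w (Suc (K * G B)) (e(r := op ?a ?b)) w"
        using bounded_byD(2)[OF G _ B] rs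
        by (intro exec_weaken[OF p]) (auto simp: fun_eq_iff clean_fromD[OF e] registers_def)
      ultimately show "exec z (Seq cf (Seq cg p)) e w (Suc (Tf B + Suc (Tg B + Suc (K * G B))))
          (e(r := op ?a ?b)) w"
        by (intro exec_Seq)
    qed
  qed
qed

lemma polytime_fun_add:
  assumes "polytime_fun d f" "polytime_fun d g"
  shows "polytime_fun d (\<lambda>z vs. f z vs + g z vs)"
proof (rule polytime_fun_binop[where K = 6, OF assms])
  fix r :: nat assume "2 \<le> r"
  then have "exec z (drain (Suc r) [r]) e w (Suc (6 * e (Suc r)))
      (e(r := e r + e (Suc r), Suc r := 0)) w"
    for z e w by (intro exec_weaken[OF exec_drain]) (auto simp: fun_eq_iff)
  then show "\<exists>c. \<forall>z e w. exec z c e w (Suc (6 * e (Suc r))) (e(r := e r + e (Suc r), Suc r := 0)) w"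
    by blast
qed simp

lemma polytime_fun_diff:
  assumes "polytime_fun d f" "polytime_fun d g"
  shows "polytime_fun d (\<lambda>z vs. f z vs - g z vs)"
proof (rule polytime_fun_binop[where K = 5, OF assms])
  fix r :: nat assume r: "2 \<le> r"
  have "exec z (count_down (Suc r) (decrement r)) e w (Suc (e (Suc r) * (2 + 3)))
      ((e(r := e r - e (Suc r)))(Suc r := 0)) w" for z e w
  proof (rule exec_count_down[where E = "\<lambda>m. e(r := e r - m)" and W = "\<lambda>_. w"])
    fix m
    show "exec z (decrement r) ((e(r := e r - m))(Suc r := e (Suc r) - Suc m)) w 2
        ((e(r := e r - Suc m))(Suc r := e (Suc r) - Suc m)) w"
      by (rule exec_weaken[OF exec_decrement[OF r]]) (auto simp: fun_eq_iff)
  qed (use r in auto)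
  then show "\<exists>c. \<forall>z e w. exec z c e w (Suc (5 * e (Suc r))) (e(r := e r - e (Suc r), Suc r := 0)) w"
    by (intro exI[of _ "count_down (Suc r) (decrement r)"]) (simp add: mult.commute)
qed simp

definition input_string :: "inputs \<Rightarrow> nat \<Rightarrow> bool list" where
  "input_string z i = (if i = 0 then fst z else snd z)"

lemma tape_cells_input:
  assumes "i < 2"
  shows "tape_cells z i (int n) =
    (if n < length (input_string z i) then bit_symbol (input_string z i ! n) else 0)"
  using assms by (auto simp: tape_cells_def input_string_def string_cells_def)

lemma length_input_string_le: "input_bound z vs B \<Longrightarrow> length (input_string z i) \<le> B"
  by (auto simp: input_bound_def input_string_def)

lemma polytime_fun_length:
  assumes i: "i < 2" shows "polytime_fun d (\<lambda>z vs. length (input_string z i))"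
proof (rule polytime_funI)
  show "bounded_by d (\<lambda>z vs. length (input_string z i)) (\<lambda>B. B)"
    by (auto simp: bounded_by_def poly_bounded_id length_input_string_le)
  fix rs r assume rs: "registers d rs r"
  let ?c = "Seq (Until i 0 (incs [i, r, Suc r])) (count_down (Suc r) (Dec i))"
  let ?T = "\<lambda>B. Suc (Suc (B * 8) + Suc (B * 4))"
  show "\<exists>c T. poly_bounded T \<and> computes_at (\<lambda>z vs. length (input_string z i)) rs r c T"
  proof (rule computesI)
    show "poly_bounded ?T" by (intro poly_bounded_intros)
    fix z e w B assume e: "clean_from r e" and B: "input_bound z (map e rs) B"
    let ?n = "length (input_string z i)"
    let ?E = "\<lambda>m. e(i := m, r := m, Suc r := m)"
    have n: "?n \<le> B" using B by (rule length_input_string_le)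
    have ri: "i \<noteq> r" "2 \<le> r" using i rs by (auto simp: registers_def)
    have "exec z (Until i 0 (incs [i, r, Suc r])) (?E 0) w (Suc (?n * Suc 7)) (?E ?n) w"
    proof (rule exec_Until[where E = ?E and W = "\<lambda>_. w"])
      fix m assume "m < ?n"
      then show "tape_cells z i (int (?E m i)) \<noteq> 0"
        using i ri by (simp add: tape_cells_input bit_symbol_def)
      show "exec z (incs [i, r, Suc r]) (?E m) w 7 (?E (Suc m)) w"
        using i ri by (intro exec_weaken[OF exec_incs]) (auto simp: fun_eq_iff)
    qed (use i ri in \<open>simp add: tape_cells_input\<close>)
    moreover have "?E 0 = e" using i by (auto simp: fun_eq_iff clean_fromD[OF e])
    ultimately have "exec z (Until i 0 (incs [i, r, Suc r])) e w (Suc (B * 8)) (?E ?n) w"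
      using n by (auto elim: exec_weaken)
    moreover have "exec z (count_down (Suc r) (Dec i)) (?E ?n) w (Suc (B * 4)) (e(r := ?n)) w"
      using i ri n by (intro exec_weaken[OF exec_count_down_Dec])
        (auto simp: fun_eq_iff clean_fromD[OF e])
    ultimately show "exec z ?c e w (?T B) (e(r := ?n)) w" by (rule exec_Seq)
  qed
qed

definition nth_bit :: "bool list \<Rightarrow> nat \<Rightarrow> bool" where
  "nth_bit x i \<longleftrightarrow> i < length x \<and> x ! i"

lemma exec_test_input_bit:
  assumes i: "i < 2" and r: "2 \<le> r" "e r = 0"
  shows "exec z (Ite i 2 (Inc r) Skip) e w 2 (e(r := of_bool (nth_bit (input_string z i) (e i)))) w"
proof -
  let ?c = "if tape_cells z i (int (e i)) = 2 then Inc r else Skip"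
  have bit: "tape_cells z i (int (e i)) = 2 \<longleftrightarrow> nth_bit (input_string z i) (e i)"
    using i by (auto simp: tape_cells_input nth_bit_def bit_symbol_def)
  have branch: "exec z ?c e w 1 (e(r := of_bool (nth_bit (input_string z i) (e i)))) w"
  proof (cases "nth_bit (input_string z i) (e i)")
    case True
    then show ?thesis using exec_Inc[of z r e w] r bit by simp
  next
    case False
    then show ?thesis using exec_Skip[of z e w] r bit by (simp add: fun_upd_idem)
  qed
  show ?thesis by (rule exec_weaken[OF exec_Ite[OF branch]]) auto
qed

lemma polytime_fun_bit:
  assumes i: "i < 2" and f: "polytime_fun d f"
  shows "polytime_fun d (\<lambda>z vs. of_bool (nth_bit (input_string z i) (f z vs)))"
proof (rule polytime_funI)
  show "bounded_by d (\<lambda>z vs. of_bool (nth_bit (input_string z i) (f z vs))) (\<lambda>B. 1)"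
    by (simp add: bounded_by_def poly_bounded_const)
  obtain F where F: "bounded_by d f F" using polytime_fun_bound[OF f] .
  fix rs r assume rs: "registers d rs r"
  obtain cf Tf where cf: "poly_bounded Tf" "computes_at f rs r cf Tf"
    using polytime_fun_program[OF f rs] .
  let ?test = "Ite i 2 (Inc r) Skip" and ?rewind = "count_down (Suc r) (Dec i)"
  let ?c = "Seq cf (Seq (drain r [i, Suc r]) (Seq ?test ?rewind))"
  let ?T = "\<lambda>B. Suc (Tf B + Suc (Suc (F B * 8) + Suc (2 + Suc (F B * 4))))"
  show "\<exists>c T. poly_bounded T \<and>
      computes_at (\<lambda>z vs. of_bool (nth_bit (input_string z i) (f z vs))) rs r c T"
  proof (rule computesI)
    show "poly_bounded ?T" by (intro poly_bounded_intros cf bounded_byD[OF F])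
    fix z e w B assume e: "clean_from r e" and B: "input_bound z (map e rs) B"
    let ?n = "f z (map e rs)"
    let ?b = "of_bool (nth_bit (input_string z i) ?n)"
    have n: "?n \<le> F B" using bounded_byD(2)[OF F _ B] rs by (simp add: registers_def)
    have ri: "i \<noteq> r" "2 \<le> r" using i rs by (auto simp: registers_def)
    let ?seek = "e(i := ?n, Suc r := ?n)"
    have "exec z cf e w (Tf B) (e(r := ?n)) w"
      by (rule computes_atD[OF cf(2) e refl B])
    moreover have "exec z (drain r [i, Suc r]) (e(r := ?n)) w (Suc (F B * 8)) ?seek w"
      using i ri n by (intro exec_weaken[OF exec_drain]) (auto simp: fun_eq_iff clean_fromD[OF e])
    moreover have "exec z ?test ?seek w 2 (?seek(r := ?b)) w"
      using exec_test_input_bit[of i r ?seek z w] i ri by (simp add: clean_fromD[OF e])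
    moreover have "exec z ?rewind (?seek(r := ?b)) w (Suc (F B * 4)) (e(r := ?b)) w"
      using i ri n by (intro exec_weaken[OF exec_count_down_Dec])
        (auto simp: fun_eq_iff clean_fromD[OF e])
    ultimately show "exec z ?c e w (?T B) (e(r := ?b)) w" by (intro exec_Seq)
  qed
qed

text \<open>Registers \<open>r\<close> to \<open>r + 3\<close> hold the partial sum, the number of summands still to come, the
  summation index and the current summand.\<close>

definition sum_step :: "nat \<Rightarrow> cmd \<Rightarrow> cmd" where
  "sum_step r c = Seq c (Seq (drain (r + 3) [r]) (Inc (r + 2)))"

lemma exec_sum_step:
  assumes rs: "registers d rs r" and e: "clean_from r e" and B: "input_bound z (m # map e rs) B"
    and c: "computes_at (\<lambda>z vs. g z (tl vs) (hd vs)) ((r + 2) # rs) (r + 3) c T"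
    and g: "g z (map e rs) m \<le> G"
  shows "exec z (sum_step r c) (e(r := s, r + 2 := m, Suc r := n)) w (T B + 6 * G + 4)
    (e(r := s + g z (map e rs) m, r + 2 := Suc m, Suc r := n)) w"
proof -
  let ?g = "g z (map e rs) m"
  let ?e = "e(r := s, r + 2 := m, Suc r := n)"
  have "map ?e ((r + 2) # rs) = m # map e rs" using registers_fresh[OF rs] by auto
  moreover have "clean_from (r + 3) ?e" using e rs by (simp add: clean_from_def registers_def)
  ultimately have "exec z c ?e w (T B) (?e(r + 3 := ?g)) w"
    using computes_atD[OF c _ _ B] by simp
  moreover have "exec z (drain (r + 3) [r]) (?e(r + 3 := ?g)) w (Suc (6 * G)) (?e(r := s + ?g)) w"
    using g by (intro exec_weaken[OF exec_drain]) (auto simp: fun_eq_iff clean_fromD[OF e])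
  ultimately have "exec z (sum_step r c) ?e w (Suc (T B + Suc (Suc (6 * G) + 1)))
      (?e(r := s + ?g, r + 2 := Suc m)) w"
    unfolding sum_step_def using exec_Inc[of z "r + 2" "?e(r := s + ?g)" w]
    by (intro exec_Seq) simp_all
  then show ?thesis by (rule exec_weaken) (auto simp: fun_eq_iff)
qed

lemma exec_sum_loop:
  assumes rs: "registers d rs r" and e: "clean_from r e"
    and B: "\<And>m. m < n \<Longrightarrow> input_bound z (m # map e rs) B"
    and c: "computes_at (\<lambda>z vs. g z (tl vs) (hd vs)) ((r + 2) # rs) (r + 3) c T"
    and g: "\<And>m. m < n \<Longrightarrow> g z (map e rs) m \<le> G"
  shows "exec z (count_down (Suc r) (sum_step r c)) (e(Suc r := n)) w (Suc (n * (T B + 6 * G + 7)))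
    (e(r := \<Sum>m<n. g z (map e rs) m, r + 2 := n)) w"
proof -
  let ?E = "\<lambda>m. e(r := \<Sum>j<m. g z (map e rs) j, r + 2 := m, Suc r := n)"
  have "exec z (count_down (Suc r) (sum_step r c)) (e(Suc r := n)) w
      (Suc (n * ((T B + 6 * G + 4) + 3))) ((?E n)(Suc r := 0)) w"
  proof (rule exec_count_down[where E = ?E and W = "\<lambda>_. w"])
    fix m assume m: "m < n"
    show "exec z (sum_step r c) ((?E m)(Suc r := n - Suc m)) w (T B + 6 * G + 4)
        ((?E (Suc m))(Suc r := n - Suc m)) w"
      using exec_sum_step[where s = "\<Sum>j<m. g z (map e rs) j" and n = "n - Suc m",
          OF rs e B[OF m] c g[OF m]] by simp
  qed (use rs in \<open>auto simp: fun_eq_iff clean_fromD[OF e] registers_def\<close>)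
  then show ?thesis by (rule exec_weaken) (auto simp: fun_eq_iff clean_fromD[OF e])
qed

lemma input_bound_index:
  assumes F: "bounded_by d f F" and vs: "length vs = d" "input_bound z vs B" and j: "j < f z vs"
  shows "input_bound z (j # vs) (B + F B)"
  using j vs(2) bounded_byD(2)[OF F vs] by (auto simp: input_bound_def)

lemma summand_le:
  assumes F: "bounded_by d f F" and G: "bounded_by (Suc d) (\<lambda>z vs. g z (tl vs) (hd vs)) G"
    and vs: "length vs = d" "input_bound z vs B" and j: "j < f z vs"
  shows "g z vs j \<le> G (B + F B)"
  using bounded_byD(2)[OF G _ input_bound_index[OF F vs j]] vs by simp

lemma bounded_by_sum:
  assumes F: "bounded_by d f F" and G: "bounded_by (Suc d) (\<lambda>z vs. g z (tl vs) (hd vs)) G"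
  shows "bounded_by d (\<lambda>z vs. \<Sum>j < f z vs. g z vs j) (\<lambda>B. F B * G (B + F B))"
proof (rule bounded_byI)
  show "poly_bounded (\<lambda>B. F B * G (B + F B))"
    by (intro poly_bounded_intros bounded_byD[OF F] bounded_byD[OF G])
  fix z vs B assume vs: "length vs = d" "input_bound z vs B"
  have "(\<Sum>j < f z vs. g z vs j) \<le> of_nat (card {..<f z vs}) * G (B + F B)"
    by (rule sum_bounded_above) (use summand_le[OF F G vs] in auto)
  also have "\<dots> \<le> F B * G (B + F B)" using bounded_byD(2)[OF F vs] by simp
  finally show "(\<Sum>j < f z vs. g z vs j) \<le> F B * G (B + F B)" .
qed

lemma polytime_fun_sum:
  assumes f: "polytime_fun d f" and g: "polytime_fun (Suc d) (\<lambda>z vs. g z (tl vs) (hd vs))"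
  shows "polytime_fun d (\<lambda>z vs. \<Sum>j < f z vs. g z vs j)"
proof -
  obtain F where F: "bounded_by d f F" using polytime_fun_bound[OF f] .
  obtain G where G: "bounded_by (Suc d) (\<lambda>z vs. g z (tl vs) (hd vs)) G"
    using polytime_fun_bound[OF g] .
  show ?thesis
  proof (rule polytime_funI)
    show "bounded_by d (\<lambda>z vs. \<Sum>j < f z vs. g z vs j) (\<lambda>B. F B * G (B + F B))"
      using F G by (rule bounded_by_sum)
    fix rs r assume rs: "registers d rs r"
    obtain cf Tf where cf: "poly_bounded Tf" "computes_at f rs (Suc r) cf Tf"
      using polytime_fun_program[OF f registers_Suc[OF rs]] .
    have rs': "registers (Suc d) ((r + 2) # rs) (r + 3)" using rs by (auto simp: registers_def)
    obtain cg Tg where cg: "poly_bounded Tg"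
      "computes_at (\<lambda>z vs. g z (tl vs) (hd vs)) ((r + 2) # rs) (r + 3) cg Tg"
      using polytime_fun_program[OF g rs'] .
    let ?loop = "count_down (Suc r) (sum_step r cg)"
    let ?Tloop = "\<lambda>B. Suc (F B * (Tg (B + F B) + 6 * G (B + F B) + 7))"
    show "\<exists>c T. poly_bounded T \<and> computes_at (\<lambda>z vs. \<Sum>j < f z vs. g z vs j) rs r c T"
    proof (rule computesI)
      show "poly_bounded (\<lambda>B. Suc (Tf B + Suc (?Tloop B + Suc (F B * 4))))"
        by (intro poly_bounded_intros cf cg bounded_byD[OF F] bounded_byD[OF G])
      fix z e w B assume e: "clean_from r e" and B: "input_bound z (map e rs) B"
      let ?vs = "map e rs"
      let ?n = "f z ?vs" and ?s = "\<Sum>j<f z ?vs. g z ?vs j"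
      have vs: "length ?vs = d" using rs by (simp add: registers_def)
      have n: "?n \<le> F B" using bounded_byD(2)[OF F vs B] .
      have "exec z cf e w (Tf B) (e(Suc r := ?n)) w"
        by (rule computes_atD[OF cf(2) _ refl B]) (use e in \<open>simp add: clean_from_def\<close>)
      moreover have "exec z ?loop (e(Suc r := ?n)) w (?Tloop B) (e(r := ?s, r + 2 := ?n)) w"
        using exec_sum_loop[OF rs e input_bound_index[OF F vs B] cg(2) summand_le[OF F G vs B]]
        by (rule exec_weaken) (use n in simp_all)
      moreover have "exec z (drain (r + 2) []) (e(r := ?s, r + 2 := ?n)) w (Suc (F B * 4))
          (e(r := ?s)) w"
        using n by (intro exec_weaken[OF exec_drain]) (auto simp: fun_eq_iff clean_fromD[OF e])
      ultimately show "exec z (Seq cf (Seq ?loop (drain (r + 2) []))) e w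
          (Suc (Tf B + Suc (?Tloop B + Suc (F B * 4)))) (e(r := ?s)) w"
        by (intro exec_Seq)
    qed
  qed
qed

lemma polytime_fun_tl:
  assumes f: "polytime_fun d f" shows "polytime_fun (Suc d) (\<lambda>z vs. f z (tl vs))"
proof -
  obtain F where F: "bounded_by d f F" using polytime_fun_bound[OF f] .
  have tl: "input_bound z (tl vs) B" if "input_bound z vs B" for z vs B
    using that by (cases vs) (auto simp: input_bound_def)
  show ?thesis
  proof (rule polytime_funI)
    show "bounded_by (Suc d) (\<lambda>z vs. f z (tl vs)) F"
      by (intro bounded_byI bounded_byD[OF F] tl) auto
    fix rs r assume "registers (Suc d) rs r"
    then have "registers d (tl rs) r" by (cases rs) (auto simp: registers_def)
    then obtain c T where c: "poly_bounded T" "computes_at f (tl rs) r c T"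
      using polytime_fun_program[OF f] by blast
    moreover have "computes_at (\<lambda>z vs. f z (tl vs)) rs r c T"
      using c(2) tl unfolding computes_at_def by (metis map_tl)
    ultimately show "\<exists>c T. poly_bounded T \<and> computes_at (\<lambda>z vs. f z (tl vs)) rs r c T" by blast
  qed
qed

definition polytime_pred :: "nat \<Rightarrow> (inputs \<Rightarrow> nat list \<Rightarrow> bool) \<Rightarrow> bool" where
  "polytime_pred d P \<longleftrightarrow> polytime_fun d (\<lambda>z vs. of_bool (P z vs))"

lemma polytime_fun_of_bool: "polytime_pred d P \<Longrightarrow> polytime_fun d (\<lambda>z vs. of_bool (P z vs))"
  by (simp add: polytime_pred_def)

lemma polytime_fun_cong:
  assumes "polytime_fun d g" "\<And>z vs. f z vs = g z vs" shows "polytime_fun d f"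
  using assms by presburger

lemma polytime_pred_cong:
  assumes "polytime_pred d Q" "\<And>z vs. P z vs \<longleftrightarrow> Q z vs" shows "polytime_pred d P"
  using assms by presburger

lemma polytime_fun_mult:
  assumes "polytime_fun d f" "polytime_fun d g" shows "polytime_fun d (\<lambda>z vs. f z vs * g z vs)"
  by (rule polytime_fun_cong[OF polytime_fun_sum[OF assms(1) polytime_fun_tl[OF assms(2)]]]) simp

lemma polytime_pred_less:
  assumes "polytime_fun d f" "polytime_fun d g" shows "polytime_pred d (\<lambda>z vs. f z vs < g z vs)"
  unfolding polytime_pred_def
  by (rule polytime_fun_cong[where g = "\<lambda>z vs. 1 - (1 - (g z vs - f z vs))"])
    (auto intro!: polytime_fun_diff polytime_fun_const assms)

lemma polytime_pred_not:
  assumes "polytime_pred d P" shows "polytime_pred d (\<lambda>z vs. \<not> P z vs)"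
  unfolding polytime_pred_def
  by (rule polytime_fun_cong[where g = "\<lambda>z vs. 1 - of_bool (P z vs)"])
    (auto intro!: polytime_fun_diff polytime_fun_const polytime_fun_of_bool assms)

lemma polytime_pred_conj:
  assumes "polytime_pred d P" "polytime_pred d Q" shows "polytime_pred d (\<lambda>z vs. P z vs \<and> Q z vs)"
  unfolding polytime_pred_def
  by (rule polytime_fun_cong[where g = "\<lambda>z vs. of_bool (P z vs) * of_bool (Q z vs)"])
    (auto intro!: polytime_fun_mult polytime_fun_of_bool assms)

lemma polytime_pred_disj:
  assumes "polytime_pred d P" "polytime_pred d Q" shows "polytime_pred d (\<lambda>z vs. P z vs \<or> Q z vs)"
  using polytime_pred_not[OF polytime_pred_conj[OF assms[THEN polytime_pred_not]]] by simp

lemma polytime_pred_imp: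
  assumes "polytime_pred d P" "polytime_pred d Q" shows "polytime_pred d (\<lambda>z vs. P z vs \<longrightarrow> Q z vs)"
  unfolding imp_conv_disj by (intro polytime_pred_disj polytime_pred_not assms)

lemma polytime_pred_le:
  assumes "polytime_fun d f" "polytime_fun d g" shows "polytime_pred d (\<lambda>z vs. f z vs \<le> g z vs)"
  by (rule polytime_pred_cong[OF polytime_pred_not[OF polytime_pred_less[OF assms(2,1)]]]) auto

lemma polytime_pred_eq:
  assumes "polytime_fun d f" "polytime_fun d g" shows "polytime_pred d (\<lambda>z vs. f z vs = g z vs)"
  unfolding eq_iff by (intro polytime_pred_conj polytime_pred_le assms)

lemma polytime_pred_ex:
  assumes "polytime_fun d f" "polytime_pred (Suc d) (\<lambda>z vs. P z (tl vs) (hd vs))"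
  shows "polytime_pred d (\<lambda>z vs. \<exists>j < f z vs. P z vs j)"
  by (rule polytime_pred_cong[OF polytime_pred_less[OF polytime_fun_const[of d 0]
      polytime_fun_sum[OF assms(1), of "\<lambda>z vs j. of_bool (P z vs j)"]]])
    (use assms(2) in \<open>auto simp: polytime_pred_def card_gt_0_iff\<close>)

lemma polytime_pred_all:
  assumes "polytime_fun d f" "polytime_pred (Suc d) (\<lambda>z vs. P z (tl vs) (hd vs))"
  shows "polytime_pred d (\<lambda>z vs. \<forall>j < f z vs. P z vs j)"
  by (rule polytime_pred_cong[OF
    polytime_pred_not[OF polytime_pred_ex[OF assms(1), of "\<lambda>z vs j. \<not> P z vs j"]]])
    (auto intro: polytime_pred_not assms(2))

lemma polytime_pred_const: "polytime_pred d (\<lambda>z vs. b)"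
  unfolding polytime_pred_def by (rule polytime_fun_const)

lemma polytime_pred_if:
  assumes "polytime_pred d P" "polytime_pred d Q" "polytime_pred d R"
  shows "polytime_pred d (\<lambda>z vs. if P z vs then Q z vs else R z vs)"
  by (rule polytime_pred_cong[where Q = "\<lambda>z vs. (P z vs \<longrightarrow> Q z vs) \<and> (\<not> P z vs \<longrightarrow> R z vs)"])
    (auto intro!: polytime_pred_imp polytime_pred_conj polytime_pred_not assms)

lemma polytime_fun_if:
  assumes "polytime_pred d P" "polytime_fun d f" "polytime_fun d g"
  shows "polytime_fun d (\<lambda>z vs. if P z vs then f z vs else g z vs)"
  by (rule polytime_fun_cong[where
      g = "\<lambda>z vs. of_bool (P z vs) * f z vs + of_bool (\<not> P z vs) * g z vs"])
    (auto intro!: polytime_fun_mult polytime_fun_add polytime_fun_of_bool polytime_pred_not assms)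

lemma polytime_pred_finite_range:
  assumes "finite S" "\<And>z vs. f z vs \<in> S"
    and f: "\<And>a. a \<in> S \<Longrightarrow> polytime_pred d (\<lambda>z vs. f z vs = a)"
    and Q: "\<And>a. a \<in> S \<Longrightarrow> polytime_pred d (\<lambda>z vs. Q a z vs)"
  shows "polytime_pred d (\<lambda>z vs. Q (f z vs) z vs)"
proof -
  have "polytime_pred d (\<lambda>z vs. \<exists>a\<in>S. f z vs = a \<and> Q a z vs)"
    using assms(1) f Q
  proof (induction S)
    case (insert a S)
    then have "polytime_pred d (\<lambda>z vs. (f z vs = a \<and> Q a z vs) \<or> (\<exists>a\<in>S. f z vs = a \<and> Q a z vs))"
      by (intro polytime_pred_disj polytime_pred_conj) auto
    then show ?case by (rule polytime_pred_cong) auto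
  qed (simp add: polytime_pred_const)
  then show ?thesis by (rule polytime_pred_cong) (use assms(2) in auto)
qed

lemma div_eq_sum_of_bool: "m div n = (\<Sum>j<m. of_bool (0 < n \<and> (j + 1) * n \<le> m))" for m n :: nat
proof (cases "n = 0")
  case False
  have "j < m div n \<longleftrightarrow> j < m \<and> (j + 1) * n \<le> m" for j
    using False less_eq_div_iff_mult_less_eq[of n "j + 1" m]
      order.strict_trans2[OF _ div_le_dividend, of j m n]
    by auto
  then have "{..<m} \<inter> {j. (j + 1) * n \<le> m} = {..<m div n}" by auto
  then show ?thesis using False by simp
qed simp

lemma polytime_fun_hd_tl:
  assumes "i < d" shows "polytime_fun d (\<lambda>z vs. hd ((tl ^^ i) vs))"
proof -
  have "(tl ^^ i) vs = drop i vs" for vs :: "nat list"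
    by (induction i) (auto simp: drop_Suc tl_drop)
  then have "length vs = d \<Longrightarrow> hd ((tl ^^ i) vs) = vs ! i" for vs :: "nat list"
    using assms by (simp add: hd_drop_conv_nth)
  then show ?thesis using polytime_fun_var[OF assms]
    unfolding polytime_fun_def computes_at_def bounded_by_def registers_def by simp
qed

lemma polytime_fun_hd:
  "0 < d \<Longrightarrow> polytime_fun d (\<lambda>z vs. hd vs)"
  "1 < d \<Longrightarrow> polytime_fun d (\<lambda>z vs. hd (tl vs))"
  "2 < d \<Longrightarrow> polytime_fun d (\<lambda>z vs. hd (tl (tl vs)))"
  "3 < d \<Longrightarrow> polytime_fun d (\<lambda>z vs. hd (tl (tl (tl vs))))"
  using polytime_fun_hd_tl[of 0 d] polytime_fun_hd_tl[of 1 d] polytime_fun_hd_tl[of 2 d]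
    polytime_fun_hd_tl[of 3 d] by (simp_all add: numeral_2_eq_2 numeral_3_eq_3)

lemma polytime_fun_div:
  assumes "polytime_fun d f" "polytime_fun d g" shows "polytime_fun d (\<lambda>z vs. f z vs div g z vs)"
  unfolding div_eq_sum_of_bool
  by (intro polytime_fun_sum polytime_fun_of_bool polytime_pred_conj polytime_pred_less polytime_pred_le
      polytime_fun_const polytime_fun_mult polytime_fun_add polytime_fun_hd(1) assms
      assms[THEN polytime_fun_tl]) simp_all

lemma polytime_fun_mod:
  assumes "polytime_fun d f" "polytime_fun d g" shows "polytime_fun d (\<lambda>z vs. f z vs mod g z vs)"
  by (rule polytime_fun_cong[OF polytime_fun_diff[OF assms(1)
      polytime_fun_mult[OF polytime_fun_div[OF assms] assms(2)]]]) (simp add: minus_div_mult_eq_mod)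

lemma polytime_fun_poly:
  assumes "polytime_fun d f" shows "polytime_fun d (\<lambda>z vs. poly p (f z vs))"
  by (induction p) (simp_all add: polytime_fun_add polytime_fun_mult polytime_fun_const assms)

lemma polytime_fun_input_length:
  "polytime_fun d (\<lambda>z vs. length (fst z))" "polytime_fun d (\<lambda>z vs. length (snd z))"
  using polytime_fun_length[of 0 d] polytime_fun_length[of 1 d] by (simp_all add: input_string_def)

lemma polytime_pred_nth_bit:
  assumes "polytime_fun d f"
  shows "polytime_pred d (\<lambda>z vs. nth_bit (fst z) (f z vs))"
    "polytime_pred d (\<lambda>z vs. nth_bit (snd z) (f z vs))"
  using polytime_fun_bit[of 0 d f] polytime_fun_bit[of 1 d f] assms
  by (simp_all add: polytime_pred_def input_string_def)

lemmas polytime_intros = polytime_fun_hd polytime_fun_const polytime_fun_add polytime_fun_diff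
  polytime_fun_mult polytime_fun_div polytime_fun_mod polytime_fun_sum polytime_fun_input_length
  polytime_fun_poly polytime_fun_of_bool polytime_fun_if polytime_pred_const polytime_pred_conj
  polytime_pred_disj polytime_pred_imp polytime_pred_not polytime_pred_less polytime_pred_le
  polytime_pred_eq polytime_pred_ex polytime_pred_all polytime_pred_nth_bit polytime_pred_if

subsection \<open>From polynomial-time functions to NP and to polynomial-time computability\<close>

lemma poly_bounded_shift:
  assumes "poly_bounded T"
  obtains r :: "nat poly" where "\<And>n. T n + 2 \<le> poly r n"
proof -
  have "poly_bounded (\<lambda>n. T n + 2)" using assms by (intro poly_bounded_intros)
  then show ?thesis unfolding poly_bounded_def using that by blast
qed

lemma accepts_iff_run:
  assumes "tm_wf M" "halts_within M xs n" "n \<le> m"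
  shows "accepts M xs \<longleftrightarrow> fst (run M xs m) = tm_accept M"
proof
  assume "accepts M xs"
  then obtain l where l: "fst (run M xs l) = tm_accept M" by (auto simp: accepts_def)
  have "run M xs (max l m) = run M xs l" by (rule run_halted) (auto simp: halting_def l)
  moreover have "run M xs (max l m) = run M xs n" "run M xs m = run M xs n"
    using assms by (auto simp: halts_within_def intro!: run_halted)
  ultimately show "fst (run M xs m) = tm_accept M" using l by simp
qed (auto simp: accepts_def)

lemma exec_run:
  assumes "exec (x, u) c (\<lambda>_. 0) [] T e w"
  obtains t where "t \<le> T" "(cmd_step (x, u) ^^ t) ([c], \<lambda>_. 0, []) = ([], int \<circ> e, w)"
proof -
  obtain t where "t \<le> T" "\<And>K. (cmd_step (x, u) ^^ t) (c # K, int \<circ> (\<lambda>_. 0), []) = (K, int \<circ> e, w)"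
    using assms by (auto simp: exec_def)
  then show ?thesis using that[of t] by (simp add: comp_def)
qed

lemma run_machine_exec:
  assumes "exec (x, u) c (\<lambda>_. 0) [] T e w" "T + 2 \<le> n"
  shows "run (machine c) [x, u] n =
    (if e 2 = 0 then tm_reject (machine c)
      else tm_accept (machine c), machine_tapes c (x, u) (int \<circ> e) w)"
proof -
  obtain t where "t \<le> T" "(cmd_step (x, u) ^^ t) ([c], \<lambda>_. 0, []) = ([], int \<circ> e, w)"
    using assms(1) by (rule exec_run)
  then show ?thesis using run_machine[where x = x and u = u and t = t and n = n] assms(2) by simp
qed

lemma NP_I:
  assumes V: "polytime_pred 0 (\<lambda>z vs. V (fst z) (snd z))"
    and L: "\<And>x. x \<in> L \<longleftrightarrow> (\<exists>u. length u \<le> poly p (length x) \<and> V x u)"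
  shows "L \<in> NP"
proof -
  have "registers 0 [] 2" by (simp add: registers_def)
  then obtain c T where c: "poly_bounded T"
    "computes_at (\<lambda>z vs. of_bool (V (fst z) (snd z))) [] 2 c T"
    using polytime_fun_program[OF V[unfolded polytime_pred_def]] by blast
  obtain r where r: "\<And>n. T n + 2 \<le> poly r n" using poly_bounded_shift[OF c(1)] by blast
  let ?M = "machine c"
  have run: "fst (run ?M [x, u] (poly r (length x + length u))) =
      (if V x u then tm_accept ?M else tm_reject ?M)" for x u
  proof -
    let ?B = "length x + length u"
    have "exec (x, u) c (\<lambda>_. 0) [] (T ?B) ((\<lambda>_. 0)(2 := of_bool (V x u))) []"
      using computes_atD[OF c(2), of "\<lambda>_. 0" "[]" "(x, u)" ?B]
      by (simp add: input_bound_def clean_from_def)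
    from run_machine_exec[OF this r] show ?thesis by simp
  qed
  then have halts: "halts_within ?M [x, u] (poly r (length x + length u))" for x u
    by (simp add: halts_within_def halting_def)
  have "accepts ?M [x, u] \<longleftrightarrow> V x u" for x u
    using accepts_iff_run[OF tm_wf_machine halts order_refl] run by simp
  then have "\<forall>x. x \<in> L \<longleftrightarrow> (\<exists>u. length u \<le> poly p (length x) \<and> accepts ?M [x, u])" using L by simp
  moreover have "2 \<le> tm_tapes ?M" using tape_count_ge[of c] by simp
  ultimately show ?thesis unfolding NP_def using tm_wf_machine[of c] halts by blast
qed

definition output_bit :: cmd where
  "output_bit = Ite 4 1 (Out False) (Seq (Dec 4) (Out True))"

lemma exec_output_bit:
  assumes "e 4 = of_bool b"
  shows "exec z output_bit e w 4 (e(4 := 0)) (w @ [b])"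
proof -
  have branch: "exec z (if tape_cells z 4 (int (e 4)) = 1 then Out False
      else Seq (Dec 4) (Out True))
      e w 3 (e(4 := 0)) (w @ [b])"
  proof (cases b)
    case True
    have "exec z (Seq (Dec 4) (Out True)) e w 3 (e(4 := 0)) (w @ [True])"
      using True assms by (intro exec_weaken[OF exec_Seq[OF exec_Dec exec_Out]]) auto
    then show ?thesis using True assms by (simp add: counter_zero)
  next
    case False
    have "exec z (Out False) e w 3 (e(4 := 0)) (w @ [False])"
      using False assms by (intro exec_weaken[OF exec_Out]) auto
    then show ?thesis using False assms by (simp add: counter_zero)
  qed
  show ?thesis unfolding output_bit_def by (rule exec_weaken[OF exec_Ite[OF branch]]) auto
qed

lemma exec_output_loop:
  assumes c: "computes_at (\<lambda>z vs. of_bool (F (fst z) (hd vs))) [2] 4 c T"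
    and B: "length x + n \<le> B"
  shows "exec (x, []) (count_down 3 (Seq c (Seq output_bit (Inc 2)))) ((\<lambda>_. 0)(3 := n)) []
    (Suc (n * (T B + 10))) ((\<lambda>_. 0)(2 := n)) (map (F x) [0..<n])"
proof -
  let ?z = "(x, [] :: bool list)" and ?E = "\<lambda>m. (\<lambda>_ :: nat. 0 :: nat)(2 := m, 3 := n)"
  let ?W = "\<lambda>m. map (F x) [0..<m]"
  have "exec ?z (count_down 3 (Seq c (Seq output_bit (Inc 2)))) ((\<lambda>_. 0)(3 := n)) []
      (Suc (n * ((T B + 7) + 3))) ((?E n)(3 := 0)) (?W n)"
  proof (rule exec_count_down[where E = ?E and W = ?W])
    fix m assume m: "m < n"
    let ?e = "(?E m)(3 := n - Suc m)"
    have "input_bound ?z (map ?e [2]) B" using m B by (simp add: input_bound_def)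
    then have "exec ?z c ?e (?W m) (T B) (?e(4 := of_bool (F x m))) (?W m)"
      using computes_atD[OF c, of ?e "map ?e [2]" ?z B "?W m"] by (simp add: clean_from_def)
    moreover have "exec ?z output_bit (?e(4 := of_bool (F x m))) (?W m) 4 ?e (?W (Suc m))"
      using exec_output_bit[of "?e(4 := of_bool (F x m))" "F x m" ?z "?W m"]
      by (simp add: fun_upd_idem)
    ultimately have "exec ?z (Seq c (Seq output_bit (Inc 2))) ?e (?W m) (Suc (T B + Suc (4 + 1)))
        (?e(2 := Suc (?e 2))) (?W (Suc m))"
      by (intro exec_Seq[OF _ exec_Seq[OF _ exec_Inc]])
    then show "exec ?z (Seq c (Seq output_bit (Inc 2))) ?e (?W m) (T B + 7)
        ((?E (Suc m))(3 := n - Suc m)) (?W (Suc m))"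
      by (rule exec_weaken) (auto simp: fun_eq_iff)
  qed (auto simp: fun_eq_iff)
  then show ?thesis by (rule exec_weaken) (auto simp: fun_eq_iff)
qed

lemma polytime_computable_map_upt:
  assumes L: "polytime_fun 0 (\<lambda>z vs. L (fst z))" and F: "polytime_pred 1 (\<lambda>z vs. F (fst z) (hd vs))"
  shows "polytime_computable (\<lambda>x. map (F x) [0..<L x])"
proof -
  have "registers 0 [] 3" by (simp add: registers_def)
  then obtain cL TL where cL: "poly_bounded TL" "computes_at (\<lambda>z vs. L (fst z)) [] 3 cL TL"
    using polytime_fun_program[OF L] by blast
  have "registers 1 [2] 4" by (simp add: registers_def)
  then obtain cF TF where cF: "poly_bounded TF"
    "computes_at (\<lambda>z vs. of_bool (F (fst z) (hd vs))) [2] 4 cF TF"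
    using polytime_fun_program[OF F[unfolded polytime_pred_def]] by blast
  obtain G where G: "bounded_by 0 (\<lambda>z vs. L (fst z)) G" using polytime_fun_bound[OF L] .
  define c where "c = Seq cL (count_down 3 (Seq cF (Seq output_bit (Inc 2))))"
  define T where "T B = Suc (TL B + Suc (G B * (TF (B + G B) + 10)))" for B
  have "poly_bounded T" unfolding T_def by (intro poly_bounded_intros cL cF bounded_byD[OF G])
  then obtain r where r: "\<And>n. T n + 2 \<le> poly r n" using poly_bounded_shift by blast
  have ex: "exec (x, []) c (\<lambda>_. 0) [] (T (length x)) ((\<lambda>_. 0)(2 := L x)) (map (F x) [0..<L x])"
    for x
  proof -
    let ?B = "length x" and ?z = "(x, [] :: bool list)"
    have B: "input_bound ?z [] ?B" by (simp add: input_bound_def)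
    have Lx: "L x \<le> G ?B" using bounded_byD(2)[OF G _ B] by simp
    have "exec ?z cL (\<lambda>_. 0) [] (TL ?B) ((\<lambda>_. 0)(3 := L x)) []"
      using computes_atD[OF cL(2), of "\<lambda>_. 0" "[]" ?z ?B] B by (simp add: clean_from_def)
    moreover have "exec ?z (count_down 3 (Seq cF (Seq output_bit (Inc 2)))) ((\<lambda>_. 0)(3 := L x)) []
        (Suc (G ?B * (TF (?B + G ?B) + 10))) ((\<lambda>_. 0)(2 := L x)) (map (F x) [0..<L x])"
      using Lx by (intro exec_weaken[OF exec_output_loop[where B = "?B + G ?B", OF cF(2)]]) simp_all
    ultimately show ?thesis unfolding c_def T_def by (rule exec_Seq)
  qed
  let ?M = "machine c"
  have run: "run ?M [x] (poly r (length x)) = (if L x = 0 then tm_reject ?M else tm_accept ?M,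
      machine_tapes c (x, []) (int \<circ> (\<lambda>_. 0)(2 := L x)) (map (F x) [0..<L x]))" for x
    using run_machine_exec[OF ex r] by (simp add: run_machine_single)
  have "halts_within ?M [x] (poly r (length x)) \<and>
      fst (last (snd (run ?M [x] (poly r (length x))))) = string_cells (map (F x) [0..<L x])" for x
    unfolding halts_within_def run by (simp add: halting_def last_machine_tapes)
  then show ?thesis unfolding polytime_computable_def using tm_wf_machine[of c] by blast
qed

section \<open>Accepting computations as tilings\<close>

definition offset :: "move \<Rightarrow> int" where
  "offset m = move_head m 0"

lemma move_head_offset: "move_head m h = h + offset m"
  by (cases m) (auto simp: offset_def)

lemma abs_offset_le: "\<bar>offset m\<bar> \<le> 1"
  by (cases m) (auto simp: offset_def)

text \<open>Tapes are described relative to the head, so that the scanned cell is always cell 0.\<close>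

definition view :: "int \<Rightarrow> tape list \<Rightarrow> nat list" where
  "view s ts = map (\<lambda>(f, h). f (h + s)) ts"

lemma view_0: "view 0 ts = map scan ts"
  by (auto simp: view_def)

lemma nth_view_map2_act:
  assumes "length acts = length ts" "i < length ts"
  shows "view s (map2 act acts ts) ! i = (let (b, m) = acts ! i in
    if s + offset m = 0 then b else view (s + offset m) ts ! i)"
proof -
  obtain f h b m where "ts ! i = (f, h)" "acts ! i = (b, m)" by fastforce
  moreover have "h + offset m + s = h \<longleftrightarrow> s + offset m = 0" by auto
  ultimately show ?thesis using assms by (auto simp: view_def move_head_offset add_ac)
qed

text \<open>A tile describes a configuration as seen from one position of the tapes.\<close>

datatype tile = Tile (state: nat) (scanned: "nat list") (symbols: "nat list")

definition run_tile :: "config \<Rightarrow> int \<Rightarrow> tile" where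
  "run_tile c s = Tile (fst c) (map scan (snd c)) (view s (snd c))"

lemma run_tile_sel [simp]:
  "state (run_tile c s) = fst c" "scanned (run_tile c s) = map scan (snd c)"
  "symbols (run_tile c s) = view s (snd c)"
  by (simp_all add: run_tile_def)

locale verifier =
  fixes M :: tm
  assumes wf: "tm_wf M" and two_tapes: "2 \<le> tm_tapes M"
begin

definition effect :: "nat \<Rightarrow> nat list \<Rightarrow> nat \<times> (nat \<times> move) list" where
  "effect q as = (if halting M q then (q, map (\<lambda>a. (a, MoveStay)) as) else tm_delta M q as)"

lemma step_effect:
  "step M (q, ts) = (fst (effect q (map scan ts)), map2 act (snd (effect q (map scan ts))) ts)"
proof -
  have "act (scan p, MoveStay) p = p" for p by (cases p) auto
  then have "map2 act (map (\<lambda>a. (a, MoveStay)) (map scan ts)) ts = ts"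
    by (intro nth_equalityI) auto
  then show ?thesis by (auto simp: effect_def split: prod.splits)
qed

declare step.simps [simp del]

definition symbol_lists :: "nat list set" where
  "symbol_lists = {as. set as \<subseteq> {..<tm_symbols M} \<and> length as = tm_tapes M}"

definition tiles :: "tile set" where
  "tiles = {\<tau>. state \<tau> < tm_states M \<and> scanned \<tau> \<in> symbol_lists \<and> symbols \<tau> \<in> symbol_lists}"

lemma finite_tiles: "finite tiles"
proof -
  have "tiles = (\<lambda>(q, as, bs). Tile q as bs) ` ({..<tm_states M} \<times> symbol_lists \<times> symbol_lists)"
    by (force simp: tiles_def image_iff intro: tile.collapse[symmetric])
  then show ?thesis by (simp add: symbol_lists_def finite_lists_length_eq)
qed

definition config_wf :: "config \<Rightarrow> bool" where
  "config_wf c \<longleftrightarrow> fst c < tm_states M \<and> length (snd c) = tm_tapes M \<and>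
     (\<forall>(f, h) \<in> set (snd c). \<forall>p. f p < tm_symbols M)"

lemma view_in_symbol_lists: "config_wf c \<Longrightarrow> view s (snd c) \<in> symbol_lists"
  by (fastforce simp: config_wf_def symbol_lists_def view_def)

lemma run_tile_in_tiles: "config_wf c \<Longrightarrow> run_tile c s \<in> tiles"
  using view_in_symbol_lists[of c 0] view_in_symbol_lists[of c s]
  by (simp add: tiles_def view_0 config_wf_def)

lemma effect_wf:
  assumes "q < tm_states M" "as \<in> symbol_lists"
  shows "fst (effect q as) < tm_states M" "length (snd (effect q as)) = tm_tapes M"
    "i < tm_tapes M \<Longrightarrow> fst (snd (effect q as) ! i) < tm_symbols M"
proof -
  obtain q' acts where d: "tm_delta M q as = (q', acts)" by fastforce
  then have wf': "q' < tm_states M \<and> length acts = tm_tapes M \<and>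
      (\<forall>(b, m) \<in> set acts. b < tm_symbols M)"
    using wf assms unfolding tm_wf_def symbol_lists_def by fastforce
  have as: "set as \<subseteq> {..<tm_symbols M}" "length as = tm_tapes M"
    using assms(2) by (simp_all add: symbol_lists_def)
  have "fst (acts ! i) < tm_symbols M" if "i < tm_tapes M" for i
    using wf' that nth_mem[of i acts] by (cases "acts ! i") auto
  moreover have "as ! i < tm_symbols M" if "i < tm_tapes M" for i
    using as that nth_mem[of i as] by (metis lessThan_iff subsetD)
  ultimately show "fst (effect q as) < tm_states M" "length (snd (effect q as)) = tm_tapes M"
    "i < tm_tapes M \<Longrightarrow> fst (snd (effect q as) ! i) < tm_symbols M"
    using assms(1) as wf' d by (auto simp: effect_def)
qed

lemma config_wf_init: "length xs \<le> tm_tapes M \<Longrightarrow> config_wf (init_config M xs)"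
proof -
  assume "length xs \<le> tm_tapes M"
  moreover have "3 \<le> tm_symbols M" "tm_start M < tm_states M" using wf by (auto simp: tm_wf_def)
  moreover from this have "string_cells x i < tm_symbols M" for x i
    by (auto simp: string_cells_def bit_symbol_def)
  ultimately show "config_wf (init_config M xs)"
    by (auto simp: init_config_def config_wf_def)
qed

lemma config_wf_step:
  assumes "config_wf c" shows "config_wf (step M c)"
proof -
  obtain q ts where c: "c = (q, ts)" by fastforce
  let ?as = "map scan ts"
  have "q < tm_states M" "?as \<in> symbol_lists" "length ts = tm_tapes M"
    using assms view_in_symbol_lists[OF assms, of 0] by (simp_all add: c config_wf_def view_0)
  note effect = effect_wf[OF this(1,2)] and length = this(3)
  have "f p < tm_symbols M"
    if "i < tm_tapes M" "act (snd (effect q ?as) ! i) (ts ! i) = (f, h)" for f h p i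
  proof -
    obtain f0 h0 where f0: "ts ! i = (f0, h0)" by fastforce
    then have "f0 p < tm_symbols M" for p
      using assms that(1) length nth_mem[of i ts] by (fastforce simp: c config_wf_def)
    then show ?thesis using that f0 effect(3)[OF that(1)] by (cases "snd (effect q ?as) ! i") auto
  qed
  then have "\<forall>(f, h) \<in> set (map2 act (snd (effect q ?as)) ts). \<forall>p. f p < tm_symbols M"
    using effect(2) length by (auto simp: in_set_conv_nth simp del: act.simps)
  then show ?thesis using effect length by (simp add: c step_effect config_wf_def)
qed

lemma run_Suc: "run M xs (Suc n) = step M (run M xs n)"
  by (simp add: run_def)

lemma config_wf_run: "length xs \<le> tm_tapes M \<Longrightarrow> config_wf (run M xs n)"
  by (induction n) (simp_all add: run_def config_wf_init config_wf_step)

text \<open>The first tile lies \<open>d\<close> cells to the right of the second one and one time step earlier;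
  \<open>b\<close> tells whether it is the scanned cell.\<close>

definition step_ok :: "int \<Rightarrow> bool \<Rightarrow> tile \<Rightarrow> tile \<Rightarrow> bool" where
  "step_ok d b \<tau> \<tau>' \<longleftrightarrow> (let (q, acts) = effect (state \<tau>) (scanned \<tau>) in state \<tau>' = q \<and>
     (\<forall>i < tm_tapes M. offset (snd (acts ! i)) = d \<longrightarrow>
        symbols \<tau>' ! i = (if b then fst (acts ! i) else symbols \<tau> ! i)))"

lemma nth_view_step:
  assumes "config_wf c" "i < tm_tapes M"
    "d = offset (snd (snd (effect (fst c) (map scan (snd c))) ! i))"
  shows "view s (snd (step M c)) ! i =
    (if s + d = 0 then fst (snd (effect (fst c) (map scan (snd c))) ! i)
      else view (s + d) (snd c) ! i)"
proof -
  obtain q ts where c: "c = (q, ts)" by fastforce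
  have "map scan ts \<in> symbol_lists" using view_in_symbol_lists[OF assms(1), of 0]
    by (simp add: c view_0)
  then have "length (snd (effect q (map scan ts))) = tm_tapes M"
    using effect_wf(2) assms(1) by (simp add: c config_wf_def)
  then show ?thesis
    using assms nth_view_map2_act[of "snd (effect q (map scan ts))" ts i s]
    by (simp add: c step_effect config_wf_def split_beta)
qed

lemma step_ok_run_tile:
  assumes "config_wf c"
  shows "step_ok (s' - s) (s' = 0) (run_tile c s') (run_tile (step M c) s)"
proof -
  have "fst (step M c) = fst (effect (fst c) (map scan (snd c)))"
    by (cases c) (simp add: step_effect)
  then show ?thesis using nth_view_step[OF assms] by (simp add: step_ok_def split_beta)
qed

definition start_ok :: "tile \<Rightarrow> bool" where
  "start_ok \<tau> \<longleftrightarrow> state \<tau> = tm_start M \<and> symbols \<tau> ! 1 \<le> 2 \<and>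
     (\<forall>i. 2 \<le> i \<and> i < tm_tapes M \<longrightarrow> symbols \<tau> ! i = 0)"

text \<open>Column \<open>j\<close> is the position \<open>j - T\<close> relative to the heads, which suffices for \<open>T\<close> steps. The
  certificate is unknown, but has length at most \<open>P\<close>.\<close>

definition compatible :: "bool list \<Rightarrow> nat \<Rightarrow> nat \<Rightarrow> nat \<Rightarrow> nat \<Rightarrow> tile \<Rightarrow> nat \<Rightarrow> nat \<Rightarrow> tile \<Rightarrow> bool" where
  "compatible x T P t j \<tau> t' j' \<tau>' \<longleftrightarrow>
     (t = t' \<longrightarrow> state \<tau> = state \<tau>' \<and> scanned \<tau> = scanned \<tau>') \<and>
     (j = T \<longrightarrow> symbols \<tau> = scanned \<tau>) \<and>
     (t' = t + 1 \<longrightarrow>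
       (j = j' \<longrightarrow> step_ok 0 (j = T) \<tau> \<tau>') \<and>
       (j = j' + 1 \<longrightarrow> step_ok 1 (j = T) \<tau> \<tau>') \<and>
       (j' = j + 1 \<longrightarrow> step_ok (- 1) (j = T) \<tau> \<tau>')) \<and>
     (t = 0 \<longrightarrow> start_ok \<tau> \<and>
       symbols \<tau> ! 0 = (if T \<le> j then string_cells x (int (j - T)) else 0) \<and>
       (j < T \<or> T + P \<le> j \<longrightarrow> symbols \<tau> ! 1 = 0) \<and>
       (t' = 0 \<and> T \<le> j \<and> j' = j + 1 \<and> symbols \<tau> ! 1 = 0 \<longrightarrow> symbols \<tau>' ! 1 = 0)) \<and>
     (t = T \<longrightarrow> state \<tau> = tm_accept M)"

definition tiling :: "bool list \<Rightarrow> nat \<Rightarrow> nat \<Rightarrow> (nat \<Rightarrow> nat \<Rightarrow> tile) \<Rightarrow> bool" where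
  "tiling x T P G \<longleftrightarrow> (\<forall>t\<le>T. \<forall>j\<le>2 * T. G t j \<in> tiles) \<and>
     (\<forall>t\<le>T. \<forall>j\<le>2 * T. \<forall>t'\<le>T. \<forall>j'\<le>2 * T. compatible x T P t j (G t j) t' j' (G t' j'))"

lemma tilingD:
  assumes "tiling x T P G" "t \<le> T" "j \<le> 2 * T"
  shows "G t j \<in> tiles" "t' \<le> T \<Longrightarrow> j' \<le> 2 * T \<Longrightarrow> compatible x T P t j (G t j) t' j' (G t' j')"
  using assms by (simp_all add: tiling_def)

lemma view_init:
  assumes "i < tm_tapes M"
  shows "view s (snd (init_config M [x, u])) ! i =
    (if i = 0 then string_cells x s else if i = 1 then string_cells u s else 0)"
  using assms by (auto simp: init_config_def view_def nth_Cons string_cells_def split: nat.splits)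

lemma string_cells_le_2: "string_cells u s \<le> 2"
  by (simp add: string_cells_def bit_symbol_def)

lemma tiling_of_run:
  assumes u: "length u \<le> P" and acc: "fst (run M [x, u] T) = tm_accept M"
  shows "tiling x T P (\<lambda>t j. run_tile (run M [x, u] t) (int j - int T))"
  unfolding tiling_def
proof (intro conjI allI impI)
  let ?c = "run M [x, u]"
  have wf_run: "config_wf (?c t)" for t using two_tapes by (intro config_wf_run) simp
  fix t j assume "t \<le> T" "j \<le> 2 * T"
  show "run_tile (?c t) (int j - int T) \<in> tiles" by (rule run_tile_in_tiles[OF wf_run])
  fix t' j' assume "t' \<le> T" "j' \<le> 2 * T"
  let ?s = "int j - int T" and ?s' = "int j' - int T"
  have "step_ok (int j - int j') (j = T) (run_tile (?c t) ?s) (run_tile (?c (Suc t)) ?s')"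
    using step_ok_run_tile[OF wf_run[of t], of ?s ?s'] by (simp add: run_Suc)
  moreover have init: "?c 0 = init_config M [x, u]" by (simp add: run_def)
  have "0 < tm_tapes M" "1 < tm_tapes M" using two_tapes by auto
  then have "symbols (run_tile (?c 0) s) ! 0 = string_cells x s"
    "symbols (run_tile (?c 0) s) ! 1 = string_cells u s" for s
    by (simp_all add: init view_init)
  moreover have "start_ok (run_tile (?c 0) ?s)"
    using two_tapes string_cells_le_2
    by (auto simp: start_ok_def init view_init) (simp add: init_config_def)
  moreover have "string_cells x ?s = (if T \<le> j then string_cells x (int (j - T)) else 0)"
    by (simp add: string_cells_def)
  moreover have "j < T \<or> T + P \<le> j \<Longrightarrow> string_cells u ?s = 0"
    using u by (auto simp: string_cells_def)
  moreover have "T \<le> j \<Longrightarrow> j' = j + 1 \<Longrightarrow> string_cells u ?s = 0 \<Longrightarrow> string_cells u ?s' = 0"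
    by (auto simp: string_cells_def bit_symbol_def split: if_splits)
  ultimately show "compatible x T P t j (run_tile (?c t) ?s) t' j' (run_tile (?c t') ?s')"
    using acc by (auto simp: compatible_def view_0)
qed

lemma string_cells_of_sequence:
  fixes c :: "nat \<Rightarrow> nat"
  assumes le: "\<And>j. j \<le> n \<Longrightarrow> c j \<le> 2" and step: "\<And>j. j < n \<Longrightarrow> c j = 0 \<Longrightarrow> c (Suc j) = 0"
    and end_zero: "c P = 0" "P \<le> n"
  obtains u where "length u \<le> P" "\<And>j. j \<le> n \<Longrightarrow> c j = string_cells u (int j)"
proof
  define l where "l = (LEAST j. c j = 0)"
  let ?u = "map (\<lambda>j. c j = 2) [0..<l]"
  show lP: "length ?u \<le> P" using end_zero(1) by (simp add: l_def Least_le)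
  fix j assume j: "j \<le> n"
  show "c j = string_cells ?u (int j)"
  proof (cases "j < l")
    case True
    then have "c j \<noteq> 0" unfolding l_def by (rule not_less_Least)
    then show ?thesis using True le[OF j] by (auto simp: string_cells_def bit_symbol_def)
  next
    case False
    then have "l \<le> j" by simp
    then have "c j = 0"
      using j
    proof (induction j rule: dec_induct)
      case base
      show ?case unfolding l_def using end_zero(1) by (rule LeastI)
    qed (use step in simp)
    then show ?thesis using False by (simp add: string_cells_def)
  qed
qed

lemma tile_eq_run_tile:
  assumes "\<tau> \<in> tiles" "config_wf c" "state \<tau> = fst c" "scanned \<tau> = map scan (snd c)"
    and "\<And>i. i < tm_tapes M \<Longrightarrow> symbols \<tau> ! i = view s (snd c) ! i"
  shows "\<tau> = run_tile c s"
proof (rule tile.expand)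
  have "symbols \<tau> = view s (snd c)"
    using assms(1,5) view_in_symbol_lists[OF assms(2), of s]
    by (intro nth_equalityI) (auto simp: tiles_def symbol_lists_def)
  then show "state \<tau> = state (run_tile c s) \<and> scanned \<tau> = scanned (run_tile c s) \<and>
      symbols \<tau> = symbols (run_tile c s)"
    using assms(3,4) by simp
qed

text \<open>The tiles of a row share state and scanned symbols, and the tile at the origin makes the
  latter agree with the tape, so it suffices to know the symbols of a row.\<close>

lemma tiling_row_eq:
  assumes G: "tiling x T P G" and t: "t \<le> T" and c: "config_wf c" and q: "state (G t T) = fst c"
    and symbols: "\<And>j i. t \<le> j \<Longrightarrow> j + t \<le> 2 * T \<Longrightarrow> i < tm_tapes M \<Longrightarrow>
      symbols (G t j) ! i = view (int j - int T) (snd c) ! i"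
    and j: "t \<le> j" "j + t \<le> 2 * T"
  shows "G t j = run_tile c (int j - int T)"
proof -
  have "T \<le> 2 * T" "j \<le> 2 * T" using j by simp_all
  note G_T = tilingD[OF G t this(1)] and G_j = tilingD[OF G t this(2)]
  have "symbols (G t T) = scanned (G t T)"
    using G_T(2)[OF t, of T] by (simp add: compatible_def)
  moreover have "symbols (G t T) = view 0 (snd c)"
    using symbols[of T] t G_T(1) view_in_symbol_lists[OF c, of 0]
    by (intro nth_equalityI) (auto simp: tiles_def symbol_lists_def)
  moreover have "state (G t j) = state (G t T)" "scanned (G t j) = scanned (G t T)"
    using G_j(2)[OF t, of T] by (simp_all add: compatible_def)
  ultimately show ?thesis
    using tile_eq_run_tile[OF G_j(1) c] symbols[OF j] q by (simp add: view_0)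
qed

lemma tiling_row_0:
  assumes G: "tiling x T P G"
    and u: "\<And>j. j \<le> T \<Longrightarrow> symbols (G 0 (T + j)) ! 1 = string_cells u (int j)"
    and j: "j \<le> 2 * T"
  shows "G 0 j = run_tile (init_config M [x, u]) (int j - int T)"
proof (rule tiling_row_eq[OF G])
  have start: "start_ok (G 0 j)"
    "symbols (G 0 j) ! 0 = (if T \<le> j then string_cells x (int (j - T)) else 0)"
    "j < T \<Longrightarrow> symbols (G 0 j) ! 1 = 0" if "j \<le> 2 * T" for j
    using tilingD(2)[OF G _ that, of 0 0 j] that by (simp_all add: compatible_def)
  show "state (G 0 T) = fst (init_config M [x, u])"
    using start(1)[of T] by (simp add: start_ok_def init_config_def)
  fix j i assume j: "j + 0 \<le> 2 * T" and i: "i < tm_tapes M"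
  have "symbols (G 0 j) ! 1 = string_cells u (int j - int T)"
  proof (cases "j < T")
    case True
    then show ?thesis using start(3)[of j] by (simp add: string_cells_def)
  next
    case False
    then show ?thesis using u[of "j - T"] j by simp
  qed
  moreover have "symbols (G 0 j) ! 0 = string_cells x (int j - int T)"
    using start(2)[of j] j by (simp add: string_cells_def)
  moreover have "2 \<le> i \<Longrightarrow> symbols (G 0 j) ! i = 0"
    using start(1)[of j] i j by (simp add: start_ok_def)
  ultimately show "symbols (G 0 j) ! i = view (int j - int T) (snd (init_config M [x, u])) ! i"
    unfolding view_init[OF i] by (cases "i = 0"; cases "i = 1"; simp)
qed (use two_tapes j in \<open>auto intro: config_wf_init\<close>)

lemma tiling_row_Suc:
  assumes G: "tiling x T P G" and t: "Suc t \<le> T" and c: "config_wf c"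
    and row: "\<And>j. t \<le> j \<Longrightarrow> j + t \<le> 2 * T \<Longrightarrow> G t j = run_tile c (int j - int T)"
    and j: "Suc t \<le> j" "j + Suc t \<le> 2 * T"
  shows "G (Suc t) j = run_tile (step M c) (int j - int T)"
proof (rule tiling_row_eq[OF G])
  let ?effect = "effect (fst c) (map scan (snd c))"
  have step: "step_ok (int j' - int j) (j' = T) (G t j') (G (Suc t) j)"
    if j: "j \<le> 2 * T" "j' \<le> 2 * T" "\<bar>int j' - int j\<bar> \<le> 1" for j j'
  proof -
    consider "j' = j" | "j' = Suc j" | "j = Suc j'" using j(3) by linarith
    then show ?thesis
      using tilingD(2)[OF G, of t j' "Suc t" j] t j(1,2) by cases (simp_all add: compatible_def)
  qed
  have "fst (step M c) = fst ?effect" by (cases c) (simp add: step_effect)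
  then show "state (G (Suc t) T) = fst (step M c)"
    using step[of T T] row[of T] t by (simp add: step_ok_def split_beta)
  fix j i assume j: "Suc t \<le> j" "j + Suc t \<le> 2 * T" and i: "i < tm_tapes M"
  define d where "d = offset (snd (snd ?effect ! i))"
  define j' where "j' = nat (int j + d)"
  have d: "\<bar>d\<bar> \<le> 1" using abs_offset_le by (simp add: d_def)
  then have j': "int j' = int j + d" using j by (simp add: j'_def)
  then have j'_range: "t \<le> j'" "j' + t \<le> 2 * T" using d j by linarith+
  have "step_ok d (j' = T) (run_tile c (int j' - int T)) (G (Suc t) j)"
    using step[of j j'] d j j' j'_range row[OF j'_range] by simp
  then have "symbols (G (Suc t) j) ! i =
      (if j' = T then fst (snd ?effect ! i) else view (int j' - int T) (snd c) ! i)"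
    using i by (simp add: step_ok_def d_def split_beta)
  moreover have "int j' - int T = int j - int T + d" "j' = T \<longleftrightarrow> int j - int T + d = 0"
    using j' by auto
  ultimately show "symbols (G (Suc t) j) ! i = view (int j - int T) (snd (step M c)) ! i"
    unfolding nth_view_step[OF c i d_def] by (simp only:)
qed (use t c j in \<open>auto intro: config_wf_step\<close>)

lemma tiling_eq_run:
  assumes G: "tiling x T P G"
    and u: "\<And>j. j \<le> T \<Longrightarrow> symbols (G 0 (T + j)) ! 1 = string_cells u (int j)"
    and "t \<le> T" "t \<le> j" "j + t \<le> 2 * T"
  shows "G t j = run_tile (run M [x, u] t) (int j - int T)"
  using assms(3-)
proof (induction t arbitrary: j)
  case 0
  then show ?case using tiling_row_0[OF G u] by (simp add: run_def)
next
  case (Suc t)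
  have "config_wf (run M [x, u] t)" using two_tapes by (intro config_wf_run) simp
  then show ?case unfolding run_Suc using Suc by (intro tiling_row_Suc[OF G]) simp_all
qed

lemma tiling_accepts:
  assumes G: "tiling x T P G" and "P \<le> T"
  obtains u where "length u \<le> P" "fst (run M [x, u] T) = tm_accept M"
proof -
  let ?c = "\<lambda>j. symbols (G 0 (T + j)) ! 1"
  have row: "compatible x T P 0 (T + j) (G 0 (T + j)) 0 j' (G 0 j')" if "j \<le> T" "j' \<le> 2 * T"
    for j j'
    using tilingD(2)[OF G, of 0 "T + j" 0 j'] that by simp
  have "?c j \<le> 2" if "j \<le> T" for j
    using row[OF that, of T] by (simp add: compatible_def start_ok_def)
  moreover have "?c (Suc j) = 0" if "j < T" "?c j = 0" for j
    using row[of j "T + Suc j"] that by (simp add: compatible_def)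
  moreover have "?c P = 0" using row[OF assms(2), of T] by (simp add: compatible_def)
  ultimately obtain u where u: "length u \<le> P" "\<And>j. j \<le> T \<Longrightarrow> ?c j = string_cells u (int j)"
    using string_cells_of_sequence[of T ?c P] assms(2) by blast
  have "state (G T T) = tm_accept M"
    using tilingD(2)[OF G order_refl, of T T T] by (simp add: compatible_def)
  then have "fst (run M [x, u] T) = tm_accept M"
    using tiling_eq_run[OF G u(2), of T T] by simp
  then show ?thesis using that u(1) by blast
qed

lemma accepting_iff_tiling:
  assumes "P \<le> T"
  shows "(\<exists>u. length u \<le> P \<and> fst (run M [x, u] T) = tm_accept M) \<longleftrightarrow> (\<exists>G. tiling x T P G)"
  using tiling_of_run tiling_accepts[OF _ assms] by metis

end

section \<open>Binary constraints as clauses\<close>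

lemma mult_add_less_mult:
  fixes a j R W :: nat
  assumes "a < R" "j < W" shows "a * W + j < R * W"
proof -
  have "a * W + j < Suc a * W" using assms(2) by simp
  also have "\<dots> \<le> R * W" using assms(1) by (intro mult_le_mono1) simp
  finally show ?thesis .
qed

lemma div_mult_add_less: "j < W \<Longrightarrow> (a * W + j) div W = a" for a j W :: nat
  by simp

lemma mod_mult_add_less: "j < W \<Longrightarrow> (a * W + j) mod W = j" for a j W :: nat
  by simp

text \<open>Clause \<open>j < W\<close> is present if \<open>active j\<close>. Its literals are all positive or all negative, as
  told by \<open>pos j\<close>, and their variables are those with \<open>occurs v j\<close>.\<close>

definition satisfiable :: "nat \<Rightarrow> nat \<Rightarrow> (nat \<Rightarrow> bool) \<Rightarrow> (nat \<Rightarrow> bool) \<Rightarrow> (nat \<Rightarrow> nat \<Rightarrow> bool) \<Rightarrow> bool"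
  where
  "satisfiable N W active pos occurs \<longleftrightarrow>
     (\<exists>\<alpha>. \<forall>j<W. active j \<longrightarrow> (\<exists>v<N. occurs v j \<and> \<alpha> v = pos j))"

text \<open>A choice of a value \<open>g i < n\<close> for each of \<open>m\<close> items, where the value \<open>a\<close> of item \<open>i\<close> is
  encoded as \<open>i * n + a\<close>.\<close>

definition conflict_free :: "nat \<Rightarrow> nat \<Rightarrow> (nat \<Rightarrow> nat \<Rightarrow> bool) \<Rightarrow> (nat \<Rightarrow> nat) \<Rightarrow> bool" where
  "conflict_free m n conflict g \<longleftrightarrow> (\<forall>i<m. g i < n) \<and>
     (\<forall>i<m. \<forall>i'<m. \<not> conflict (i * n + g i) (i' * n + g i'))"

text \<open>The first \<open>m\<close> clauses say that every item gets some value, the others that no two conflicting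
  choices are made.\<close>

definition choice_clause :: "nat \<Rightarrow> nat \<Rightarrow> (nat \<Rightarrow> nat \<Rightarrow> bool) \<Rightarrow> nat \<Rightarrow> bool" where
  "choice_clause m n conflict j \<longleftrightarrow>
     j < m \<or> conflict ((j - m) div (m * n)) ((j - m) mod (m * n))"

definition choice_occurs :: "nat \<Rightarrow> nat \<Rightarrow> nat \<Rightarrow> nat \<Rightarrow> bool" where
  "choice_occurs m n v j \<longleftrightarrow> (if j < m then v div n = j
     else v = (j - m) div (m * n) \<or> v = (j - m) mod (m * n))"

abbreviation choice_satisfiable :: "nat \<Rightarrow> nat \<Rightarrow> (nat \<Rightarrow> nat \<Rightarrow> bool) \<Rightarrow> bool" where
  "choice_satisfiable m n conflict \<equiv> satisfiable (m * n) (m + m * n * (m * n))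
     (choice_clause m n conflict) (\<lambda>j. j < m) (choice_occurs m n)"

lemma satisfiable_of_conflict_free:
  assumes "conflict_free m n conflict g"
  shows "choice_satisfiable m n conflict"
  unfolding satisfiable_def
proof (intro exI[of _ "\<lambda>v. v mod n = g (v div n)"] allI impI)
  let ?\<alpha> = "\<lambda>v. v mod n = g (v div n)"
  fix j assume j: "j < m + m * n * (m * n)" and active: "choice_clause m n conflict j"
  show "\<exists>v<m * n. choice_occurs m n v j \<and> ?\<alpha> v = (j < m)"
  proof (cases "j < m")
    case True
    then have "g j < n" using assms by (simp add: conflict_free_def)
    then show ?thesis using True
      by (intro exI[of _ "j * n + g j"])
        (simp add: choice_occurs_def mult_add_less_mult div_mult_add_less)
  next
    case False
    let ?v = "(j - m) div (m * n)" and ?v' = "(j - m) mod (m * n)"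
    have "j - m < m * n * (m * n)" using j False by simp
    moreover from this have "0 < m * n" by (cases "m * n") auto
    ultimately have v: "?v < m * n" "?v' < m * n" by (auto simp: less_mult_imp_div_less)
    have "\<not> (?\<alpha> ?v \<and> ?\<alpha> ?v')"
    proof
      assume \<alpha>: "?\<alpha> ?v \<and> ?\<alpha> ?v'"
      have "?v div n < m" "?v' div n < m" using v by (simp_all add: less_mult_imp_div_less)
      then have "\<not> conflict (?v div n * n + ?v mod n) (?v' div n * n + ?v' mod n)"
        using assms \<alpha> unfolding conflict_free_def by metis
      then show False using active False by (simp add: choice_clause_def)
    qed
    then show ?thesis using False v by (auto simp: choice_occurs_def)
  qed
qed

lemma conflict_free_of_satisfiable:
  assumes "choice_satisfiable m n conflict"
  obtains g where "conflict_free m n conflict g"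
proof -
  obtain \<alpha> where \<alpha>: "\<exists>v<m * n. choice_occurs m n v j \<and> \<alpha> v = (j < m)"
    if "j < m + m * n * (m * n)" "choice_clause m n conflict j" for j
    using assms unfolding satisfiable_def by blast
  have "\<exists>v<m * n. v div n = i \<and> \<alpha> v" if "i < m" for i
    using \<alpha>[of i] that by (auto simp: choice_clause_def choice_occurs_def)
  then obtain V where V: "V i < m * n" "V i div n = i" "\<alpha> (V i)" if "i < m" for i
    by metis
  have "conflict_free m n conflict (\<lambda>i. V i mod n)"
    unfolding conflict_free_def
  proof (intro conjI allI impI notI)
    fix i assume i: "i < m"
    then show "V i mod n < n" using V(1)[OF i] by (cases "n = 0") simp_all
    fix i' assume i': "i' < m" and "conflict (i * n + V i mod n) (i' * n + V i' mod n)"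
    moreover have V_eq: "V i = i * n + V i mod n" if "i < m" for i
      using V(2)[OF that] div_mult_mod_eq[of "V i" n] by simp
    ultimately have conflict: "conflict (V i) (V i')" using i i' by metis
    let ?j = "m + (V i * (m * n) + V i')"
    have decode: "(?j - m) div (m * n) = V i" "(?j - m) mod (m * n) = V i'"
      using div_mult_add_less[OF V(1)[OF i']] mod_mult_add_less[OF V(1)[OF i']] by simp_all
    have "?j < m + m * n * (m * n)"
      using mult_add_less_mult[OF V(1)[OF i] V(1)[OF i']] by simp
    moreover have "choice_clause m n conflict ?j"
      using conflict unfolding choice_clause_def decode by simp
    ultimately obtain v where "choice_occurs m n v ?j" "\<alpha> v = (?j < m)" using \<alpha> by blast
    then have "v = V i \<or> v = V i'" "\<not> \<alpha> v" unfolding choice_occurs_def decode by simp_all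
    then show False using V(3)[OF i] V(3)[OF i'] by blast
  qed
  then show ?thesis by (rule that)
qed

lemma satisfiable_choice_iff:
  "choice_satisfiable m n conflict \<longleftrightarrow> (\<exists>g. conflict_free m n conflict g)"
  by (blast intro: satisfiable_of_conflict_free elim: conflict_free_of_satisfiable)

context verifier
begin

definition tile_of :: "nat \<Rightarrow> tile" where
  "tile_of = from_nat_into tiles"

lemma bij_betw_tile_of: "bij_betw tile_of {..<card tiles} tiles"
  unfolding tile_of_def using bij_betw_from_nat_into_finite[OF finite_tiles] .

lemma card_tiles_pos: "0 < card tiles"
proof -
  have "run_tile (init_config M []) 0 \<in> tiles" by (intro run_tile_in_tiles config_wf_init) simp
  then show ?thesis using finite_tiles by (auto simp: card_gt_0_iff)
qed

text \<open>Tile \<open>a\<close> at time \<open>t\<close> in column \<open>j\<close> is encoded as \<open>(t * (2 * T + 1) + j) * card tiles + a\<close>.\<close>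

definition tile_conflict :: "bool list \<Rightarrow> nat \<Rightarrow> nat \<Rightarrow> nat \<Rightarrow> nat \<Rightarrow> bool" where
  "tile_conflict x T P v v' \<longleftrightarrow> (let i = v div card tiles; i' = v' div card tiles in
     \<not> compatible x T P (i div (2 * T + 1)) (i mod (2 * T + 1)) (tile_of (v mod card tiles))
         (i' div (2 * T + 1)) (i' mod (2 * T + 1)) (tile_of (v' mod card tiles)))"

lemma tile_conflict_encoded:
  assumes "a < card tiles" "a' < card tiles"
  shows "tile_conflict x T P (i * card tiles + a) (i' * card tiles + a') \<longleftrightarrow>
    \<not> compatible x T P (i div (2 * T + 1)) (i mod (2 * T + 1)) (tile_of a)
        (i' div (2 * T + 1)) (i' mod (2 * T + 1)) (tile_of a')"
  unfolding tile_conflict_def Let_def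
  by (simp only: div_mult_add_less[OF assms(1)] mod_mult_add_less[OF assms(1)]
      div_mult_add_less[OF assms(2)] mod_mult_add_less[OF assms(2)])

lemma conflict_free_of_tiling:
  assumes G: "tiling x T P G"
  obtains g where "conflict_free ((T + 1) * (2 * T + 1)) (card tiles) (tile_conflict x T P) g"
proof
  let ?m = "(T + 1) * (2 * T + 1)" and ?S = "2 * T + 1"
  define g where "g i = inv_into {..<card tiles} tile_of (G (i div ?S) (i mod ?S))" for i
  have index: "i div ?S \<le> T" "i mod ?S \<le> 2 * T" if "i < ?m" for i
    using less_mult_imp_div_less[OF that] mod_less_divisor[of ?S i]
    by (simp_all del: mod_less_divisor)
  have "G (i div ?S) (i mod ?S) \<in> tile_of ` {..<card tiles}" if "i < ?m" for i
    using tilingD(1)[OF G index[OF that]] bij_betw_tile_of by (simp add: bij_betw_def)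
  then have g: "g i < card tiles" "tile_of (g i) = G (i div ?S) (i mod ?S)" if "i < ?m" for i
    using that inv_into_into[of _ tile_of "{..<card tiles}"]
      f_inv_into_f[of _ tile_of "{..<card tiles}"]
    by (simp_all add: g_def)
  have "\<not> tile_conflict x T P (i * card tiles + g i) (i' * card tiles + g i')" if "i < ?m" "i' < ?m"
    for i i'
    unfolding tile_conflict_encoded[OF g(1)[OF that(1)] g(1)[OF that(2)]] g(2)[OF that(1)]
      g(2)[OF that(2)]
    using tilingD(2)[OF G index[OF that(1)] index[OF that(2)]] by simp
  then show "conflict_free ?m (card tiles) (tile_conflict x T P) g"
    using g(1) by (simp add: conflict_free_def)
qed

lemma tiling_of_conflict_free:
  assumes "conflict_free ((T + 1) * (2 * T + 1)) (card tiles) (tile_conflict x T P) g"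
  shows "tiling x T P (\<lambda>t j. tile_of (g (t * (2 * T + 1) + j)))"
  unfolding tiling_def
proof (intro conjI allI impI)
  let ?m = "(T + 1) * (2 * T + 1)" and ?S = "2 * T + 1"
  have index: "t * ?S + j < ?m" "(t * ?S + j) div ?S = t" "(t * ?S + j) mod ?S = j"
    if "t \<le> T" "j \<le> 2 * T" for t j
    using that by (intro mult_add_less_mult div_mult_add_less mod_mult_add_less; simp)+
  have g: "g i < card tiles" if "i < ?m" for i
    using assms that by (simp add: conflict_free_def)
  fix t j assume t: "t \<le> T" "j \<le> 2 * T"
  show "tile_of (g (t * ?S + j)) \<in> tiles"
    using bij_betwE[OF bij_betw_tile_of] g[OF index(1)[OF t]] by simp
  fix t' j' assume t': "t' \<le> T" "j' \<le> 2 * T"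
  have "\<not> tile_conflict x T P ((t * ?S + j) * card tiles + g (t * ?S + j))
      ((t' * ?S + j') * card tiles + g (t' * ?S + j'))"
    using assms index(1)[OF t] index(1)[OF t'] unfolding conflict_free_def by blast
  then show "compatible x T P t j (tile_of (g (t * ?S + j))) t' j' (tile_of (g (t' * ?S + j')))"
    unfolding tile_conflict_encoded[OF g[OF index(1)[OF t]] g[OF index(1)[OF t']]]
      index(2,3)[OF t] index(2,3)[OF t'] by simp
qed

lemma accepting_iff_conflict_free:
  assumes "P \<le> T"
  shows "(\<exists>u. length u \<le> P \<and> fst (run M [x, u] T) = tm_accept M) \<longleftrightarrow>
    (\<exists>g. conflict_free ((T + 1) * (2 * T + 1)) (card tiles) (tile_conflict x T P) g)"
  unfolding accepting_iff_tiling[OF assms]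
  by (blast intro: tiling_of_conflict_free elim: conflict_free_of_tiling)

end

subsection \<open>Deciding conflicts in polynomial time\<close>

lemma polytime_fun_string_cells:
  assumes "polytime_fun d f" shows "polytime_fun d (\<lambda>z vs. string_cells (fst z) (int (f z vs)))"
proof -
  have "string_cells x (int i) = (if i < length x then if nth_bit x i then 2 else 1 else 0)" for x i
    by (simp add: string_cells_def nth_bit_def bit_symbol_def)
  then show ?thesis using assms by (simp only:) (intro polytime_intros)
qed

context verifier
begin

lemma polytime_pred_step_ok:
  assumes "polytime_pred d B" shows "polytime_pred d (\<lambda>z vs. step_ok e (B z vs) \<tau> \<tau>')"
proof (rule polytime_pred_cong)
  show "polytime_pred d (\<lambda>z vs. if B z vs then step_ok e True \<tau> \<tau>' else step_ok e False \<tau> \<tau>')"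
    by (intro polytime_pred_if polytime_pred_const assms)
qed simp

lemma polytime_pred_compatible:
  assumes "polytime_fun d T" "polytime_fun d P" "polytime_fun d t" "polytime_fun d j"
    "polytime_fun d t'" "polytime_fun d j'"
  shows "polytime_pred d (\<lambda>z vs. compatible (fst z) (T z vs) (P z vs) (t z vs) (j z vs) \<tau> (t' z vs)
      (j' z vs) \<tau>')"
  unfolding compatible_def
  by (intro polytime_intros polytime_fun_string_cells polytime_pred_step_ok assms)

lemma polytime_pred_tile_conflict:
  assumes T: "polytime_fun d T" and P: "polytime_fun d P" and v: "polytime_fun d v"
    and v': "polytime_fun d v'"
  shows "polytime_pred d (\<lambda>z vs. tile_conflict (fst z) (T z vs) (P z vs) (v z vs) (v' z vs))"
proof -
  let ?n = "card tiles"
  define Q where "Q a a' z vs \<longleftrightarrow> \<not> compatible (fst z) (T z vs) (P z vs)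
    (v z vs div ?n div (2 * T z vs + 1)) (v z vs div ?n mod (2 * T z vs + 1)) (tile_of a)
    (v' z vs div ?n div (2 * T z vs + 1)) (v' z vs div ?n mod (2 * T z vs + 1)) (tile_of a')"
    for a a' z vs
  have mod: "polytime_pred d (\<lambda>z vs. f z vs mod ?n = a)" "f z vs mod ?n \<in> {..<?n}"
    if "polytime_fun d f" for f a z vs
    using that card_tiles_pos by (auto intro!: polytime_intros)
  have "polytime_pred d (\<lambda>z vs. Q a a' z vs)" for a a'
    unfolding Q_def
    by (intro polytime_pred_not polytime_pred_compatible polytime_intros T P v v')
  then have "polytime_pred d (\<lambda>z vs. Q a (v' z vs mod ?n) z vs)" for a
    by (intro polytime_pred_finite_range[where Q = "Q a", OF finite_lessThan mod(2)[OF v']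
      mod(1)[OF v']])
  then have "polytime_pred d (\<lambda>z vs. Q (v z vs mod ?n) (v' z vs mod ?n) z vs)"
    by (intro polytime_pred_finite_range[where Q = "\<lambda>a z vs. Q a (v' z vs mod ?n) z vs",
        OF finite_lessThan mod(2)[OF v] mod(1)[OF v]])
  then show ?thesis by (simp add: Q_def tile_conflict_def Let_def)
qed

end

section \<open>Lucky labelings of regular graphs\<close>

lemma lucky_number_le:
  assumes "lucky_labeling G l" "\<And>v. v \<in> pverts G \<Longrightarrow> l v \<in> {1..k}" "0 < k"
  shows "lucky_number G \<le> k"
  unfolding lucky_number_def using assms by (intro Least_le) blast

lemma lucky_number_attained:
  assumes "pair_graph G"
  obtains l where "lucky_labeling G l" "\<And>v. v \<in> pverts G \<Longrightarrow> l v \<in> {1..lucky_number G}"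
    "0 < lucky_number G"
  using LeastI_ex[OF lucky_labeling_exists[OF assms]] unfolding lucky_number_def by blast

lemma out_degree_with_proj: "out_degree (with_proj G) v = card {w. (v, w) \<in> parcs G}"
proof -
  have "out_arcs (with_proj G) v = Pair v ` {w. (v, w) \<in> parcs G}" by (auto simp: out_arcs_def)
  then show ?thesis by (simp add: out_degree_def card_image inj_on_def)
qed

context pair_graph
begin

lemma lucky_labeling_cong:
  assumes "\<And>v. v \<in> pverts G \<Longrightarrow> l v = l' v"
  shows "lucky_labeling G l \<longleftrightarrow> lucky_labeling G l'"
proof -
  have "(\<Sum>w | (w, u) \<in> parcs G. l w) = (\<Sum>w | (w, u) \<in> parcs G. l' w)" for u
    using in_arcsD1 by (intro sum.cong refl assms) auto
  then show ?thesis by (simp add: lucky_labeling_def)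
qed

lemma card_in_neighbours:
  assumes "regular d G" "v \<in> pverts G" shows "card {w. (w, v) \<in> parcs G} = d"
proof -
  have "{w. (w, v) \<in> parcs G} = {w. (v, w) \<in> parcs G}" using arcs_symmetric by auto
  then show ?thesis using assms by (simp add: regular_def out_degree_with_proj)
qed

lemma lucky_labeling_add_const:
  assumes "regular d G"
  shows "lucky_labeling G (\<lambda>v. c + l v) \<longleftrightarrow> lucky_labeling G l"
proof -
  have "(\<Sum>w | (w, v) \<in> parcs G. c + l w) = d * c + (\<Sum>w | (w, v) \<in> parcs G. l w)" if "v \<in> pverts G"
    for v
    using card_in_neighbours[OF assms that] by (simp add: sum.distrib)
  moreover have "u \<in> pverts G" "v \<in> pverts G" if "(u, v) \<in> parcs G" for u v
    using that in_arcsD1 in_arcsD2 by auto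
  ultimately show ?thesis by (simp add: lucky_labeling_def cong: imp_cong)
qed

lemma not_lucky_labeling_const:
  assumes "regular d G" "0 < d" "pverts G \<noteq> {}"
  shows "\<not> lucky_labeling G (\<lambda>_. c)"
proof
  assume lucky: "lucky_labeling G (\<lambda>_. c)"
  obtain v where v: "v \<in> pverts G" using assms(3) by blast
  then have "{w. (w, v) \<in> parcs G} \<noteq> {}" using card_in_neighbours[OF assms(1)] assms(2) by fastforce
  then obtain u where uv: "(u, v) \<in> parcs G" by blast
  then have "u \<in> pverts G" using in_arcsD1 by auto
  then show False
    using lucky uv v card_in_neighbours[OF assms(1)] by (fastforce simp: lucky_labeling_def)
qed

lemma lucky_number_ge_2:
  assumes "regular d G" "0 < d" "pverts G \<noteq> {}"
  shows "2 \<le> lucky_number G"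
proof (rule ccontr)
  assume "\<not> 2 \<le> lucky_number G"
  moreover obtain l where l: "lucky_labeling G l" "0 < lucky_number G"
    and range: "\<And>v. v \<in> pverts G \<Longrightarrow> l v \<in> {1..lucky_number G}"
    using lucky_number_attained[OF pair_graph_axioms] by blast
  ultimately have "lucky_number G = 1" by simp
  then have "lucky_labeling G (\<lambda>_. 1)"
    using l(1) by (elim lucky_labeling_cong[THEN iffD1, rotated]) (use range in fastforce)
  then show False using not_lucky_labeling_const[OF assms] by blast
qed

lemma lucky_number_eq_2_iff:
  assumes reg: "regular d G" and "0 < d"
  shows "lucky_number G = 2 \<longleftrightarrow> pverts G \<noteq> {} \<and> (\<exists>b. lucky_labeling G (\<lambda>v. of_bool (b v)))"
proof (intro iffI conjI)
  assume two: "lucky_number G = 2"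
  show "pverts G \<noteq> {}"
  proof
    assume empty: "pverts G = {}"
    then have "lucky_labeling G l" for l using in_arcsD1 by (fastforce simp: lucky_labeling_def)
    then have "lucky_number G \<le> 1" by (rule lucky_number_le) (simp_all add: empty)
    then show False using two by simp
  qed
  obtain l where l: "lucky_labeling G l" "\<And>v. v \<in> pverts G \<Longrightarrow> l v \<in> {1..2}"
    using lucky_number_attained[OF pair_graph_axioms] two by metis
  have "lucky_labeling G (\<lambda>v. 1 + of_bool (l v = 2))"
    using l(1) by (rule lucky_labeling_cong[THEN iffD1, rotated]) (use l(2) in fastforce)
  then show "\<exists>b. lucky_labeling G (\<lambda>v. of_bool (b v))"
    unfolding lucky_labeling_add_const[OF reg] by (rule exI[of _ "\<lambda>v. l v = 2"])
next
  assume "pverts G \<noteq> {} \<and> (\<exists>b. lucky_labeling G (\<lambda>v. of_bool (b v)))"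
  then obtain b where nonempty: "pverts G \<noteq> {}" and b: "lucky_labeling G (\<lambda>v. of_bool (b v))"
    by blast
  have "lucky_labeling G (\<lambda>v. 1 + of_bool (b v))"
    using b by (simp only: lucky_labeling_add_const[OF reg])
  then have "lucky_number G \<le> 2" by (rule lucky_number_le) auto
  then show "lucky_number G = 2"
    using lucky_number_ge_2[OF assms nonempty] by simp
qed

end

section \<open>Adjacency matrices and their encodings\<close>

definition matrix_graph :: "nat \<Rightarrow> (nat \<Rightarrow> nat \<Rightarrow> bool) \<Rightarrow> nat pair_pre_digraph" where
  "matrix_graph n A = \<lparr>pverts = {..<n}, parcs = {(i, j). i < n \<and> j < n \<and> A i j}\<rparr>"

lemma matrix_graph_simps [simp]:
  "pverts (matrix_graph n A) = {..<n}"
  "(i, j) \<in> parcs (matrix_graph n A) \<longleftrightarrow> i < n \<and> j < n \<and> A i j"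
  by (auto simp: matrix_graph_def)

lemma matrix_graph_cong:
  assumes "\<And>i j. i < n \<Longrightarrow> j < n \<Longrightarrow> A i j \<longleftrightarrow> B i j"
  shows "matrix_graph n A = matrix_graph n B"
  using assms by (auto simp: matrix_graph_def)

lemma matrix_graph_cases:
  assumes "pair_graph G" "pverts G = {..<n}"
  obtains A where "G = matrix_graph n A"
proof
  interpret pair_graph G by fact
  have "parcs G = {(i, j). i < n \<and> j < n \<and> (i, j) \<in> parcs G}"
    using assms(2) by (auto dest: in_arcsD1 in_arcsD2)
  then show "G = matrix_graph n (\<lambda>i j. (i, j) \<in> parcs G)"
    using assms(2) by (cases G) (simp add: matrix_graph_def)
qed

lemma pair_graph_matrix_graph_iff:
  "pair_graph (matrix_graph n A) \<longleftrightarrow> (\<forall>i<n. \<forall>j<n. A i j \<longrightarrow> A j i) \<and> (\<forall>i<n. \<not> A i i)"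
proof
  assume "pair_graph (matrix_graph n A)"
  then interpret G: pair_graph "matrix_graph n A" by assumption
  have "A j i" if "i < n" "j < n" "A i j" for i j
    using that G.arcs_symmetric[of i j] by simp
  moreover have "\<not> A i i" if "i < n" for i
    using that G.pair_no_loops[of "(i, i)"] by auto
  ultimately show "(\<forall>i<n. \<forall>j<n. A i j \<longrightarrow> A j i) \<and> (\<forall>i<n. \<not> A i i)" by blast
next
  assume A: "(\<forall>i<n. \<forall>j<n. A i j \<longrightarrow> A j i) \<and> (\<forall>i<n. \<not> A i i)"
  then have irrefl: "\<not> A i i" if "i < n" for i using that by blast
  show "pair_graph (matrix_graph n A)"
  proof
    have "parcs (matrix_graph n A) \<subseteq> {..<n} \<times> {..<n}" by (auto simp: matrix_graph_def)
    then show "finite (parcs (matrix_graph n A))" by (rule finite_subset) simp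
    show "finite (pverts (matrix_graph n A))" by simp
    show "fst e \<in> pverts (matrix_graph n A)" "snd e \<in> pverts (matrix_graph n A)" "fst e \<noteq> snd e"
      if "e \<in> parcs (matrix_graph n A)" for e
      using that irrefl by (auto simp: matrix_graph_def)
    have "sym (parcs (matrix_graph n A))"
      unfolding sym_def matrix_graph_simps(2) using A by blast
    then show "symmetric (with_proj (matrix_graph n A))" by (simp add: symmetric_def)
  qed
qed

lemma regular_matrix_graph_iff:
  "regular d (matrix_graph n A) \<longleftrightarrow> (\<forall>i<n. (\<Sum>j<n. of_bool (A i j)) = d)"
proof -
  have "{j. i < n \<and> j < n \<and> A i j} = {..<n} \<inter> {j. A i j}" if "i < n" for i using that by auto
  then show ?thesis by (simp add: regular_def out_degree_with_proj Ball_def)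
qed

lemma lucky_labeling_matrix_graph_iff:
  "lucky_labeling (matrix_graph n A) l \<longleftrightarrow> (\<forall>i<n. \<forall>j<n. A i j \<longrightarrow>
     (\<Sum>w<n. of_bool (A w i) * l w) \<noteq> (\<Sum>w<n. of_bool (A w j) * l w))"
proof -
  have "{w. w < n \<and> v < n \<and> A w v} = {..<n} \<inter> {w. A w v}" if "v < n" for v using that by auto
  then show ?thesis by (auto simp: lucky_labeling_def)
qed

definition matrix_code :: "nat \<Rightarrow> (nat \<Rightarrow> nat \<Rightarrow> bool) \<Rightarrow> nat \<Rightarrow> bool" where
  "matrix_code n A k \<longleftrightarrow> k < n \<or> n < k \<and> A ((k - n - 1) div n) ((k - n - 1) mod n)"

lemma concat_map_map_upt:
  "concat (map (\<lambda>i. map (f i) [0..<m]) [0..<n]) = map (\<lambda>k. f (k div m) (k mod m)) [0..<n * m]"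
proof (induction n)
  case (Suc n)
  have "map (\<lambda>k. f (k div m) (k mod m)) [n * m..<n * m + m] = map (f n) [0..<m]"
    by (rule nth_equalityI) auto
  moreover have "[0..<Suc n * m] = [0..<n * m] @ [n * m..<n * m + m]"
    using upt_add_eq_append[of 0 "n * m" m] by (simp add: add.commute)
  ultimately show ?case using Suc by simp
qed simp

lemma encode_matrix_graph:
  "encode_graph (matrix_graph n A) = map (matrix_code n A) [0..<n + 1 + n * n]"
proof -
  have "[0..<n + 1 + n * n] = [0..<n] @ [n] @ [n + 1..<n + 1 + n * n]"
    using upt_add_eq_append[of 0 n "1 + n * n"] by (simp add: upt_conv_Cons del: upt_Suc)
  moreover have "map (matrix_code n A) [0..<n] = replicate n True"
    by (rule nth_equalityI) (auto simp: matrix_code_def)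
  moreover have "map (matrix_code n A) [n] = [False]" by (simp add: matrix_code_def)
  moreover have "map (matrix_code n A) [n + 1..<n + 1 + n * n] =
      map (\<lambda>k. (k div n, k mod n) \<in> parcs (matrix_graph n A)) [0..<n * n]"
  proof (rule nth_equalityI)
    fix k assume "k < length (map (matrix_code n A) [n + 1..<n + 1 + n * n])"
    then have k: "k < n * n" by (simp del: upt_Suc)
    then have "0 < n" by (cases n) auto
    then have "k div n < n" "k mod n < n" using k by (auto simp: less_mult_imp_div_less)
    then show "map (matrix_code n A) [n + 1..<n + 1 + n * n] ! k =
      map (\<lambda>k. (k div n, k mod n) \<in> parcs (matrix_graph n A)) [0..<n * n] ! k"
      using k by (simp add: matrix_code_def del: upt_Suc)
  qed (simp del: upt_Suc)
  ultimately show ?thesis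
    unfolding encode_graph_def Let_def concat_map_map_upt matrix_graph_simps card_lessThan by simp
qed

definition is_graph_code :: "nat \<Rightarrow> bool list \<Rightarrow> bool" where
  "is_graph_code n x \<longleftrightarrow> length x = n + 1 + n * n \<and> (\<forall>i<n. nth_bit x i) \<and> \<not> nth_bit x n"

definition decode_graph :: "nat \<Rightarrow> bool list \<Rightarrow> nat pair_pre_digraph" where
  "decode_graph n x = matrix_graph n (\<lambda>i j. nth_bit x (n + 1 + i * n + j))"

lemma nth_bit_encode_matrix_graph:
  "nth_bit (encode_graph (matrix_graph n A)) k \<longleftrightarrow> k < n + 1 + n * n \<and> matrix_code n A k"
  by (auto simp: nth_bit_def encode_matrix_graph simp del: upt_Suc)

lemma is_graph_code_encode: "is_graph_code n (encode_graph (matrix_graph n A))"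
  unfolding is_graph_code_def nth_bit_encode_matrix_graph
  by (simp add: encode_matrix_graph matrix_code_def)

lemma is_graph_code_unique:
  assumes "is_graph_code n x" "is_graph_code m x" shows "n = m"
  using assms unfolding is_graph_code_def by (metis nat_neq_iff)

lemma decode_encode: "decode_graph n (encode_graph (matrix_graph n A)) = matrix_graph n A"
  unfolding decode_graph_def nth_bit_encode_matrix_graph
proof (rule matrix_graph_cong)
  fix i j assume "i < n" "j < n"
  then show "n + 1 + i * n + j < n + 1 + n * n \<and> matrix_code n A (n + 1 + i * n + j) \<longleftrightarrow> A i j"
    using mult_add_less_mult[of i n j n] by (simp add: matrix_code_def)
qed

lemma encode_decode:
  assumes "is_graph_code n x" shows "encode_graph (decode_graph n x) = x"
  unfolding decode_graph_def encode_matrix_graph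
proof (rule nth_equalityI)
  let ?A = "\<lambda>i j. nth_bit x (n + 1 + i * n + j)"
  fix k assume "k < length (map (matrix_code n ?A) [0..<n + 1 + n * n])"
  then have k: "k < n + 1 + n * n" by (simp del: upt_Suc)
  consider (vertices) "k < n" | (separator) "k = n" | (entry) "n < k" by linarith
  then have "matrix_code n ?A k \<longleftrightarrow> nth_bit x k"
  proof cases
    case entry
    have "n + 1 + (k - n - 1) div n * n + (k - n - 1) mod n = n + 1 + (k - n - 1)"
      by (simp only: add.assoc div_mult_mod_eq)
    also have "\<dots> = k" using entry by simp
    finally show ?thesis using entry by (simp add: matrix_code_def)
  qed (use assms in \<open>auto simp: matrix_code_def is_graph_code_def\<close>)
  then show "map (matrix_code n ?A) [0..<n + 1 + n * n] ! k = x ! k"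
    using k assms by (simp add: nth_bit_def is_graph_code_def del: upt_Suc)
qed (use assms in \<open>simp add: is_graph_code_def\<close>)

lemma in_graph_problem_iff:
  "x \<in> graph_problem P \<longleftrightarrow>
   (\<exists>n. is_graph_code n x \<and> pair_graph (decode_graph n x) \<and> P (decode_graph n x))"
proof
  assume "x \<in> graph_problem P"
  then obtain G where x: "x = encode_graph G"
    and G: "pair_graph G" "pverts G = {..<card (pverts G)}"
    and P: "P G"
    unfolding graph_problem_def by blast
  define n where "n = card (pverts G)"
  obtain A where A: "G = matrix_graph n A"
    using matrix_graph_cases[OF G] unfolding n_def by blast
  have "is_graph_code n x" unfolding x A by (rule is_graph_code_encode)
  moreover have "decode_graph n x = G" unfolding x A by (rule decode_encode)
  ultimately show "\<exists>n. is_graph_code n x \<and> pair_graph (decode_graph n x) \<and> P (decode_graph n x)"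
    using G(1) P by blast
next
  assume "\<exists>n. is_graph_code n x \<and> pair_graph (decode_graph n x) \<and> P (decode_graph n x)"
  then obtain n where n: "is_graph_code n x" "pair_graph (decode_graph n x)" "P (decode_graph n x)"
    by blast
  have "pverts (decode_graph n x) = {..<card (pverts (decode_graph n x))}"
    by (simp add: decode_graph_def)
  with n(2,3) have "encode_graph (decode_graph n x) \<in> graph_problem P"
    unfolding graph_problem_def by blast
  then show "x \<in> graph_problem P" by (simp only: encode_decode[OF n(1)])
qed

lemma encode_matrix_graph_in_graph_problem_iff:
  assumes "pair_graph (matrix_graph n A)"
  shows "encode_graph (matrix_graph n A) \<in> graph_problem P \<longleftrightarrow> P (matrix_graph n A)"
proof -
  have "is_graph_code m (encode_graph (matrix_graph n A)) \<longleftrightarrow> m = n" for m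
    using is_graph_code_unique[OF _ is_graph_code_encode] is_graph_code_encode by blast
  then show ?thesis unfolding in_graph_problem_iff using assms by (simp add: decode_encode)
qed

lemma polytime_computable_encode_matrix_graph:
  assumes N: "polytime_fun 0 (\<lambda>z vs. N (fst z))" "polytime_fun 1 (\<lambda>z vs. N (fst z))"
    and A: "\<And>i j. polytime_fun 1 i \<Longrightarrow> polytime_fun 1 j \<Longrightarrow>
      polytime_pred 1 (\<lambda>z vs. A (fst z) (i z vs) (j z vs))"
  shows "polytime_computable (\<lambda>x. encode_graph (matrix_graph (N x) (A x)))"
  unfolding encode_matrix_graph
proof (rule polytime_computable_map_upt)
  show "polytime_fun 0 (\<lambda>z vs. N (fst z) + 1 + N (fst z) * N (fst z))"
    by (intro polytime_intros N)
  show "polytime_pred 1 (\<lambda>z vs. matrix_code (N (fst z)) (A (fst z)) (hd vs))"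
    unfolding matrix_code_def by (intro A polytime_intros N) simp_all
qed

subsection \<open>Membership in NP\<close>

abbreviation (input) cubic_lucky_problem :: "bool list set" where
  "cubic_lucky_problem \<equiv> graph_problem (\<lambda>G. regular 3 G \<and> lucky_number G = 2)"

definition cubic_lucky_verifier :: "bool list \<Rightarrow> bool list \<Rightarrow> bool" where
  "cubic_lucky_verifier x u \<longleftrightarrow> (\<exists>n < length x. 0 < n \<and> is_graph_code n x \<and>
     pair_graph (decode_graph n x) \<and> regular 3 (decode_graph n x) \<and>
     lucky_labeling (decode_graph n x) (\<lambda>v. of_bool (nth_bit u v)))"

lemma polytime_pred_cubic_lucky_verifier:
  "polytime_pred 0 (\<lambda>z vs. cubic_lucky_verifier (fst z) (snd z))"
  unfolding cubic_lucky_verifier_def is_graph_code_def decode_graph_def pair_graph_matrix_graph_iff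
    regular_matrix_graph_iff lucky_labeling_matrix_graph_iff
  by (intro polytime_intros; simp)

lemma ex_short_certificate_iff:
  assumes "pair_graph (matrix_graph n A)" "n \<le> k"
  shows "(\<exists>b. lucky_labeling (matrix_graph n A) (\<lambda>v. of_bool (b v))) \<longleftrightarrow>
    (\<exists>u. length u \<le> k \<and> lucky_labeling (matrix_graph n A) (\<lambda>v. of_bool (nth_bit u v)))"
proof
  interpret pair_graph "matrix_graph n A" by fact
  assume "\<exists>b. lucky_labeling (matrix_graph n A) (\<lambda>v. of_bool (b v))"
  then obtain b where "lucky_labeling (matrix_graph n A) (\<lambda>v. of_bool (b v))" ..
  then have "lucky_labeling (matrix_graph n A) (\<lambda>v. of_bool (nth_bit (map b [0..<n]) v))"
    by (rule lucky_labeling_cong[THEN iffD1, rotated]) (simp add: nth_bit_def)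
  then show "\<exists>u. length u \<le> k \<and> lucky_labeling (matrix_graph n A) (\<lambda>v. of_bool (nth_bit u v))"
    using assms(2) by (intro exI[of _ "map b [0..<n]"]) simp
qed blast

lemma cubic_lucky_problem_iff_verifier:
  "x \<in> cubic_lucky_problem \<longleftrightarrow> (\<exists>u. length u \<le> poly [:0, 1:] (length x) \<and> cubic_lucky_verifier x u)"
proof -
  have "pair_graph (decode_graph n x) \<and> regular 3 (decode_graph n x) \<and>
      lucky_number (decode_graph n x) = 2 \<longleftrightarrow>
      (\<exists>u. length u \<le> length x \<and> 0 < n \<and>
        pair_graph (decode_graph n x) \<and> regular 3 (decode_graph n x) \<and>
        lucky_labeling (decode_graph n x) (\<lambda>v. of_bool (nth_bit u v)))"
    if "is_graph_code n x" for n
    using pair_graph.lucky_number_eq_2_iff[of "decode_graph n x" 3]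
      ex_short_certificate_iff[of n _ "length x"] that
    by (auto simp: decode_graph_def is_graph_code_def lessThan_empty_iff)
  moreover have "n < length x" if "is_graph_code n x" for n
    using that by (simp add: is_graph_code_def)
  moreover have "poly [:0, 1:] (length x) = length x" by simp
  ultimately show ?thesis
    unfolding in_graph_problem_iff cubic_lucky_verifier_def by (simp only:) blast
qed

lemma cubic_lucky_problem_in_NP: "cubic_lucky_problem \<in> NP"
  by (rule NP_I[OF polytime_pred_cubic_lucky_verifier cubic_lucky_problem_iff_verifier])

section \<open>Cells\<close>

text \<open>In the grid of cells a row stands for a variable and a column for a clause. A \<open>Literal\<close> is a
  variable occurring in a clause and a \<open>Wire\<close> one not occurring in it; \<open>Positive\<close> and \<open>Negative\<close>
  start a column with literals of that sign. The ports of a cell are its vertices 0 (left), 1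
  (right), 2 (upper) and 3 (lower).\<close>

datatype cell = Literal | Wire | Positive | Negative

fun core :: "cell \<Rightarrow> nat list list" where
  "core Literal = [[4,5], [4,5], [4,6], [6,7], [0,1,2], [7,0,1], [7,2,3], [3,5,6]]"
| "core Wire = [[4,5], [4,5], [6,7], [6,7], [5,0,1], [0,1,4], [7,2,3], [2,3,6]]"
| "core Positive = [[2,4], [2,4], [0,1], [5,6], [7,0,1], [6,7,3], [7,3,5], [4,5,6]]"
| "core Negative = [[3,4], [3,4], [5,6], [0,1], [7,0,1], [6,7,2], [7,2,5], [4,5,6]]"

text \<open>Every port has one neighbour outside the core, which carries the opposite bit and sees one
  more bit set than the port carries.\<close>

definition core_sum :: "cell \<Rightarrow> (nat \<Rightarrow> bool) \<Rightarrow> nat \<Rightarrow> nat" where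
  "core_sum k b i = (\<Sum>j \<leftarrow> core k ! i. of_bool (b j)) + (if i < 4 then of_bool (\<not> b i) else 0)"

definition core_ok :: "cell \<Rightarrow> (nat \<Rightarrow> bool) \<Rightarrow> bool" where
  "core_ok k b \<longleftrightarrow> (\<forall>i<8. \<forall>j \<in> set (core k ! i). core_sum k b i \<noteq> core_sum k b j) \<and>
     (\<forall>i<4. core_sum k b i \<noteq> Suc (of_bool (b i)))"

fun cell_rel :: "cell \<Rightarrow> bool \<Rightarrow> bool \<Rightarrow> bool \<Rightarrow> bool \<Rightarrow> bool" where
  "cell_rel Literal l r u d \<longleftrightarrow> l = r \<and> (u = l \<or> d \<noteq> l)"
| "cell_rel Wire l r u d \<longleftrightarrow> l = r \<and> u = d"
| "cell_rel Positive l r u d \<longleftrightarrow> l = r \<and> d = l \<and> u \<noteq> l"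
| "cell_rel Negative l r u d \<longleftrightarrow> l = r \<and> u = l \<and> d \<noteq> l"

lemma all_less_2: "(\<forall>i<2. P i) \<longleftrightarrow> P 0 \<and> P (1 :: nat)"
  by (simp add: numeral_eq_Suc All_less_Suc conj_ac)

lemma all_less_4: "(\<forall>i<4. P i) \<longleftrightarrow> P 0 \<and> P 1 \<and> P 2 \<and> P (3 :: nat)"
  by (simp add: numeral_eq_Suc All_less_Suc conj_ac)

lemma all_less_8:
  "(\<forall>i<8. P i) \<longleftrightarrow> P 0 \<and> P 1 \<and> P 2 \<and> P 3 \<and> P 4 \<and> P 5 \<and> P 6 \<and> P (7 :: nat)"
  by (simp add: numeral_eq_Suc All_less_Suc conj_ac)

lemma core_symmetric:
  "\<forall>i<8. distinct (core k ! i) \<and> length (core k ! i) = (if i < 4 then 2 else 3) \<and>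
    (\<forall>j \<in> set (core k ! i). j < 8 \<and> j \<noteq> i \<and> i \<in> set (core k ! j))"
  by (cases k) (simp_all add: all_less_8)

lemma core_less: "i < 8 \<Longrightarrow> j \<in> set (core k ! i) \<Longrightarrow> j < 8"
  using core_symmetric by blast

lemma core_ok_imp_cell_rel: "core_ok k b \<Longrightarrow> cell_rel k (b 0) (b 1) (b 2) (b 3)"
  by (cases k; simp add: core_ok_def core_sum_def all_less_4 all_less_8;
      cases "b 0"; cases "b (Suc 0)"; simp?; cases "b 4"; simp?; cases "b 5"; simp?;
      cases "b 2"; simp?; cases "b 3"; simp?; cases "b 6"; simp?; cases "b 7"; simp?)

fun core_bits :: "cell \<Rightarrow> bool \<Rightarrow> bool \<Rightarrow> bool \<Rightarrow> bool list" where
  "core_bits Literal l u d =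
     [l, l, u, d, (u = l \<and> d \<noteq> l) \<noteq> l, \<not> l, (u = l \<and> d = l) \<noteq> l, (u = d) \<noteq> l]"
| "core_bits Wire l u d = [l, l, u, d, False, True, False, True]"
| "core_bits k l u d = [l, l, u, d, \<not> l, l, \<not> l, l]"

lemma core_ok_core_bits: "cell_rel k l r u d \<Longrightarrow> core_ok k ((!) (core_bits k l u d))"
  by (cases k; cases l; cases u; cases d; simp add: core_ok_def core_sum_def all_less_4 all_less_8)

lemma cell_rel_iff:
  "cell_rel k l r u d \<longleftrightarrow> (\<exists>b. core_ok k b \<and> b 0 = l \<and> b 1 = r \<and> b 2 = u \<and> b 3 = d)"
proof
  assume rel: "cell_rel k l r u d"
  then have "l = r" by (cases k) auto
  moreover have "core_bits k l u d ! 0 = l" "core_bits k l u d ! 1 = l"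
    "core_bits k l u d ! 2 = u" "core_bits k l u d ! 3 = d"
    by (cases k; simp)+
  ultimately show "\<exists>b. core_ok k b \<and> b 0 = l \<and> b 1 = r \<and> b 2 = u \<and> b 3 = d"
    using core_ok_core_bits[OF rel] by (intro exI[of _ "(!) (core_bits k l u d)"]) simp
qed (auto dest: core_ok_imp_cell_rel)

lemma core_sum_cong:
  assumes "i < 8" "\<And>j. j < 8 \<Longrightarrow> b j = b' j" shows "core_sum k b i = core_sum k b' i"
proof -
  have "(\<Sum>j\<leftarrow>core k ! i. of_bool (b j)) = (\<Sum>j\<leftarrow>core k ! i. of_bool (b' j) :: nat)"
    using assms(2) core_less[OF assms(1)] by (intro arg_cong[where f = sum_list] map_cong) simp_all
  then show ?thesis using assms by (simp add: core_sum_def)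
qed

lemma core_ok_cong:
  assumes "core_ok k b" "\<And>j. j < 8 \<Longrightarrow> b j = b' j" shows "core_ok k b'"
  using assms core_less core_sum_cong[of _ b b' k] by (simp add: core_ok_def)

subsection \<open>Regular graphs given by neighbour lists\<close>

locale neighbour_lists =
  fixes n d :: nat and nbs :: "nat \<Rightarrow> nat list"
  assumes distinct_nbs: "v < n \<Longrightarrow> distinct (nbs v)"
    and length_nbs: "v < n \<Longrightarrow> length (nbs v) = d"
    and nbs_less: "v < n \<Longrightarrow> w \<in> set (nbs v) \<Longrightarrow> w < n"
    and nbs_sym: "v < n \<Longrightarrow> w \<in> set (nbs v) \<Longrightarrow> v \<in> set (nbs w)"
    and nbs_irrefl: "v < n \<Longrightarrow> v \<notin> set (nbs v)"
begin

abbreviation graph :: "nat pair_pre_digraph" where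
  "graph \<equiv> matrix_graph n (\<lambda>v w. w \<in> set (nbs v))"

lemma pair_graph_graph: "pair_graph graph"
  unfolding pair_graph_matrix_graph_iff using nbs_sym nbs_irrefl by blast

lemma regular_graph: "regular d graph"
proof -
  have "{..<n} \<inter> {w. w \<in> set (nbs v)} = set (nbs v)" if "v < n" for v
    using that nbs_less by auto
  then show ?thesis
    unfolding regular_matrix_graph_iff
    by (simp add: distinct_card distinct_nbs length_nbs cong: imp_cong)
qed

lemma lucky_labeling_graph_iff:
  "lucky_labeling graph l \<longleftrightarrow>
    (\<forall>v<n. \<forall>w \<in> set (nbs v). (\<Sum>u\<leftarrow>nbs v. l u) \<noteq> (\<Sum>u\<leftarrow>nbs w. l u))"
proof -
  have "u < n \<and> v \<in> set (nbs u) \<longleftrightarrow> u \<in> set (nbs v)" if "v < n" for u v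
    using that nbs_less nbs_sym by blast
  then have "{..<n} \<inter> {u. v \<in> set (nbs u)} = set (nbs v)" if "v < n" for v
    using that by auto
  then have sums: "(\<Sum>u<n. of_bool (v \<in> set (nbs u)) * l u) = (\<Sum>u\<leftarrow>nbs v. l u)" if "v < n" for v
    using that by (simp add: sum_list_distinct_conv_sum_set distinct_nbs)
  then show ?thesis
    unfolding lucky_labeling_matrix_graph_iff using nbs_less
    by (auto simp: sums simp del: sum_of_bool_mult_eq cong: imp_cong)
qed

end

subsection \<open>The graph of a grid of cells\<close>

text \<open>Cells are linked in two directions: horizontally, \<open>d = 0\<close>, and vertically, \<open>d = 1\<close>. Port
  \<open>2 * d + 1\<close> of cell \<open>c\<close> is joined to port \<open>2 * d\<close> of the next cell by a diamond with vertices
  \<open>8 + 4 * d\<close> to \<open>11 + 4 * d\<close>, the ends being the first and the last one. Vertex \<open>i\<close> of cell \<open>c\<close> is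
  encoded as \<open>16 * c + i\<close>.\<close>

definition inner_nbs :: "cell \<Rightarrow> nat list list" where
  "inner_nbs k = (core k)[1 := core k ! 1 @ [8], 3 := core k ! 3 @ [12]] @
     [[1, 9, 10], [8, 10, 11], [8, 9, 11], [9, 10],
      [3, 13, 14], [12, 14, 15], [12, 13, 15], [13, 14]]"

locale cell_graph =
  fixes C :: nat and nxt prv :: "nat \<Rightarrow> nat \<Rightarrow> nat" and kind :: "nat \<Rightarrow> cell"
  assumes nxt_less: "d < 2 \<Longrightarrow> c < C \<Longrightarrow> nxt d c < C"
    and prv_less: "d < 2 \<Longrightarrow> c < C \<Longrightarrow> prv d c < C"
    and prv_nxt: "d < 2 \<Longrightarrow> c < C \<Longrightarrow> prv d (nxt d c) = c"
    and nxt_prv: "d < 2 \<Longrightarrow> c < C \<Longrightarrow> nxt d (prv d c) = c"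
begin

definition outer_nbs :: "nat \<Rightarrow> nat \<Rightarrow> nat list" where
  "outer_nbs c i = (if i = 0 then [16 * prv 0 c + 11] else if i = 2 then [16 * prv 1 c + 15]
     else if i = 11 then [16 * nxt 0 c] else if i = 15 then [16 * nxt 1 c + 2] else [])"

definition nbs :: "nat \<Rightarrow> nat list" where
  "nbs v = map ((+) (16 * (v div 16))) (inner_nbs (kind (v div 16)) ! (v mod 16)) @
     outer_nbs (v div 16) (v mod 16)"

lemma nbs_vertex:
  "i < 16 \<Longrightarrow> nbs (16 * c + i) = map ((+) (16 * c)) (inner_nbs (kind c) ! i) @ outer_nbs c i"
  by (simp add: nbs_def)

lemma vertex_cases:
  assumes "v < 16 * C" obtains c i where "v = 16 * c + i" "c < C" "i < 16"
  using assms that[of "v div 16" "v mod 16"] by (simp add: less_mult_imp_div_less mult.commute)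

end

lemma all_less_4_iff_ports: "(\<forall>i<4. P i) \<longleftrightarrow> (\<forall>d<2. P (2 * d + 1) \<and> P (2 * d))" for P :: "nat \<Rightarrow> bool"
  by (auto simp: numeral_eq_Suc All_less_Suc)

lemma vertex_eq_iff:
  "i < 16 \<Longrightarrow> j < 16 \<Longrightarrow> 16 * c + i = 16 * c' + j \<longleftrightarrow> c = c' \<and> i = j" for i j c c' :: nat
  by (cases c c' rule: linorder_cases) auto

lemma all_less_16:
  "(\<forall>i<16. P i) \<longleftrightarrow> P 0 \<and> P 1 \<and> P 2 \<and> P 3 \<and> P 4 \<and> P 5 \<and> P 6 \<and> P 7 \<and>
    P 8 \<and> P 9 \<and> P 10 \<and> P 11 \<and> P 12 \<and> P 13 \<and> P 14 \<and> P (15 :: nat)"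
  by (simp add: numeral_eq_Suc All_less_Suc conj_ac)

lemma inner_nbs_symmetric:
  "\<forall>i<16. distinct (inner_nbs k ! i) \<and>
    length (inner_nbs k ! i) = (if i \<in> {0, 2, 11, 15} then 2 else 3) \<and>
    (\<forall>j \<in> set (inner_nbs k ! i). j < 16 \<and> j \<noteq> i \<and> i \<in> set (inner_nbs k ! j))"
  by (cases k) (simp_all add: all_less_16 inner_nbs_def)

lemma outer_port_not_inner:
  "\<forall>d<2. 11 + 4 * d \<notin> set (inner_nbs k ! (2 * d)) \<and> 2 * d \<notin> set (inner_nbs k ! (11 + 4 * d))"
  by (cases k) (simp_all add: all_less_2 inner_nbs_def)

context cell_graph
begin

lemma outer_nbs_cases:
  assumes "w \<in> set (outer_nbs c i)"
  obtains (to_prv) d where "d < 2" "i = 2 * d" "w = 16 * prv d c + (11 + 4 * d)"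
    | (to_nxt) d where "d < 2" "i = 11 + 4 * d" "w = 16 * nxt d c + 2 * d"
  using assms that(1)[of 0] that(1)[of 1] that(2)[of 0] that(2)[of 1]
  by (auto simp: outer_nbs_def split: if_splits)

lemma outer_nbsI:
  assumes "d < 2"
  shows "16 * prv d c + (11 + 4 * d) \<in> set (outer_nbs c (2 * d))"
    "16 * nxt d c + 2 * d \<in> set (outer_nbs c (11 + 4 * d))"
  using assms by (auto simp: outer_nbs_def less_2_cases_iff)

lemma nbs_cases:
  assumes "w \<in> set (nbs (16 * c + i))" "i < 16"
  obtains (inner) j where "w = 16 * c + j" "j \<in> set (inner_nbs (kind c) ! i)"
    | (outer) "w \<in> set (outer_nbs c i)"
  using assms by (auto simp: nbs_vertex)

lemma distinct_nbs_vertex: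
  assumes i: "i < 16" shows "distinct (nbs (16 * c + i))" "length (nbs (16 * c + i)) = 3"
proof -
  let ?inner = "inner_nbs (kind c) ! i"
  have inner: "distinct ?inner" "length ?inner = (if i \<in> {0, 2, 11, 15} then 2 else 3)"
    and less: "j \<in> set ?inner \<Longrightarrow> j < 16" for j
    using inner_nbs_symmetric i by blast+
  have "16 * c + j \<notin> set (outer_nbs c i)" if "j \<in> set ?inner" for j
  proof
    assume "16 * c + j \<in> set (outer_nbs c i)"
    then show False
    proof (cases rule: outer_nbs_cases)
      case (to_prv d)
      then have "j = 11 + 4 * d" using less[OF that] by (simp add: vertex_eq_iff)
      then show False using that outer_port_not_inner to_prv(1,2) by blast
    next
      case (to_nxt d)
      then have "j = 2 * d" using less[OF that] by (simp add: vertex_eq_iff)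
      then show False using that outer_port_not_inner to_nxt(1,2) by blast
    qed
  qed
  moreover have "distinct (outer_nbs c i)"
    "length (outer_nbs c i) = (if i \<in> {0, 2, 11, 15} then 1 else 0)"
    by (simp_all add: outer_nbs_def)
  ultimately show "distinct (nbs (16 * c + i))" "length (nbs (16 * c + i)) = 3"
    using inner i by (auto simp: nbs_vertex distinct_map)
qed

lemma nbs_vertex_symmetric:
  assumes c: "c < C" and i: "i < 16" and w: "w \<in> set (nbs (16 * c + i))"
  shows "w < 16 * C" "16 * c + i \<in> set (nbs w)" "w \<noteq> 16 * c + i"
proof -
  from w i have "w < 16 * C \<and> 16 * c + i \<in> set (nbs w) \<and> w \<noteq> 16 * c + i"
  proof (cases rule: nbs_cases)
    case (inner j)
    then have "j < 16" "j \<noteq> i" "i \<in> set (inner_nbs (kind c) ! j)"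
      using inner_nbs_symmetric i by blast+
    then show ?thesis using inner(1) c by (simp add: nbs_vertex)
  next
    case outer
    then show ?thesis
    proof (cases rule: outer_nbs_cases)
      case (to_prv d)
      have "16 * c + i \<in> set (nbs w)"
        using outer_nbsI(2)[of d "prv d c"] to_prv c by (simp add: nbs_vertex nxt_prv)
      then show ?thesis using to_prv c prv_less[of d c] by (simp add: vertex_eq_iff)
    next
      case (to_nxt d)
      have "16 * c + i \<in> set (nbs w)"
        using outer_nbsI(1)[of d "nxt d c"] to_nxt c by (simp add: nbs_vertex prv_nxt)
      then show ?thesis using to_nxt c nxt_less[of d c] by (simp add: vertex_eq_iff)
    qed
  qed
  then show "w < 16 * C" "16 * c + i \<in> set (nbs w)" "w \<noteq> 16 * c + i" by blast+
qed

end

sublocale cell_graph \<subseteq> neighbour_lists "16 * C" 3 nbs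
proof
  fix v assume "v < 16 * C"
  then obtain c i where v: "v = 16 * c + i" "c < C" "i < 16" by (rule vertex_cases)
  show "distinct (nbs v)" "length (nbs v) = 3"
    using distinct_nbs_vertex[OF v(3)] by (simp_all add: v(1))
  show "w < 16 * C" "v \<in> set (nbs w)" if "w \<in> set (nbs v)" for w
    using nbs_vertex_symmetric[OF v(2,3)] that by (simp_all add: v(1))
  show "v \<notin> set (nbs v)" using nbs_vertex_symmetric(3)[OF v(2,3)] by (auto simp: v(1))
qed

subsection \<open>Lucky labelings of a grid of cells\<close>

text \<open>A diamond consists of two triangles sharing an edge. With ends \<open>a\<close>, \<open>e\<close>, inner vertices \<open>m\<close>,
  \<open>n\<close> and outer neighbours \<open>p\<close>, \<open>q\<close> of the ends, it transports the bit \<open>p\<close> to \<open>q\<close>.\<close>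

definition diamond_ok :: "nat \<Rightarrow> nat \<Rightarrow> nat \<Rightarrow> nat \<Rightarrow> bool" where
  "diamond_ok sa sm sn se \<longleftrightarrow> sa \<noteq> sm \<and> sa \<noteq> sn \<and> sm \<noteq> sn \<and> sm \<noteq> se \<and> sn \<noteq> se"

lemma diamond_ok_iff:
  "diamond_ok (of_bool p + of_bool m + of_bool n) (of_bool a + of_bool n + of_bool e)
     (of_bool a + of_bool m + of_bool e) (of_bool m + of_bool n + of_bool q) \<longleftrightarrow>
   m \<noteq> n \<and> a = (\<not> p) \<and> e = (\<not> p) \<and> q = p"
  unfolding diamond_ok_def by (cases p; cases a; cases m; cases n; cases e; cases q; simp)

context cell_graph
begin

lemma inner_nbs_core:
  assumes "i < 8"
  shows "inner_nbs k ! i = core k ! i @ (if i = 1 then [8] else if i = 3 then [12] else [])"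
proof -
  have "length (core k) = 8" by (cases k) simp_all
  then show ?thesis using assms by (simp add: inner_nbs_def nth_append nth_list_update)
qed

lemma inner_nbs_diamond:
  "\<forall>d<2. inner_nbs k ! (8 + 4 * d) = [2 * d + 1, 9 + 4 * d, 10 + 4 * d] \<and>
    inner_nbs k ! (9 + 4 * d) = [8 + 4 * d, 10 + 4 * d, 11 + 4 * d] \<and>
    inner_nbs k ! (10 + 4 * d) = [8 + 4 * d, 9 + 4 * d, 11 + 4 * d] \<and>
    inner_nbs k ! (11 + 4 * d) = [9 + 4 * d, 10 + 4 * d]"
  by (cases k) (simp_all add: all_less_2 inner_nbs_def)

text \<open>Every edge of the graph lies in a core or in a diamond or joins a port to an end of a
  diamond.\<close>

definition cell_edges_ok :: "(nat \<Rightarrow> nat) \<Rightarrow> nat \<Rightarrow> bool" where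
  "cell_edges_ok s c \<longleftrightarrow>
     (\<forall>i<8. \<forall>j \<in> set (core (kind c) ! i). s (16 * c + i) \<noteq> s (16 * c + j)) \<and>
     (\<forall>d<2. diamond_ok (s (16 * c + (8 + 4 * d))) (s (16 * c + (9 + 4 * d)))
          (s (16 * c + (10 + 4 * d))) (s (16 * c + (11 + 4 * d))) \<and>
        s (16 * c + (2 * d + 1)) \<noteq> s (16 * c + (8 + 4 * d)) \<and>
        s (16 * c + 2 * d) \<noteq> s (16 * prv d c + (11 + 4 * d)))"

lemma cell_edges_okI:
  assumes c: "c < C" and edges: "\<And>i w. i < 16 \<Longrightarrow> w \<in> set (nbs (16 * c + i)) \<Longrightarrow> s (16 * c + i) \<noteq> s w"
  shows "cell_edges_ok s c"
proof -
  have inner: "s (16 * c + i) \<noteq> s (16 * c + j)" if "i < 16" "j \<in> set (inner_nbs (kind c) ! i)"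
    for i j
    using edges[of i "16 * c + j"] that by (simp add: nbs_vertex)
  have "s (16 * c + i) \<noteq> s (16 * c + j)" if "i < 8" "j \<in> set (core (kind c) ! i)" for i j
    using inner[of i j] that by (simp add: inner_nbs_core)
  moreover have "diamond_ok (s (16 * c + (8 + 4 * d))) (s (16 * c + (9 + 4 * d)))
      (s (16 * c + (10 + 4 * d))) (s (16 * c + (11 + 4 * d)))"
    "s (16 * c + (2 * d + 1)) \<noteq> s (16 * c + (8 + 4 * d))" if "d < 2" for d
  proof -
    note diamond = inner_nbs_diamond[rule_format, OF that, of "kind c"]
    show "diamond_ok (s (16 * c + (8 + 4 * d))) (s (16 * c + (9 + 4 * d)))
        (s (16 * c + (10 + 4 * d))) (s (16 * c + (11 + 4 * d)))"
      unfolding diamond_ok_def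
      using that diamond inner[of "8 + 4 * d"] inner[of "9 + 4 * d"] inner[of "10 + 4 * d"] by simp
    show "s (16 * c + (2 * d + 1)) \<noteq> s (16 * c + (8 + 4 * d))"
      using that diamond inner[of "8 + 4 * d"] by fastforce
  qed
  moreover have "s (16 * c + 2 * d) \<noteq> s (16 * prv d c + (11 + 4 * d))" if "d < 2" for d
    using that by (intro edges) (simp_all add: nbs_vertex outer_nbsI)
  ultimately show ?thesis by (simp add: cell_edges_ok_def)
qed

lemma cell_edges_okD:
  assumes "cell_edges_ok s c"
  shows "i < 8 \<Longrightarrow> j \<in> set (core (kind c) ! i) \<Longrightarrow> s (16 * c + i) \<noteq> s (16 * c + j)"
    "d < 2 \<Longrightarrow> diamond_ok (s (16 * c + (8 + 4 * d))) (s (16 * c + (9 + 4 * d)))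
       (s (16 * c + (10 + 4 * d))) (s (16 * c + (11 + 4 * d)))"
    "d < 2 \<Longrightarrow> s (16 * c + (2 * d + 1)) \<noteq> s (16 * c + (8 + 4 * d))"
    "d < 2 \<Longrightarrow> s (16 * c + 2 * d) \<noteq> s (16 * prv d c + (11 + 4 * d))"
  using assms unfolding cell_edges_ok_def by blast+

lemma cell_edges_ok_inner:
  assumes ok: "cell_edges_ok s c" and i: "i < 16" and j: "j \<in> set (inner_nbs (kind c) ! i)"
  shows "s (16 * c + i) \<noteq> s (16 * c + j)"
proof (cases "i < 8")
  case True
  then consider (core) "j \<in> set (core (kind c) ! i)" | (right) "i = 1" "j = 8"
    | (lower) "i = 3" "j = 12"
    using j by (auto simp: inner_nbs_core split: if_splits)
  then show ?thesis
  proof cases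
    case core
    then show ?thesis using cell_edges_okD(1)[OF ok True] by blast
  next
    case right
    then show ?thesis using cell_edges_okD(3)[OF ok, of 0] by simp
  next
    case lower
    then show ?thesis using cell_edges_okD(3)[OF ok, of 1] by simp
  qed
next
  case False
  define d where "d = (i - 8) div 4"
  have d: "d < 2" using i by (simp add: d_def less_mult_imp_div_less)
  have "i = 8 + 4 * d + (i - 8) mod 4" "(i - 8) mod 4 < 4"
    using False div_mult_mod_eq[of "i - 8" 4] by (simp_all add: d_def)
  then consider "i = 8 + 4 * d" | "i = 9 + 4 * d" | "i = 10 + 4 * d" | "i = 11 + 4 * d" by linarith
  then show ?thesis
    using cell_edges_okD(2)[OF ok d] cell_edges_okD(3)[OF ok d] j
      inner_nbs_diamond[rule_format, OF d, of "kind c"]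
    by cases (auto simp: diamond_ok_def)
qed

lemma cell_edges_ok_nbs:
  assumes ok: "\<And>c. c < C \<Longrightarrow> cell_edges_ok s c"
    and c: "c < C" and i: "i < 16" and w: "w \<in> set (nbs (16 * c + i))"
  shows "s (16 * c + i) \<noteq> s w"
  using w i
proof (cases rule: nbs_cases)
  case (inner j)
  then show ?thesis using cell_edges_ok_inner[OF ok[OF c] i] by simp
next
  case outer
  then show ?thesis
  proof (cases rule: outer_nbs_cases)
    case (to_prv d)
    then show ?thesis using cell_edges_okD(4)[OF ok[OF c]] by simp
  next
    case (to_nxt d)
    then have "cell_edges_ok s (nxt d c)" using ok nxt_less c by blast
    then show ?thesis using cell_edges_okD(4)[of s "nxt d c" d] to_nxt c by (simp add: prv_nxt)
  qed
qed

lemma all_edges_iff: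
  "(\<forall>v<16 * C. \<forall>w \<in> set (nbs v). s v \<noteq> s w) \<longleftrightarrow> (\<forall>c<C. cell_edges_ok s c)"
proof
  assume edges: "\<forall>v<16 * C. \<forall>w \<in> set (nbs v). s v \<noteq> s w"
  show "\<forall>c<C. cell_edges_ok s c"
  proof (intro allI impI cell_edges_okI)
    fix c i w assume "c < C" "i < 16" "w \<in> set (nbs (16 * c + i))"
    then show "s (16 * c + i) \<noteq> s w" using edges by simp
  qed
next
  assume ok: "\<forall>c<C. cell_edges_ok s c"
  show "\<forall>v<16 * C. \<forall>w \<in> set (nbs v). s v \<noteq> s w"
  proof (intro allI impI ballI)
    fix v w assume "v < 16 * C" and w: "w \<in> set (nbs v)"
    then obtain c i where "v = 16 * c + i" "c < C" "i < 16" using vertex_cases by blast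
    then show "s v \<noteq> s w" using cell_edges_ok_nbs[of s c i w] ok w by simp
  qed
qed

definition nbs_sum :: "(nat \<Rightarrow> bool) \<Rightarrow> nat \<Rightarrow> nat" where
  "nbs_sum b v = (\<Sum>w\<leftarrow>nbs v. of_bool (b w))"

lemma nbs_sum_vertex:
  "i < 16 \<Longrightarrow> nbs_sum b (16 * c + i) =
    (\<Sum>j\<leftarrow>inner_nbs (kind c) ! i. of_bool (b (16 * c + j))) + (\<Sum>w\<leftarrow>outer_nbs c i. of_bool (b w))"
  by (simp add: nbs_sum_def nbs_vertex comp_def)

definition transports :: "(nat \<Rightarrow> bool) \<Rightarrow> nat \<Rightarrow> nat \<Rightarrow> bool" where
  "transports b c d \<longleftrightarrow> b (16 * c + (9 + 4 * d)) \<noteq> b (16 * c + (10 + 4 * d)) \<and>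
     b (16 * c + (8 + 4 * d)) = (\<not> b (16 * c + (2 * d + 1))) \<and>
     b (16 * c + (11 + 4 * d)) = (\<not> b (16 * c + (2 * d + 1))) \<and>
     b (16 * nxt d c + 2 * d) = b (16 * c + (2 * d + 1))"

lemma nbs_sum_diamond:
  assumes "d < 2"
  shows "nbs_sum b (16 * c + (8 + 4 * d)) = of_bool (b (16 * c + (2 * d + 1))) +
      of_bool (b (16 * c + (9 + 4 * d))) + of_bool (b (16 * c + (10 + 4 * d)))"
    "nbs_sum b (16 * c + (9 + 4 * d)) = of_bool (b (16 * c + (8 + 4 * d))) +
      of_bool (b (16 * c + (10 + 4 * d))) + of_bool (b (16 * c + (11 + 4 * d)))"
    "nbs_sum b (16 * c + (10 + 4 * d)) = of_bool (b (16 * c + (8 + 4 * d))) +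
      of_bool (b (16 * c + (9 + 4 * d))) + of_bool (b (16 * c + (11 + 4 * d)))"
    "nbs_sum b (16 * c + (11 + 4 * d)) = of_bool (b (16 * c + (9 + 4 * d))) +
      of_bool (b (16 * c + (10 + 4 * d))) + of_bool (b (16 * nxt d c + 2 * d))"
proof -
  have outer: "outer_nbs c (8 + 4 * d) = []" "outer_nbs c (9 + 4 * d) = []"
    "outer_nbs c (10 + 4 * d) = []"
    "outer_nbs c (11 + 4 * d) = [16 * nxt d c + 2 * d]"
    using assms by (auto simp: outer_nbs_def less_2_cases_iff)
  have less: "8 + 4 * d < 16" "9 + 4 * d < 16" "10 + 4 * d < 16" "11 + 4 * d < 16"
    using assms by simp_all
  note inner = inner_nbs_diamond[rule_format, OF assms, of "kind c"]
  show "nbs_sum b (16 * c + (8 + 4 * d)) = of_bool (b (16 * c + (2 * d + 1))) +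
      of_bool (b (16 * c + (9 + 4 * d))) + of_bool (b (16 * c + (10 + 4 * d)))"
    "nbs_sum b (16 * c + (9 + 4 * d)) = of_bool (b (16 * c + (8 + 4 * d))) +
      of_bool (b (16 * c + (10 + 4 * d))) + of_bool (b (16 * c + (11 + 4 * d)))"
    "nbs_sum b (16 * c + (10 + 4 * d)) = of_bool (b (16 * c + (8 + 4 * d))) +
      of_bool (b (16 * c + (9 + 4 * d))) + of_bool (b (16 * c + (11 + 4 * d)))"
    "nbs_sum b (16 * c + (11 + 4 * d)) = of_bool (b (16 * c + (9 + 4 * d))) +
      of_bool (b (16 * c + (10 + 4 * d))) + of_bool (b (16 * nxt d c + 2 * d))"
    unfolding nbs_sum_vertex[OF less(1)] nbs_sum_vertex[OF less(2)] nbs_sum_vertex[OF less(3)]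
      nbs_sum_vertex[OF less(4)] outer by (simp_all add: inner)
qed

lemma diamond_ok_nbs_sum_iff:
  assumes "d < 2"
  shows "diamond_ok (nbs_sum b (16 * c + (8 + 4 * d))) (nbs_sum b (16 * c + (9 + 4 * d)))
      (nbs_sum b (16 * c + (10 + 4 * d))) (nbs_sum b (16 * c + (11 + 4 * d))) \<longleftrightarrow> transports b c d"
  by (simp only: nbs_sum_diamond[OF assms] diamond_ok_iff transports_def)

lemma nbs_sum_diamond_ends:
  assumes "d < 2" "transports b c d"
  shows "nbs_sum b (16 * c + (8 + 4 * d)) = Suc (of_bool (b (16 * c + (2 * d + 1))))"
    "nbs_sum b (16 * c + (11 + 4 * d)) = Suc (of_bool (b (16 * nxt d c + 2 * d)))"
  using assms(2) unfolding nbs_sum_diamond[OF assms(1)] transports_def by (auto simp: of_bool_def)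

lemma nbs_sum_core:
  assumes transports: "\<And>c d. c < C \<Longrightarrow> d < 2 \<Longrightarrow> transports b c d" and c: "c < C" and i: "i < 8"
  shows "nbs_sum b (16 * c + i) = core_sum (kind c) (\<lambda>i. b (16 * c + i)) i"
proof -
  have "b (16 * prv d c + (11 + 4 * d)) = (\<not> b (16 * c + 2 * d))"
    "b (16 * c + (8 + 4 * d)) = (\<not> b (16 * c + (2 * d + 1)))" if "d < 2" for d
    using transports[of "prv d c" d] transports[of c d] c that
    by (simp_all add: transports_def prv_less nxt_prv)
  note horizontal = this[of 0] and vertical = this[of 1]
  let ?inside = "if i = 1 then of_bool (b (16 * c + 8))
      else if i = 3 then of_bool (b (16 * c + 12)) else 0"
  consider "i = 0" | "i = 1" | "i = 2" | "i = 3" | "4 \<le> i" by linarith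
  then have "?inside + (\<Sum>w\<leftarrow>outer_nbs c i. of_bool (b w)) =
      (if i < 4 then of_bool (\<not> b (16 * c + i)) else 0 :: nat)"
    using i horizontal vertical by cases (simp_all add: outer_nbs_def)
  moreover have "nbs_sum b (16 * c + i) = (\<Sum>j\<leftarrow>core (kind c) ! i. of_bool (b (16 * c + j))) +
      ?inside + (\<Sum>w\<leftarrow>outer_nbs c i. of_bool (b w))"
    using i by (simp add: nbs_sum_vertex inner_nbs_core)
  ultimately show ?thesis by (simp only: core_sum_def add.assoc)
qed

lemma cell_edges_ok_nbs_sum_iff:
  assumes transports: "\<And>c d. c < C \<Longrightarrow> d < 2 \<Longrightarrow> transports b c d" and c: "c < C"
  shows "cell_edges_ok (nbs_sum b) c \<longleftrightarrow> core_ok (kind c) (\<lambda>i. b (16 * c + i))"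
proof -
  let ?b = "\<lambda>i. b (16 * c + i)"
  have core: "nbs_sum b (16 * c + i) = core_sum (kind c) ?b i" if "i < 8" for i
    using transports c that by (rule nbs_sum_core)
  have ports: "nbs_sum b (16 * c + (2 * d + 1)) = core_sum (kind c) ?b (2 * d + 1)"
    "nbs_sum b (16 * c + 2 * d) = core_sum (kind c) ?b (2 * d)" if "d < 2" for d
    using that by (intro core; simp)+
  have ends: "nbs_sum b (16 * c + (8 + 4 * d)) = Suc (of_bool (?b (2 * d + 1)))"
    "nbs_sum b (16 * prv d c + (11 + 4 * d)) = Suc (of_bool (?b (2 * d)))" if "d < 2" for d
    using nbs_sum_diamond_ends(1)[OF that transports[OF c that]]
      nbs_sum_diamond_ends(2)[OF that transports[of "prv d c" d]] c that
    by (simp_all only: prv_less nxt_prv)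
  have "(\<forall>i<8. \<forall>j \<in> set (core (kind c) ! i). nbs_sum b (16 * c + i) \<noteq> nbs_sum b (16 * c + j)) \<longleftrightarrow>
      (\<forall>i<8. \<forall>j \<in> set (core (kind c) ! i). core_sum (kind c) ?b i \<noteq> core_sum (kind c) ?b j)"
    using core core_less by (intro all_cong ball_cong refl) metis
  moreover have "(\<forall>d<2. nbs_sum b (16 * c + (2 * d + 1)) \<noteq> nbs_sum b (16 * c + (8 + 4 * d)) \<and>
        nbs_sum b (16 * c + 2 * d) \<noteq> nbs_sum b (16 * prv d c + (11 + 4 * d))) \<longleftrightarrow>
      (\<forall>d<2. core_sum (kind c) ?b (2 * d + 1) \<noteq> Suc (of_bool (?b (2 * d + 1))) \<and>
        core_sum (kind c) ?b (2 * d) \<noteq> Suc (of_bool (?b (2 * d))))"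
    by (intro all_cong) (simp only: ports ends)
  moreover have "(\<forall>i<4. core_sum (kind c) ?b i \<noteq> Suc (of_bool (?b i))) \<longleftrightarrow>
      (\<forall>d<2. core_sum (kind c) ?b (2 * d + 1) \<noteq> Suc (of_bool (?b (2 * d + 1))) \<and>
        core_sum (kind c) ?b (2 * d) \<noteq> Suc (of_bool (?b (2 * d))))"
    by (rule all_less_4_iff_ports)
  moreover have "\<forall>d<2. diamond_ok (nbs_sum b (16 * c + (8 + 4 * d)))
      (nbs_sum b (16 * c + (9 + 4 * d)))
      (nbs_sum b (16 * c + (10 + 4 * d))) (nbs_sum b (16 * c + (11 + 4 * d)))"
    using transports[OF c] diamond_ok_nbs_sum_iff by blast
  ultimately show ?thesis unfolding cell_edges_ok_def core_ok_def by blast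
qed

lemma lucky_labeling_of_bool_iff:
  "lucky_labeling graph (\<lambda>v. of_bool (b v)) \<longleftrightarrow>
   (\<forall>c<C. core_ok (kind c) (\<lambda>i. b (16 * c + i)) \<and> (\<forall>d<2. transports b c d))"
proof -
  have "transports b c d" if "cell_edges_ok (nbs_sum b) c" "d < 2" for c d
    using cell_edges_okD(2)[OF that] diamond_ok_nbs_sum_iff[OF that(2)] by blast
  then have "(\<forall>c<C. cell_edges_ok (nbs_sum b) c) \<longleftrightarrow>
      (\<forall>c<C. core_ok (kind c) (\<lambda>i. b (16 * c + i)) \<and> (\<forall>d<2. transports b c d))"
    using cell_edges_ok_nbs_sum_iff by blast
  then show ?thesis
    unfolding lucky_labeling_graph_iff nbs_sum_def[symmetric] all_edges_iff .
qed

definition port_bits_ok :: "(nat \<Rightarrow> nat \<Rightarrow> bool) \<Rightarrow> bool" where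
  "port_bits_ok p \<longleftrightarrow> (\<forall>c<C. cell_rel (kind c) (p c 0) (p c 1) (p c 2) (p c 3) \<and>
     (\<forall>d<2. p (nxt d c) (2 * d) = p c (2 * d + 1)))"

lemma lucky_labeling_of_port_bits:
  assumes "port_bits_ok p"
  shows "\<exists>b. lucky_labeling graph (\<lambda>v. of_bool (b v))"
proof -
  define w where "w c = (SOME b. core_ok (kind c) b \<and> (\<forall>i<4. b i = p c i))" for c
  have "\<exists>b. core_ok (kind c) b \<and> (\<forall>i<4. b i = p c i)" if "c < C" for c
  proof -
    have "cell_rel (kind c) (p c 0) (p c 1) (p c 2) (p c 3)" using assms that
      by (simp add: port_bits_ok_def)
    then show ?thesis by (simp add: cell_rel_iff all_less_4)
  qed
  then have w: "core_ok (kind c) (w c)" "\<forall>i<4. w c i = p c i" if "c < C" for c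
    using someI_ex[of "\<lambda>b. core_ok (kind c) b \<and> (\<forall>i<4. b i = p c i)"] that by (simp_all add: w_def)
  define bits where "bits c i = (if i < 8 then w c i else if i \<in> {9, 10, 13, 14} then i \<in> {9, 13}
    else if i < 12 then \<not> p c 1 else \<not> p c 3)" for c i
  define b where "b v = bits (v div 16) (v mod 16)" for v
  have b: "b (16 * c + i) = bits c i" if "i < 16" for c i
    using that by (simp add: b_def)
  have "core_ok (kind c) (\<lambda>i. b (16 * c + i))" if "c < C" for c
    using w(1)[OF that] by (rule core_ok_cong) (simp add: b bits_def)
  moreover have "transports b c d" if c: "c < C" and d: "d < 2" for c d
  proof -
    have "bits c (8 + 4 * d) = (\<not> p c (2 * d + 1))" "bits c (9 + 4 * d)" "\<not> bits c (10 + 4 * d)"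
      "bits c (11 + 4 * d) = (\<not> p c (2 * d + 1))"
      using d by (auto simp: bits_def less_2_cases_iff)
    moreover have "b (16 * c' + i) = p c' i" if "c' < C" "i < 4" for c' i
      using w(2)[OF that(1)] that(2) by (simp add: b bits_def)
    note this[of c "2 * d + 1"] this[of "nxt d c" "2 * d"]
    moreover have "p (nxt d c) (2 * d) = p c (2 * d + 1)" "nxt d c < C"
      using assms c d nxt_less by (simp_all add: port_bits_ok_def)
    ultimately show ?thesis using c d by (simp add: transports_def b)
  qed
  ultimately show ?thesis using lucky_labeling_of_bool_iff by blast
qed

lemma port_bits_of_lucky_labeling:
  assumes "lucky_labeling graph (\<lambda>v. of_bool (b v))"
  shows "port_bits_ok (\<lambda>c i. b (16 * c + i))"
  using assms core_ok_imp_cell_rel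
  unfolding lucky_labeling_of_bool_iff port_bits_ok_def transports_def
  by fastforce

lemma lucky_number_graph_iff:
  assumes "0 < C"
  shows "lucky_number graph = 2 \<longleftrightarrow> (\<exists>p. port_bits_ok p)"
proof -
  have "pverts graph \<noteq> {}" using assms by (simp add: lessThan_empty_iff)
  then show ?thesis
    using pair_graph.lucky_number_eq_2_iff[OF pair_graph_graph regular_graph]
      lucky_labeling_of_port_bits port_bits_of_lucky_labeling by auto
qed

end

subsection \<open>Grids on a torus\<close>

definition torus_nxt :: "nat \<Rightarrow> nat \<Rightarrow> nat \<Rightarrow> nat \<Rightarrow> nat" where
  "torus_nxt R W d c = (if d = 0 then c div W * W + (c mod W + 1) mod W
     else (c div W + 1) mod R * W + c mod W)"

definition torus_prv :: "nat \<Rightarrow> nat \<Rightarrow> nat \<Rightarrow> nat \<Rightarrow> nat" where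
  "torus_prv R W d c = (if d = 0 then c div W * W + (c mod W + (W - 1)) mod W
     else (c div W + (R - 1)) mod R * W + c mod W)"

lemma mod_succ_pred:
  assumes "j < n"
  shows "((j + 1) mod n + (n - 1)) mod n = j" "((j + (n - 1)) mod n + 1) mod n = (j :: nat)"
proof -
  have "((j + 1) mod n + (n - 1)) mod n = (j + 1 + (n - 1)) mod n" by (rule mod_add_left_eq)
  then show "((j + 1) mod n + (n - 1)) mod n = j" using assms by simp
  have "((j + (n - 1)) mod n + 1) mod n = (j + (n - 1) + 1) mod n" by (rule mod_add_left_eq)
  then show "((j + (n - 1)) mod n + 1) mod n = j" using assms by simp
qed

lemma torus_nxt_index:
  assumes "j < W"
  shows "torus_nxt R W 0 (a * W + j) = a * W + (j + 1) mod W"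
    "torus_nxt R W 1 (a * W + j) = (a + 1) mod R * W + j"
  using assms by (simp_all only: torus_nxt_def div_mult_add_less mod_mult_add_less) simp_all

lemma torus_prv_index:
  assumes "j < W"
  shows "torus_prv R W 0 (a * W + j) = a * W + (j + (W - 1)) mod W"
    "torus_prv R W 1 (a * W + j) = (a + (R - 1)) mod R * W + j"
  using assms by (simp_all only: torus_prv_def div_mult_add_less mod_mult_add_less) simp_all

lemma grid_cases:
  fixes c R W :: nat
  assumes "c < R * W" obtains a j where "c = a * W + j" "a < R" "j < W"
proof
  show "c = c div W * W + c mod W" by simp
  show "c div W < R" using assms by (simp add: less_mult_imp_div_less)
  have "0 < W" using assms by (cases W) auto
  then show "c mod W < W" by simp
qed

lemma all_less_mult_iff: "(\<forall>c < R * W. P c) \<longleftrightarrow> (\<forall>a<R. \<forall>j<W. P (a * W + j))" for R W :: nat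
  by (auto intro: mult_add_less_mult elim: grid_cases)

lemma cell_graph_torus: "cell_graph (R * W) (torus_nxt R W) (torus_prv R W)"
proof
  fix d c assume d: "d < (2 :: nat)" and "c < R * W"
  then obtain a j where c: "c = a * W + j" "a < R" "j < W" by (auto elim: grid_cases)
  have mods: "(j + 1) mod W < W" "(j + (W - 1)) mod W < W" "(a + 1) mod R < R"
    "(a + (R - 1)) mod R < R"
    using c by auto
  have "d = 0 \<or> d = 1" using d by linarith
  then have "torus_nxt R W d c < R * W \<and> torus_prv R W d c < R * W \<and>
      torus_prv R W d (torus_nxt R W d c) = c \<and> torus_nxt R W d (torus_prv R W d c) = c"
    by (elim disjE) (simp_all only: c torus_nxt_index[OF c(3)] torus_prv_index[OF c(3)]
        torus_nxt_index[OF mods(2)] torus_prv_index[OF mods(1)] mult_add_less_mult mods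
        mod_succ_pred[OF c(2)] mod_succ_pred[OF c(3)])
  then show "torus_nxt R W d c < R * W" "torus_prv R W d c < R * W"
    "torus_prv R W d (torus_nxt R W d c) = c" "torus_nxt R W d (torus_prv R W d c) = c" by blast+
qed

context cell_graph
begin

lemma port_bits_ok_torus_iff:
  assumes "C = R * W" "nxt = torus_nxt R W"
  shows "port_bits_ok p \<longleftrightarrow> (\<forall>a<R. \<forall>j<W.
    cell_rel (kind (a * W + j)) (p (a * W + j) 0) (p (a * W + j) 1) (p (a * W + j) 2)
      (p (a * W + j) 3) \<and>
    p (a * W + (j + 1) mod W) 0 = p (a * W + j) 1 \<and> p ((a + 1) mod R * W + j) 2 = p (a * W + j) 3)"
proof -
  have "port_bits_ok p \<longleftrightarrow> (\<forall>a<R. \<forall>j<W. let c = a * W + j in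
    cell_rel (kind c) (p c 0) (p c 1) (p c 2) (p c 3) \<and>
    (\<forall>d<2. p (torus_nxt R W d c) (2 * d) = p c (2 * d + 1)))"
    unfolding port_bits_ok_def by (simp only: assms all_less_mult_iff Let_def)
  also have "\<dots> \<longleftrightarrow> (\<forall>a<R. \<forall>j<W.
    cell_rel (kind (a * W + j)) (p (a * W + j) 0) (p (a * W + j) 1) (p (a * W + j) 2)
      (p (a * W + j) 3) \<and>
    p (a * W + (j + 1) mod W) 0 = p (a * W + j) 1 \<and> p ((a + 1) mod R * W + j) 2 = p (a * W + j) 3)"
    unfolding Let_def all_less_2
    by (intro all_cong) (simp add: torus_nxt_index del: One_nat_def)
  finally show ?thesis .
qed

text \<open>As the left and right ports of a cell carry the same bit, there is one horizontal bit per
  row.\<close>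

lemma ex_port_bits_torus_iff:
  assumes torus: "C = R * W" "nxt = torus_nxt R W"
  shows "(\<exists>p. port_bits_ok p) \<longleftrightarrow> (\<exists>h V. \<forall>a<R. \<forall>j<W.
    cell_rel (kind (a * W + j)) (h a) (h a) (V a j) (V ((a + 1) mod R) j))"
proof
  assume "\<exists>p. port_bits_ok p"
  then obtain p where p: "port_bits_ok p" ..
  have rel: "cell_rel (kind (a * W + j)) (p (a * W + j) 0) (p (a * W + j) 1) (p (a * W + j) 2)
      (p (a * W + j) 3)"
    and right: "p (a * W + (j + 1) mod W) 0 = p (a * W + j) 1"
    and lower: "p ((a + 1) mod R * W + j) 2 = p (a * W + j) 3" if "a < R" "j < W" for a j
    using port_bits_ok_torus_iff[OF torus, THEN iffD1, OF p] that by blast+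
  have left_right: "p (a * W + j) 0 = p (a * W + j) 1" if "a < R" "j < W" for a j
    using rel[OF that] by (cases "kind (a * W + j)") simp_all
  have row: "p (a * W + j) 0 = p (a * W) 0" if a: "a < R" and j: "j < W" for a j
    using j
  proof (induction j)
    case (Suc j)
    then have "p (a * W + Suc j) 0 = p (a * W + j) 1" using right[OF a, of j] by simp
    then show ?case using Suc left_right[OF a, of j] by simp
  qed simp
  have "cell_rel (kind (a * W + j)) (p (a * W) 0) (p (a * W) 0) (p (a * W + j) 2)
      (p ((a + 1) mod R * W + j) 2)"
    if "a < R" "j < W" for a j
    using rel[OF that] left_right[OF that] row[OF that] lower[OF that] by simp
  then show "\<exists>h V. \<forall>a<R. \<forall>j<W. cell_rel (kind (a * W + j)) (h a) (h a) (V a j)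
      (V ((a + 1) mod R) j)"
    by (intro exI[of _ "\<lambda>a. p (a * W) 0"] exI[of _ "\<lambda>a j. p (a * W + j) 2"]) blast
next
  assume "\<exists>h V. \<forall>a<R. \<forall>j<W. cell_rel (kind (a * W + j)) (h a) (h a) (V a j) (V ((a + 1) mod R) j)"
  then obtain h V where rel: "cell_rel (kind (a * W + j)) (h a) (h a) (V a j) (V ((a + 1) mod R) j)"
    if "a < R" "j < W" for a j by blast
  define p where "p c i = (let a = c div W; j = c mod W in
    if i < 2 then h a else if i = 2 then V a j else V ((a + 1) mod R) j)" for c and i :: nat
  have p: "p (a * W + j) i = (if i < 2 then h a else if i = 2 then V a j else V ((a + 1) mod R) j)"
    if "j < W" for a j i
    unfolding p_def Let_def div_mult_add_less[OF that] mod_mult_add_less[OF that] ..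
  have "port_bits_ok p"
    unfolding port_bits_ok_torus_iff[OF torus] using rel by (simp add: p)
  then show "\<exists>p. port_bits_ok p" by blast
qed

end

section \<open>Satisfiability as a grid of cells\<close>

text \<open>Row 0 carries a reference bit, row \<open>v + 1\<close> the variable \<open>v\<close>, which is true iff its bit
  agrees with the reference bit. In the column of an active clause a bit travels downwards from
  row 0. It arrives at row 0 again inverted, and only a cell of a true literal allows the change.\<close>

definition column_cell :: "bool \<Rightarrow> bool \<Rightarrow> (nat \<Rightarrow> bool) \<Rightarrow> nat \<Rightarrow> cell" where
  "column_cell active pos occurs a =
      (if a = 0 then if active then if pos then Positive else Negative else Wire
     else if occurs (a - 1) then Literal else Wire)"

text \<open>\<open>h a\<close> is the horizontal bit of row \<open>a\<close> and \<open>V a\<close> the vertical bit above it.\<close>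

definition column_ok :: "nat \<Rightarrow> bool \<Rightarrow> bool \<Rightarrow> (nat \<Rightarrow> bool) \<Rightarrow> (nat \<Rightarrow> bool) \<Rightarrow> (nat \<Rightarrow> bool) \<Rightarrow> bool"
  where
  "column_ok N active pos occurs h V \<longleftrightarrow> (\<forall>a\<le>N.
     cell_rel (column_cell active pos occurs a) (h a) (h a) (V a) (V ((a + 1) mod Suc N)))"

lemma column_true_literal:
  assumes "column_ok N True pos occurs h V"
  shows "\<exists>v<N. occurs v \<and> (h (Suc v) = h 0) = pos"
proof (rule ccontr)
  assume false: "\<not> (\<exists>v<N. occurs v \<and> (h (Suc v) = h 0) = pos)"
  let ?y = "h 0 = pos"
  have V: "cell_rel (column_cell True pos occurs a) (h a) (h a) (V a) (V ((a + 1) mod Suc N))"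
    if "a \<le> N" for a
    using assms that unfolding column_ok_def by blast
  have start: "V (1 mod Suc N) = ?y" "V 0 = (\<not> ?y)"
    using V[of 0] by (cases pos; simp add: column_cell_def)+
  have "V ((a + 1) mod Suc N) = ?y" if "a \<le> N" for a
    using that
  proof (induction a)
    case 0
    show ?case using start(1) by simp
  next
    case (Suc a)
    then have "V (Suc a) = ?y" by simp
    moreover have "occurs a \<Longrightarrow> h (Suc a) \<noteq> ?y" using false Suc.prems by auto
    ultimately show ?case using V[OF Suc.prems] by (auto simp: column_cell_def split: if_splits)
  qed
  from this[of N] have "V 0 = ?y" by simp
  with start(2) show False by blast
qed

lemma column_of_true_literal:
  assumes "active \<Longrightarrow> v < N \<and> occurs v \<and> (h (Suc v) = h 0) = pos"
  shows "\<exists>V. column_ok N active pos occurs h V"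
  unfolding column_ok_def
proof (intro exI allI impI)
  let ?y = "h 0 = pos"
  let ?V = "\<lambda>a. active \<and> (if 0 < a \<and> a \<le> Suc v then ?y else \<not> ?y)"
  fix a assume a: "a \<le> N"
  have next_row: "(a + 1) mod Suc N = (if a = N then 0 else Suc a)" using a by simp
  consider (top) "a = 0" | (true_literal) "a = Suc v" "active"
    | (other) "0 < a" "a \<noteq> Suc v \<or> \<not> active" by linarith
  then show "cell_rel (column_cell active pos occurs a) (h a) (h a) (?V a) (?V ((a + 1) mod Suc N))"
  proof cases
    case top
    then show ?thesis using assms unfolding next_row by (auto simp: column_cell_def)
  next
    case true_literal
    then show ?thesis using assms unfolding next_row by (auto simp: column_cell_def)
  next
    case other
    then have "?V ((a + 1) mod Suc N) = ?V a" using assms a unfolding next_row by auto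
    then show ?thesis using other unfolding column_cell_def by auto
  qed
qed

lemma column_iff:
  "(\<exists>V. column_ok N active pos occurs h V) \<longleftrightarrow>
   (active \<longrightarrow> (\<exists>v<N. occurs v \<and> (h (Suc v) = h 0) = pos))"
proof (intro iffI impI)
  assume "\<exists>V. column_ok N active pos occurs h V" and active
  then obtain V where "column_ok N True pos occurs h V" by auto
  then show "\<exists>v<N. occurs v \<and> (h (Suc v) = h 0) = pos" by (rule column_true_literal)
next
  assume "active \<longrightarrow> (\<exists>v<N. occurs v \<and> (h (Suc v) = h 0) = pos)"
  then obtain v where "active \<Longrightarrow> v < N \<and> occurs v \<and> (h (Suc v) = h 0) = pos" by blast
  then show "\<exists>V. column_ok N active pos occurs h V" by (rule column_of_true_literal)
qed

definition clause_cell :: "nat \<Rightarrow> (nat \<Rightarrow> bool) \<Rightarrow> (nat \<Rightarrow> bool) \<Rightarrow> (nat \<Rightarrow> nat \<Rightarrow> bool) \<Rightarrow> nat \<Rightarrow> cell"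
  where
  "clause_cell W active pos occurs c =
     column_cell (active (c mod W)) (pos (c mod W)) (\<lambda>v. occurs v (c mod W)) (c div W)"

lemma satisfiable_iff_reference_bit:
  "satisfiable N W active pos occurs \<longleftrightarrow>
   (\<exists>h :: nat \<Rightarrow> bool. \<forall>j<W. active j \<longrightarrow> (\<exists>v<N. occurs v j \<and> (h (Suc v) = h 0) = pos j))"
proof
  assume "satisfiable N W active pos occurs"
  then obtain \<alpha> where \<alpha>: "\<forall>j<W. active j \<longrightarrow> (\<exists>v<N. occurs v j \<and> \<alpha> v = pos j)"
    unfolding satisfiable_def ..
  show "\<exists>h :: nat \<Rightarrow> bool. \<forall>j<W. active j \<longrightarrow> (\<exists>v<N. occurs v j \<and> (h (Suc v) = h 0) = pos j)"
    by (rule exI[of _ "\<lambda>a. a = 0 \<or> \<alpha> (a - 1)"]) (use \<alpha> in simp)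
next
  assume "\<exists>h :: nat \<Rightarrow> bool. \<forall>j<W. active j \<longrightarrow> (\<exists>v<N. occurs v j \<and> (h (Suc v) = h 0) = pos j)"
  then show "satisfiable N W active pos occurs" unfolding satisfiable_def by (elim exE) (rule exI)
qed

lemma (in cell_graph) lucky_number_clause_cells_iff:
  assumes "C = Suc N * W" "nxt = torus_nxt (Suc N) W" "kind = clause_cell W active pos occurs"
    "0 < W"
  shows "lucky_number graph = 2 \<longleftrightarrow> satisfiable N W active pos occurs"
proof -
  let ?ok = "\<lambda>h V j. column_ok N (active j) (pos j) (\<lambda>v. occurs v j) h V"
  have kind: "kind (a * W + j) = column_cell (active j) (pos j) (\<lambda>v. occurs v j) a" if "j < W"
    for a j
    unfolding assms(3) clause_cell_def div_mult_add_less[OF that] mod_mult_add_less[OF that] ..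
  have "lucky_number graph = 2 \<longleftrightarrow> (\<exists>p. port_bits_ok p)"
    using assms(1,4) by (intro lucky_number_graph_iff) simp
  also have "\<dots> \<longleftrightarrow> (\<exists>h V. \<forall>a<Suc N. \<forall>j<W.
      cell_rel (column_cell (active j) (pos j) (\<lambda>v. occurs v j) a) (h a) (h a)
        (V a j) (V ((a + 1) mod Suc N) j))"
    unfolding ex_port_bits_torus_iff[OF assms(1,2)]
    by (intro ex_cong1 all_cong) (simp only: kind)
  also have "\<dots> \<longleftrightarrow> (\<exists>h V. \<forall>j<W. ?ok h (\<lambda>a. V a j) j)"
    unfolding less_Suc_eq_le column_ok_def by (intro ex_cong1) blast
  also have "\<dots> \<longleftrightarrow> (\<exists>h. \<forall>j<W. \<exists>V. ?ok h V j)"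
  proof (rule ex_cong1, rule iffI)
    fix h assume "\<forall>j<W. \<exists>V. ?ok h V j"
    then obtain V where "\<forall>j<W. ?ok h (V j) j" by metis
    then show "\<exists>V. \<forall>j<W. ?ok h (\<lambda>a. V a j) j" by (intro exI[of _ "\<lambda>a j. V j a"])
  qed blast
  also have "\<dots> \<longleftrightarrow> satisfiable N W active pos occurs"
    unfolding column_iff satisfiable_iff_reference_bit ..
  finally show ?thesis .
qed

context cell_graph
begin

lemma set_nbs_iff:
  "w \<in> set (nbs v) \<longleftrightarrow>
    w div 16 = v div 16 \<and> w mod 16 \<in> set (inner_nbs (kind (v div 16)) ! (v mod 16)) \<or>
    w \<in> set (outer_nbs (v div 16) (v mod 16))"
proof -
  let ?inner = "set (inner_nbs (kind (v div 16)) ! (v mod 16))"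
  have "v mod 16 < 16" by simp
  then have less: "j < 16" if "j \<in> ?inner" for j
    using that inner_nbs_symmetric by blast
  have "w \<in> (+) (16 * (v div 16)) ` ?inner \<longleftrightarrow> w div 16 = v div 16 \<and> w mod 16 \<in> ?inner"
  proof
    assume "w \<in> (+) (16 * (v div 16)) ` ?inner"
    then obtain j where j: "w = 16 * (v div 16) + j" "j \<in> ?inner" by blast
    then have "w div 16 = v div 16" "w mod 16 = j" using less[OF j(2)] by simp_all
    then show "w div 16 = v div 16 \<and> w mod 16 \<in> ?inner" using j(2) by (simp only:)
  next
    assume "w div 16 = v div 16 \<and> w mod 16 \<in> ?inner"
    moreover have "w = 16 * (w div 16) + w mod 16" by (rule mult_div_mod_eq[symmetric])
    ultimately show "w \<in> (+) (16 * (v div 16)) ` ?inner" by (metis imageI)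
  qed
  then show ?thesis by (simp add: nbs_def)
qed

lemma set_outer_nbs_iff:
  "w \<in> set (outer_nbs c i) \<longleftrightarrow> i = 0 \<and> w = 16 * prv 0 c + 11 \<or> i = 2 \<and> w = 16 * prv 1 c + 15 \<or>
    i = 11 \<and> w = 16 * nxt 0 c \<or> i = 15 \<and> w = 16 * nxt 1 c + 2"
  by (auto simp: outer_nbs_def)

end

section \<open>The reduction\<close>

locale np_verifier = verifier +
  fixes p r :: "nat poly"
  assumes halts: "\<And>x u. halts_within M [x, u] (poly r (length x + length u))"
begin

definition cert :: "bool list \<Rightarrow> nat" where
  "cert x = poly p (length x)"

definition time :: "bool list \<Rightarrow> nat" where
  "time x = cert x + poly r (length x + cert x)"

definition items :: "bool list \<Rightarrow> nat" where
  "items x = (time x + 1) * (2 * time x + 1)"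

definition vars :: "bool list \<Rightarrow> nat" where
  "vars x = items x * card tiles"

definition clauses :: "bool list \<Rightarrow> nat" where
  "clauses x = items x + vars x * vars x"

definition active_clause :: "bool list \<Rightarrow> nat \<Rightarrow> bool" where
  "active_clause x = choice_clause (items x) (card tiles) (tile_conflict x (time x) (cert x))"

definition occurs :: "bool list \<Rightarrow> nat \<Rightarrow> nat \<Rightarrow> bool" where
  "occurs x = choice_occurs (items x) (card tiles)"

lemma accepts_iff_satisfiable:
  "(\<exists>u. length u \<le> poly p (length x) \<and> accepts M [x, u]) \<longleftrightarrow>
   satisfiable (vars x) (clauses x) (active_clause x) (\<lambda>j. j < items x) (occurs x)"
proof -
  have "accepts M [x, u] \<longleftrightarrow> fst (run M [x, u] (time x)) = tm_accept M" if "length u \<le> cert x" for u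
  proof (rule accepts_iff_run[OF wf halts])
    have "poly r (length x + length u) \<le> poly r (length x + cert x)" using that
      by (intro poly_nat_mono) simp
    then show "poly r (length x + length u) \<le> time x" by (simp add: time_def)
  qed
  then have "(\<exists>u. length u \<le> poly p (length x) \<and> accepts M [x, u]) \<longleftrightarrow>
      (\<exists>u. length u \<le> cert x \<and> fst (run M [x, u] (time x)) = tm_accept M)"
    by (auto simp: cert_def)
  also have "\<dots> \<longleftrightarrow> (\<exists>g. conflict_free (items x) (card tiles) (tile_conflict x (time x) (cert x)) g)"
    unfolding items_def by (rule accepting_iff_conflict_free) (simp add: time_def)
  also have "\<dots> \<longleftrightarrow> satisfiable (vars x) (clauses x) (active_clause x) (\<lambda>j. j < items x) (occurs x)"
    unfolding vars_def clauses_def active_clause_def occurs_def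
    by (rule satisfiable_choice_iff[symmetric])
  finally show ?thesis .
qed

definition kind :: "bool list \<Rightarrow> nat \<Rightarrow> cell" where
  "kind x = clause_cell (clauses x) (active_clause x) (\<lambda>j. j < items x) (occurs x)"

sublocale grid: cell_graph "Suc (vars x) * clauses x" "torus_nxt (Suc (vars x)) (clauses x)"
  "torus_prv (Suc (vars x)) (clauses x)" "kind x" for x
  by (rule cell_graph_torus)

definition reduction :: "bool list \<Rightarrow> bool list" where
  "reduction x = encode_graph (grid.graph x)"

lemma reduction_correct:
  "reduction x \<in> cubic_lucky_problem \<longleftrightarrow> (\<exists>u. length u \<le> poly p (length x) \<and> accepts M [x, u])"
proof -
  have "0 < clauses x" by (simp add: clauses_def items_def)
  have "reduction x \<in> cubic_lucky_problem \<longleftrightarrow> lucky_number (grid.graph x) = 2"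
    unfolding reduction_def encode_matrix_graph_in_graph_problem_iff[OF grid.pair_graph_graph]
    using grid.regular_graph by simp
  also have "\<dots> \<longleftrightarrow> satisfiable (vars x) (clauses x) (active_clause x) (\<lambda>j. j < items x) (occurs x)"
    using \<open>0 < clauses x\<close>
    by (intro grid.lucky_number_clause_cells_iff refl) (simp_all add: kind_def)
  also have "\<dots> \<longleftrightarrow> (\<exists>u. length u \<le> poly p (length x) \<and> accepts M [x, u])"
    by (rule accepts_iff_satisfiable[symmetric])
  finally show ?thesis .
qed

lemma polytime_fun_sizes:
  "polytime_fun d (\<lambda>z vs. cert (fst z))" "polytime_fun d (\<lambda>z vs. time (fst z))"
  "polytime_fun d (\<lambda>z vs. items (fst z))" "polytime_fun d (\<lambda>z vs. vars (fst z))"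
  "polytime_fun d (\<lambda>z vs. clauses (fst z))"
  unfolding clauses_def vars_def items_def time_def cert_def by (intro polytime_intros)+

lemma polytime_pred_active_clause:
  assumes "polytime_fun d j" shows "polytime_pred d (\<lambda>z vs. active_clause (fst z) (j z vs))"
  unfolding active_clause_def choice_clause_def
  by (intro polytime_pred_tile_conflict polytime_intros polytime_fun_sizes assms)

lemma polytime_pred_occurs:
  assumes "polytime_fun d v" "polytime_fun d j"
  shows "polytime_pred d (\<lambda>z vs. occurs (fst z) (v z vs) (j z vs))"
  unfolding occurs_def choice_occurs_def by (intro polytime_intros polytime_fun_sizes assms)

lemma polytime_pred_kind:
  assumes "polytime_fun d c" shows "polytime_pred d (\<lambda>z vs. kind (fst z) (c z vs) = k)"
proof -
  have "(if b then x else y) = k \<longleftrightarrow> (if b then x = k else y = k)" for b and x y :: cell by simp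
  then show ?thesis
    unfolding kind_def clause_cell_def column_cell_def
    by (simp only:) (intro polytime_pred_active_clause polytime_pred_occurs polytime_intros
        polytime_fun_sizes assms)
qed

lemma polytime_fun_torus:
  assumes "polytime_fun d c"
  shows "polytime_fun d (\<lambda>z vs. torus_nxt (Suc (vars (fst z))) (clauses (fst z)) e (c z vs))"
    "polytime_fun d (\<lambda>z vs. torus_prv (Suc (vars (fst z))) (clauses (fst z)) e (c z vs))"
  unfolding torus_nxt_def torus_prv_def Suc_eq_plus1
  by (intro polytime_intros polytime_fun_sizes assms)+

lemma polytime_pred_inner_nbs:
  assumes "polytime_fun d c" "polytime_fun d v" "polytime_fun d w"
  shows "polytime_pred d (\<lambda>z vs. w z vs mod 16 \<in> set
      (inner_nbs (kind (fst z) (c z vs)) ! (v z vs mod 16)))"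
proof -
  have mod_16: "polytime_pred d (\<lambda>z vs. f z vs mod 16 = a)" "f z vs mod 16 \<in> {..<16}"
    if "polytime_fun d f" for f a z vs
    using that by (auto intro!: polytime_intros)
  have cells: "k \<in> {Literal, Wire, Positive, Negative}" for k by (cases k) simp_all
  have "polytime_pred d (\<lambda>z vs. w z vs mod 16 \<in> set (inner_nbs k ! i))" for k i
    by (rule polytime_pred_finite_range[where Q = "\<lambda>j z vs. j \<in> set (inner_nbs k ! i)",
        OF finite_lessThan mod_16(2)[OF assms(3)] mod_16(1)[OF assms(3)] polytime_pred_const])
  then have "polytime_pred d (\<lambda>z vs. w z vs mod 16 \<in> set (inner_nbs k ! (v z vs mod 16)))" for k
    by (intro polytime_pred_finite_range[where Q = "\<lambda>i z vs. w z vs mod 16 \<in> set (inner_nbs k ! i)",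
        OF finite_lessThan mod_16(2)[OF assms(2)] mod_16(1)[OF assms(2)]])
  then show ?thesis
    by (intro polytime_pred_finite_range[where
        Q = "\<lambda>k z vs. w z vs mod 16 \<in> set (inner_nbs k ! (v z vs mod 16))" and
        f = "\<lambda>z vs. kind (fst z) (c z vs)", OF _ cells polytime_pred_kind[OF assms(1)]]) simp_all
qed

lemma polytime_pred_nbs:
  assumes "polytime_fun d v" "polytime_fun d w"
  shows "polytime_pred d (\<lambda>z vs. w z vs \<in> set (grid.nbs (fst z) (v z vs)))"
  unfolding grid.set_nbs_iff grid.set_outer_nbs_iff
  by (intro polytime_pred_inner_nbs polytime_fun_torus polytime_intros assms)

lemma polytime_reduction: "polytime_computable reduction"
proof -
  have size: "polytime_fun d (\<lambda>z vs. 16 * (Suc (vars (fst z)) * clauses (fst z)))" for d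
    unfolding Suc_eq_plus1 by (intro polytime_intros polytime_fun_sizes)
  show ?thesis
    unfolding reduction_def[abs_def]
    by (intro polytime_computable_encode_matrix_graph size polytime_pred_nbs)
qed

end

lemma cubic_lucky_problem_NP_hard:
  assumes "A \<in> NP" shows "polytime_reducible A cubic_lucky_problem"
proof -
  from assms obtain M and p r :: "nat poly" where M: "tm_wf M" "2 \<le> tm_tapes M"
    "\<forall>x u. halts_within M [x, u] (poly r (length x + length u))"
    and A: "\<forall>x. x \<in> A \<longleftrightarrow> (\<exists>u. length u \<le> poly p (length x) \<and> accepts M [x, u])"
    unfolding NP_def by blast
  interpret np_verifier M p r by unfold_locales (use M in auto)
  have "\<forall>x. x \<in> A \<longleftrightarrow> reduction x \<in> cubic_lucky_problem" using A reduction_correct by blast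
  then show ?thesis unfolding polytime_reducible_def using polytime_reduction by blast
qed

theorem theorem2:
  shows "NP_complete (graph_problem (\<lambda>G. regular 3 G \<and> lucky_number G = 2))"
  unfolding NP_complete_def using cubic_lucky_problem_in_NP cubic_lucky_problem_NP_hard by blast

end
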